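(* Let $T\subset\mathbb{R}^3$ be a nondegenerate tetrahedron with Alfeld split $T^z$ and let $r\ge5$. Then a function $\omega\in M_{d,r}^0(T^z)$ is uniquely determined by the following degrees of freedom (DOFs): (a) $D^\alpha\omega(a)$ for all $|\alpha|\le2$, $a\in\Delta_0(T)$ ($40$ DOFs); (b) $\int_e\omega\,\sigma\,ds$ for all $\sigma\in\mathcal{P}_{r-6}(e)$, $e\in\Delta_1(T)$ ($6(r-5)$ DOFs); (c) $\int_e\frac{\partial\omega}{\partial n_e^{\pm}}\sigma\,ds$ for all $\sigma\in\mathcal{P}_{r-5}(e)$, $e\in\Delta_1(T)$ ($12(r-4)$ DOFs); (d) $\int_F\omega\,\sigma\,dA$ for all $\sigma\in\mathcal{P}_{r-6}(F)$, $F\in\Delta_2(T)$ ($4\frac{(r-5)(r-4)}2$ DOFs); (e) $\int_F\frac{\partial\omega}{\partial n_F}\sigma\,dA$ for all $\sigma\in\mathcal{P}_{r-4}(F)$, $F\in\Delta_2(T)$ ($4\frac{(r-3)(r-2)}2$ DOFs); (f) $\int_T\operatorname{grad}\omega\cdot\operatorname{grad}\sigma\,dx$ for all $\sigma\in\mathring{M}_{d,r}^0(T^z)$ ($2\frac{(r-4)(r-3)(r-2)}3$ DOFs). In the case $r=5$ the sets (b) and (d) are omitted.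
   Context: Let $T=[x_0,x_1,x_2,x_3]\subset\mathbb{R}^3$ be a nondegenerate tetrahedron with barycenter $z$. The Alfeld split is $T^z=\{T_0,\dots,T_3\}$, where $T_i$ is obtained from $T$ by replacing the vertex $x_i$ by $z$. $\Delta_s(T)$ is the set of $s$-dimensional subsimplices of $T$ (vertices, edges, faces for $s=0,1,2$). $\mathcal{P}_r(S)$ denotes polynomials of total degree at most $r$ on a simplex $S$, $\{0\}$ if $r<0$. $C^0(T)$ means continuous on the closed tetrahedron. $M_{d,r}^0(T^z)=\{\omega\in C^0(T):\omega|_{T_i}\in\mathcal{P}_r(T_i),\ 0\le i\le3,\ \operatorname{grad}\omega\in[C^0(T)]^3\}$; $\mathring{M}_{d,r}^0(T^z)=\{\omega\in M_{d,r}^0(T^z):\omega=0\text{ and }\operatorname{grad}\omega=0\text{ on }\partial T\}$. Functions in $M_{d,r}^0(T^z)$ are $C^2$ at the vertices of $T$, so the values $D^\alpha\omega(a)$ are well defined. $n_F$ is the outward unit normal to the face $F$; $n_e^{+},n_e^{-}$ are two orthonormal vectors orthogonal to the edge $e$. "($N$ DOFs)" is the number of scalar conditions obtained when test functions run through a basis. "Uniquely determined" means that two elements of the space with the same values of all the DOFs coincide. *)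

theory Defs
  imports "HOL-Analysis.Analysis" "HOL-Library.Function_Algebras"
begin

section \<open>Functions on a subset of space\<close>

text \<open>A real function with domain \<open>S\<close> is represented by a function on the whole space that
  vanishes off \<open>S\<close>.  Thus equality of functions on \<open>S\<close> is equality in HOL, and spaces of
  functions on \<open>S\<close> have their true dimension.\<close>

definition restr :: "(real^3) set \<Rightarrow> (real^3 \<Rightarrow> real) \<Rightarrow> real^3 \<Rightarrow> real" where
  "restr S f = (\<lambda>y. if y \<in> S then f y else 0)"

lemma vector_space_fun: "vector_space (\<lambda>(c::real) (f :: real^3 \<Rightarrow> real) y. c * f y)"
  by unfold_locales (auto simp: fun_eq_iff algebra_simps)

definition fun_dim :: "(real^3 \<Rightarrow> real) set \<Rightarrow> nat" where
  "fun_dim = vector_space.dim (\<lambda>(c::real) (f :: real^3 \<Rightarrow> real) y. c * f y)"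

definition mi_order :: "nat^3 \<Rightarrow> nat" where
  "mi_order \<alpha> = (\<Sum>i\<in>UNIV. \<alpha> $ i)"

text \<open>The degree bound \<open>k\<close> is an integer; for \<open>k < 0\<close> the sum is empty and the space is \<open>{0}\<close>.\<close>

definition polys :: "int \<Rightarrow> (real^3) set \<Rightarrow> (real^3 \<Rightarrow> real) set" where
  "polys k S =
    {restr S (\<lambda>y. \<Sum>\<alpha> | int (mi_order \<alpha>) \<le> k. c \<alpha> * (\<Prod>i\<in>UNIV. (y $ i) ^ (\<alpha> $ i))) | c. True}"

section \<open>Derivatives on a closed body\<close>

text \<open>Derivatives are taken within the closed set \<open>T\<close>.  For a tetrahedron the derivative within
  \<open>T\<close> is unique at every point of \<open>T\<close>, vertices included.  A function on \<open>T\<close> is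
  differentiable within \<open>T\<close> with continuous gradient iff it is \<open>C\<^sup>1\<close> inside and its gradient
  extends continuously to \<open>T\<close>; at a boundary point the value is that extension.\<close>

definition partial_der :: "(real^3) set \<Rightarrow> 3 \<Rightarrow> (real^3 \<Rightarrow> real) \<Rightarrow> real^3 \<Rightarrow> real" where
  "partial_der T j f = (\<lambda>y. frechet_derivative f (at y within T) (axis j 1))"

definition grad :: "(real^3) set \<Rightarrow> (real^3 \<Rightarrow> real) \<Rightarrow> real^3 \<Rightarrow> real^3" where
  "grad T f = (\<lambda>y. \<chi> j. partial_der T j f y)"

definition mi_der :: "(real^3) set \<Rightarrow> nat^3 \<Rightarrow> (real^3 \<Rightarrow> real) \<Rightarrow> real^3 \<Rightarrow> real" where
  "mi_der T \<alpha> f =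
    (partial_der T 1 ^^ (\<alpha> $ 1)) ((partial_der T 2 ^^ (\<alpha> $ 2)) ((partial_der T 3 ^^ (\<alpha> $ 3)) f))"

section \<open>The tetrahedron and its Alfeld split\<close>

definition tetra :: "(nat \<Rightarrow> real^3) \<Rightarrow> (real^3) set" where
  "tetra x = convex hull (x ` {..3})"

definition nondegenerate :: "(nat \<Rightarrow> real^3) \<Rightarrow> bool" where
  "nondegenerate x \<longleftrightarrow> inj_on x {..3} \<and> \<not> affine_dependent (x ` {..3})"

definition barycenter :: "(nat \<Rightarrow> real^3) \<Rightarrow> real^3" where
  "barycenter x = (1/4) *\<^sub>R (\<Sum>i\<le>3. x i)"

definition alfeld_cell :: "(nat \<Rightarrow> real^3) \<Rightarrow> nat \<Rightarrow> (real^3) set" where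
  "alfeld_cell x i = tetra (x(i := barycenter x))"

text \<open>Edges and faces are indexed by their vertex numbers in increasing order.\<close>

definition edges :: "(nat \<times> nat) set" where
  "edges = {(i, j). i < j \<and> j \<le> 3}"

definition faces :: "(nat \<times> nat \<times> nat) set" where
  "faces = {(i, j, k). i < j \<and> j < k \<and> k \<le> 3}"

definition edge_of_tetra :: "(nat \<Rightarrow> real^3) \<Rightarrow> nat \<times> nat \<Rightarrow> (real^3) set" where
  "edge_of_tetra x = (\<lambda>(i, j). convex hull {x i, x j})"

definition face_of_tetra :: "(nat \<Rightarrow> real^3) \<Rightarrow> nat \<times> nat \<times> nat \<Rightarrow> (real^3) set" where
  "face_of_tetra x = (\<lambda>(i, j, k). convex hull {x i, x j, x k})"

text \<open>Arc length and surface integrals through the affine parametrisation of the edge by \<open>[0,1]\<close>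
  and of the face by the unit triangle; the factor is the Jacobian.\<close>

definition edge_integral ::
    "(nat \<Rightarrow> real^3) \<Rightarrow> nat \<times> nat \<Rightarrow> (real^3 \<Rightarrow> real) \<Rightarrow> real" where
  "edge_integral x = (\<lambda>(i, j) f.
     norm (x j - x i) * integral {0..1} (\<lambda>t::real. f (x i + t *\<^sub>R (x j - x i))))"

definition face_integral ::
    "(nat \<Rightarrow> real^3) \<Rightarrow> nat \<times> nat \<times> nat \<Rightarrow> (real^3 \<Rightarrow> real) \<Rightarrow> real" where
  "face_integral x = (\<lambda>(i, j, k) f.
     norm (cross3 (x j - x i) (x k - x i)) *
     integral {(s::real, t::real). 0 \<le> s \<and> 0 \<le> t \<and> s + t \<le> 1}
       (\<lambda>(s, t). f (x i + s *\<^sub>R (x j - x i) + t *\<^sub>R (x k - x i))))"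

definition outward_unit_normal :: "(real^3) set \<Rightarrow> (real^3) set \<Rightarrow> real^3 \<Rightarrow> bool" where
  "outward_unit_normal T F n \<longleftrightarrow> norm n = 1 \<and>
     (\<forall>p\<in>F. \<forall>q\<in>F. n \<bullet> (q - p) = 0) \<and> (\<forall>p\<in>F. \<forall>q\<in>T. n \<bullet> (q - p) \<le> 0)"

definition orthonormal_normals :: "(real^3) set \<Rightarrow> real^3 \<Rightarrow> real^3 \<Rightarrow> bool" where
  "orthonormal_normals e n m \<longleftrightarrow> norm n = 1 \<and> norm m = 1 \<and> n \<bullet> m = 0 \<and>
     (\<forall>p\<in>e. \<forall>q\<in>e. n \<bullet> (q - p) = 0 \<and> m \<bullet> (q - p) = 0)"

section \<open>The spline spaces\<close>

definition M_space :: "nat \<Rightarrow> (nat \<Rightarrow> real^3) \<Rightarrow> (real^3 \<Rightarrow> real) set" where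
  "M_space r x = {\<omega>. (\<forall>y. y \<notin> tetra x \<longrightarrow> \<omega> y = 0) \<and>
     continuous_on (tetra x) \<omega> \<and>
     (\<forall>i\<le>3. restr (alfeld_cell x i) \<omega> \<in> polys (int r) (alfeld_cell x i)) \<and>
     \<omega> differentiable_on tetra x \<and> continuous_on (tetra x) (grad (tetra x) \<omega>)}"

definition M_ring_space :: "nat \<Rightarrow> (nat \<Rightarrow> real^3) \<Rightarrow> (real^3 \<Rightarrow> real) set" where
  "M_ring_space r x = {\<omega> \<in> M_space r x.
     \<forall>y \<in> frontier (tetra x). \<omega> y = 0 \<and> grad (tetra x) \<omega> y = 0}"

end

theory Submission
  imports Defs
begin

text \<open>Let \<open>lam 0, \<dots>, lam 3\<close> be the barycentric coordinates of \<open>T\<close>.  The cell \<open>T_i\<close> is the part of \<open>T\<close>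
on which \<open>lam i\<close> is the smallest coordinate, so two cells \<open>T_i\<close> and \<open>T_j\<close> meet in the plane
\<open>lam i = lam j\<close>.  A spline is therefore a family of four polynomials \<open>f i\<close>, one for each cell, and
it is \<open>C\<^sup>1\<close> if and only if \<open>(lam i - lam j)\<^sup>2\<close> divides \<open>f i - f j\<close> for all \<open>i, j\<close>
(\<open>M_space_iff\<close>).  From here on everything is divisibility of polynomials by affine functions.

Vertices.  Three pieces meet at a vertex.  Their differences are \<open>u\<^sup>2 q\<^sub>1\<close>, \<open>v\<^sup>2 q\<^sub>2\<close> and
\<open>(u + v)\<^sup>2 q\<^sub>3\<close> up to signs and add up to zero; as \<open>u\<^sup>2\<close>, \<open>v\<^sup>2\<close>, \<open>(u + v)\<^sup>2\<close> are linearly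
independent, all \<open>q\<close> vanish at the vertex and the three Hessians agree (\<open>C2_at_vertex\<close>).

Unisolvence.  Let \<open>h\<close> be the difference of two splines with the same degrees of freedom.
On an edge with parameter \<open>t\<close> the vertex values give \<open>h = t\<^sup>3 (1 - t)\<^sup>3 q\<close>, and \<open>q\<close>, of degree
at most \<open>r - 6\<close>, is an admissible test function; hence the integral of \<open>t\<^sup>3 (1 - t)\<^sup>3 q\<^sup>2\<close> is zero
and so is \<open>q\<close>.  In the same way the normal derivatives \<open>t\<^sup>2 (1 - t)\<^sup>2 q\<close> vanish, so \<open>h\<close> and its
gradient vanish on the edges.  On a face, with \<open>b\<close> the product of its three barycentric
coordinates, \<open>h = b\<^sup>2 q\<close> and the normal derivative is \<open>b q\<close>, and the argument repeats.  Thus \<open>h\<close>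
lies in the space of splines that vanish on the boundary with their gradients, it is a test
function for the last set of conditions, and its gradient has norm zero (\<open>unisolvence\<close>).

Dimension.  The boundary space is filtered by the order \<open>k \<ge> 2\<close> to which splines vanish on the
boundary: the pieces are \<open>lam i ^ k * h i\<close>.  The smoothness across the interior planes forces the
leading coefficient \<open>h i\<close> to vanish on the edges of the face \<open>lam i = 0\<close>
(\<open>leading_coeff_vanishes_on_edges\<close>), so on that face it is the product of the three other
coordinates with a polynomial of degree \<open>r - k - 3\<close> in two variables.  All of these occur.  For a
vertex number \<open>m\<close> take as piece on the cell \<open>T_j\<close> the integral over \<open>[0, lam j]\<close> of
\<open>t ^ (k - 1)\<close> times the product of the three \<open>t - lam i\<close> with \<open>i \<noteq> m\<close>.  Two pieces differ by an
integral over \<open>[lam j, lam i]\<close> of a function that vanishes at one end at least, so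
\<open>(lam i - lam j)\<^sup>2\<close> divides the difference; and its leading coefficient vanishes on all faces but
\<open>lam m = 0\<close>.  Multiples of these splines span each quotient of the filtration
(\<open>fin_dim_level_step\<close>), which has dimension \<open>4\<close> times \<open>(r - k - 1) choose 2\<close>, and the sum over
\<open>k \<ge> 2\<close> is \<open>4\<close> times \<open>(r - 2) choose 3\<close>.\<close>

section \<open>Polynomial functions of bounded degree\<close>

text \<open>The degree is an integer so that degrees can be lowered by division without side conditions:
below zero only the zero function is left.  A definition without coordinates lets polynomials be
restricted along affine maps from a line or a plane.\<close>

inductive Pol :: "int \<Rightarrow> ('a::real_normed_vector \<Rightarrow> real) \<Rightarrow> bool" where
  zero: "Pol k (\<lambda>_. 0)"
| const: "0 \<le> k \<Longrightarrow> Pol k (\<lambda>_. c)"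
| add: "Pol k p \<Longrightarrow> Pol k q \<Longrightarrow> Pol k (\<lambda>y. p y + q y)"
| lin: "Pol k p \<Longrightarrow> bounded_linear l \<Longrightarrow> Pol (k + 1) (\<lambda>y. l y * p y)"

lemma Pol_neg: "Pol k p \<Longrightarrow> k < 0 \<Longrightarrow> p = (\<lambda>_. 0)"
  by (induction rule: Pol.induct) auto

lemma Pol_mono: "Pol k p \<Longrightarrow> k \<le> k' \<Longrightarrow> Pol k' p"
proof (induction arbitrary: k' rule: Pol.induct)
  case (lin k p l)
  then have "Pol (k' - 1) p" by simp
  from Pol.lin[OF this lin.hyps(2)] show ?case by simp
qed (auto intro: Pol.intros)

lemma Pol_cmul: "Pol k p \<Longrightarrow> Pol k (\<lambda>y. c * p y)"
proof (induction rule: Pol.induct)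
  case (lin k p l)
  from Pol.lin[OF lin.IH lin.hyps(2)] show ?case by (simp add: mult.left_commute)
qed (auto intro: Pol.intros simp: distrib_left)

lemma Pol_mult: "Pol j p \<Longrightarrow> Pol k q \<Longrightarrow> Pol (j + k) (\<lambda>y. p y * q y)"
proof (induction rule: Pol.induct)
  case (const j c)
  then show ?case by (intro Pol_cmul Pol_mono[OF const.prems]) simp
next
  case (lin j p l)
  from Pol.lin[OF lin.IH[OF lin.prems] lin.hyps(2)] show ?case
    by (simp add: mult.assoc algebra_simps)
qed (auto intro: Pol.intros simp: distrib_right)

lemma Pol_diff: "Pol k p \<Longrightarrow> Pol k q \<Longrightarrow> Pol k (\<lambda>y. p y - q y)"
  using Pol.add[OF _ Pol_cmul[of k q "-1"]] by simp

lemma Pol_sum: "(\<And>i. i \<in> I \<Longrightarrow> Pol k (f i)) \<Longrightarrow> Pol k (\<lambda>y. \<Sum>i\<in>I. f i y)"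
  by (induction I rule: infinite_finite_induct) (auto intro: Pol.intros)

definition affine_fun :: "('a::real_normed_vector \<Rightarrow> 'b::real_normed_vector) \<Rightarrow> bool" where
  "affine_fun f \<longleftrightarrow> (\<exists>c l. bounded_linear l \<and> f = (\<lambda>y. c + l y))"

lemma Pol_affine: assumes "affine_fun A" shows "Pol 1 A"
proof -
  obtain c l where l: "bounded_linear l" "A = (\<lambda>y. c + l y)"
    using assms by (auto simp: affine_fun_def)
  have "Pol 1 (\<lambda>y. c + l y * 1)"
    using Pol.add[OF Pol.const[of 1 c] Pol.lin[OF Pol.const[of 0 1] l(1), simplified]] by simp
  then show ?thesis by (simp add: l(2))
qed

lemma Pol_power: "Pol j p \<Longrightarrow> Pol (int n * j) (\<lambda>y. p y ^ n)"
proof (induction n)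
  case (Suc n)
  from Pol_mult[OF Suc.prems Suc.IH[OF Suc.prems]] show ?case
    by (simp add: algebra_simps)
qed (auto intro: Pol.intros)

lemma Pol_affine_power: "affine_fun A \<Longrightarrow> Pol (int n) (\<lambda>y. A y ^ n)"
  using Pol_power[OF Pol_affine, of A n] by simp

lemma Pol_compose: assumes "Pol k p" "affine_fun f" shows "Pol k (\<lambda>y. p (f y))"
proof -
  obtain c l where l: "bounded_linear l" "f = (\<lambda>y. c + l y)"
    using assms by (auto simp: affine_fun_def)
  from assms(1) show ?thesis
  proof (induction rule: Pol.induct)
    case (lin k p m)
    interpret m: bounded_linear m by fact
    have "affine_fun (\<lambda>y. m (f y))"
      unfolding affine_fun_def l(2)
      by (rule exI[of _ "m c"], rule exI[of _ "\<lambda>y. m (l y)"])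
        (auto simp: m.add intro: bounded_linear_compose[OF lin.hyps(2) l(1)])
    from Pol_mult[OF Pol_affine[OF this] lin.IH] show ?case by (simp add: add.commute)
  qed (auto intro: Pol.intros)
qed

lemma affine_fun_const: "affine_fun (\<lambda>_. c)"
  unfolding affine_fun_def by (rule exI[of _ c], rule exI[of _ "\<lambda>_. 0"]) auto

lemma affine_fun_linear: "bounded_linear l \<Longrightarrow> affine_fun l"
  unfolding affine_fun_def by (rule exI[of _ 0], rule exI[of _ l]) auto

lemma affine_fun_add: "affine_fun f \<Longrightarrow> affine_fun g \<Longrightarrow> affine_fun (\<lambda>y. f y + g y)"
proof -
  assume "affine_fun f" "affine_fun g"
  then obtain c l d m where "bounded_linear l" "f = (\<lambda>y. c + l y)" "bounded_linear m" "g = (\<lambda>y. d + m y)"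
    by (auto simp: affine_fun_def)
  then show ?thesis unfolding affine_fun_def
    by (intro exI[of _ "c + d"] exI[of _ "\<lambda>y. l y + m y"]) (auto simp: bounded_linear_add)
qed

lemma affine_fun_compose: "affine_fun f \<Longrightarrow> affine_fun g \<Longrightarrow> affine_fun (\<lambda>y. f (g y))"
proof -
  assume "affine_fun f" "affine_fun g"
  then obtain c l d m where *: "bounded_linear l" "f = (\<lambda>y. c + l y)" "bounded_linear m" "g = (\<lambda>y. d + m y)"
    by (auto simp: affine_fun_def)
  interpret l: bounded_linear l by fact
  show ?thesis unfolding affine_fun_def
    by (intro exI[of _ "c + l d"] exI[of _ "\<lambda>y. l (m y)"])
      (auto simp: * l.add intro: bounded_linear_compose)
qed

lemma affine_fun_scaleR: "affine_fun f \<Longrightarrow> affine_fun (\<lambda>y. f y *\<^sub>R v)"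
  by (rule affine_fun_compose[of "\<lambda>t. t *\<^sub>R v"])
     (auto intro: affine_fun_linear bounded_linear_scaleR_left)

lemma affine_fun_cmul: "affine_fun f \<Longrightarrow> affine_fun (\<lambda>y. c *\<^sub>R f y)"
  by (rule affine_fun_compose[of "\<lambda>t. c *\<^sub>R t"])
     (auto intro: affine_fun_linear bounded_linear_scaleR_right)

lemma affine_fun_diff: "affine_fun f \<Longrightarrow> affine_fun g \<Longrightarrow> affine_fun (\<lambda>y. f y - g y)"
  using affine_fun_add[of f "\<lambda>y. (-1) *\<^sub>R g y"] affine_fun_cmul[of g "-1"] by simp

lemma affine_fun_id: "affine_fun (\<lambda>y. y)"
  by (auto intro: affine_fun_linear bounded_linear_ident)

lemma affine_fun_fst: "affine_fun fst" and affine_fun_snd: "affine_fun snd"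
  by (auto intro: affine_fun_linear bounded_linear_fst bounded_linear_snd)

lemmas affine_intros = affine_fun_const affine_fun_add affine_fun_diff affine_fun_scaleR affine_fun_cmul
  affine_fun_id affine_fun_fst affine_fun_snd

lemma affine_fun_line:
  assumes "affine_fun A" shows "A (a + t *\<^sub>R (b - a)) = A a + t *\<^sub>R (A b - A a)"
proof -
  obtain c l where l: "bounded_linear l" "A = (\<lambda>y. c + l y)"
    using assms by (auto simp: affine_fun_def)
  interpret bounded_linear l by fact
  show ?thesis by (simp add: l(2) add diff scaleR)
qed

lemma affine_zero_set:
  fixes A :: "'a::real_normed_vector \<Rightarrow> real"
  assumes "affine_fun A" shows "affine {y. A y = 0}"
  unfolding affine_alt
proof (intro ballI allI)
  fix a b u assume "a \<in> {y. A y = 0}" "b \<in> {y. A y = 0}"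
  moreover have "(1 - u) *\<^sub>R a + u *\<^sub>R b = a + u *\<^sub>R (b - a)" by (simp add: algebra_simps)
  ultimately show "(1 - u) *\<^sub>R a + u *\<^sub>R b \<in> {y. A y = 0}"
    using affine_fun_line[OF assms, of a u b] by simp
qed

text \<open>Along the projection \<open>y - A y *\<^sub>R v\<close> a polynomial changes by a multiple of \<open>A\<close>; this is clear for
linear functions and inherited by sums and products.  If \<open>v\<close> has \<open>A\<close>-slope one, the projection
maps onto the plane \<open>A = 0\<close> and the identity is division with remainder by \<open>A\<close>.\<close>

lemma Pol_project:
  assumes "Pol d p" "affine_fun A"
  shows "\<exists>q. Pol (d - 1) q \<and> (\<forall>y. p y = p (y - A y *\<^sub>R v) + A y * q y)"
  using assms(1)
proof (induction rule: Pol.induct)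
  case (zero k) then show ?case by (intro exI[of _ "\<lambda>_. 0"]) (auto intro: Pol.intros)
next
  case (const k c) then show ?case by (intro exI[of _ "\<lambda>_. 0"]) (auto intro: Pol.intros)
next
  case (add k p q)
  then obtain a b where a: "Pol (k-1) a" "\<And>y. p y = p (y - A y *\<^sub>R v) + A y * a y"
    and b: "Pol (k-1) b" "\<And>y. q y = q (y - A y *\<^sub>R v) + A y * b y" by blast
  have "p y + q y = p (y - A y *\<^sub>R v) + q (y - A y *\<^sub>R v) + A y * (a y + b y)" for y
    unfolding distrib_left by (rule trans[OF arg_cong2[of _ _ _ _ "(+)", OF a(2) b(2)]]) (simp only: add_ac)
  with Pol.add[OF a(1) b(1)] show ?case by (intro exI[of _ "\<lambda>y. a y + b y"] conjI allI)
next
  case (lin k p l)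
  interpret l: bounded_linear l by fact
  obtain a where a: "Pol (k-1) a" "\<And>y. p y = p (y - A y *\<^sub>R v) + A y * a y" using lin by blast
  have 1: "Pol k (\<lambda>y. l y * a y)" using Pol.lin[OF a(1) lin.hyps(2)] by simp
  have 2: "Pol k (\<lambda>y. l v * p (y - A y *\<^sub>R v))"
    by (intro Pol_cmul Pol_compose[OF lin.hyps(1), of "\<lambda>y. y - A y *\<^sub>R v"] affine_intros assms)
  have "l y * p y = l (y - A y *\<^sub>R v) * p (y - A y *\<^sub>R v) + A y * (l y * a y + l v * p (y - A y *\<^sub>R v))" for y
  proof -
    define P where "P = p (y - A y *\<^sub>R v)"
    have 1: "p y = P + A y * a y" using a(2)[of y] unfolding P_def .
    have 2: "l (y - A y *\<^sub>R v) = l y - A y * l v" by (simp add: l.diff l.scaleR)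
    show ?thesis unfolding P_def[symmetric] 1 2 by (simp add: distrib_left distrib_right left_diff_distrib)
  qed
  moreover have "Pol (k + 1 - 1) (\<lambda>y. l y * a y + l v * p (y - A y *\<^sub>R v))"
    using Pol.add[OF 1 2] by simp
  ultimately show ?case by blast
qed

lemma affine_fun_direction:
  assumes "affine_fun A" "A a \<noteq> (A b :: real)"
  obtains v where "\<And>y t. A (y + t *\<^sub>R v) = A y + t"
proof -
  obtain c l where l: "bounded_linear l" "A = (\<lambda>y. c + l y)"
    using assms by (auto simp: affine_fun_def)
  interpret l: bounded_linear l by fact
  show thesis
    using assms(2) by (intro that[of "(1 / (A a - A b)) *\<^sub>R (a - b)"])
      (simp add: l(2) l.add l.diff l.scaleR)
qed

lemma Pol_divide:
  assumes "Pol d p" "affine_fun A" "A a \<noteq> A b" "\<And>y. A y = 0 \<Longrightarrow> p y = 0"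
  obtains q where "Pol (d - 1) q" "\<And>y. p y = A y * q y"
proof -
  obtain v where v: "\<And>y t. A (y + t *\<^sub>R v) = A y + t"
    by (rule affine_fun_direction[OF assms(2,3)]) blast
  obtain q where q: "Pol (d - 1) q" "\<And>y. p y = p (y - A y *\<^sub>R v) + A y * q y"
    using Pol_project[OF assms(1,2)] by blast
  have z: "p (y - A y *\<^sub>R v) = 0" for y
    using v[of y "- A y"] by (intro assms(4)) simp
  show thesis by (rule that[OF q(1)]) (subst q(2), simp add: z)
qed

lemma Pol_infinite_roots:
  fixes p :: "real \<Rightarrow> real"
  assumes "Pol d p" "infinite {t. p t = 0}" shows "p t = 0"
  using assms
proof (induction "nat (d + 1)" arbitrary: d p t)
  case 0
  then show ?case using Pol_neg by fastforce
next
  case (Suc n)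
  from Suc.prems(2) obtain a where a: "p a = 0"
    by (metis (mono_tags, lifting) Collect_empty_eq finite.emptyI)
  obtain q where q: "Pol (d - 1) q" "\<And>y. p y = (y - a) * q y"
    by (rule Pol_divide[OF Suc.prems(1), of "\<lambda>y. y - a" 0 1])
       (use a in \<open>auto intro!: affine_intros\<close>)
  have "infinite {t. q t = 0}"
  proof
    assume "finite {t. q t = 0}"
    then have "finite (insert a {t. q t = 0})" by simp
    moreover have "{t. p t = 0} \<subseteq> insert a {t. q t = 0}" by (auto simp: q(2))
    ultimately show False using Suc.prems(2) finite_subset by blast
  qed
  from Suc.hyps(1)[OF _ q(1) this] Suc.hyps(2) show ?case by (simp add: q(2))
qed

text \<open>Polynomials on an affine set have no zero divisors: on the line through \<open>w\<close> and \<open>y\<close> the first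
factor has finitely many roots, so the second one has infinitely many.\<close>

lemma Pol_cancel:
  assumes p: "Pol d p" and q: "Pol e q" and S: "affine S" and "w \<in> S" "p w \<noteq> 0" "y \<in> S"
    and z: "\<And>y. y \<in> S \<Longrightarrow> p y * q y = 0"
  shows "q y = 0"
proof -
  let ?f = "\<lambda>t. w + t *\<^sub>R (y - w)"
  have f: "affine_fun ?f" by (intro affine_intros)
  have P: "Pol d (\<lambda>t. p (?f t))" "Pol e (\<lambda>t. q (?f t))"
    by (rule Pol_compose[OF p f], rule Pol_compose[OF q f])
  have "?f t \<in> S" for t
  proof -
    have "?f t = (1 - t) *\<^sub>R w + t *\<^sub>R y" by (simp add: algebra_simps)
    also have "\<dots> \<in> S" by (rule mem_affine[OF S \<open>w \<in> S\<close> \<open>y \<in> S\<close>]) simp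
    finally show ?thesis .
  qed
  then have "p (?f t) * q (?f t) = 0" for t using z by blast
  then have U: "{t. p (?f t) = 0} \<union> {t. q (?f t) = 0} = UNIV" by auto
  have "finite {t. p (?f t) = 0}"
    using Pol_infinite_roots[OF P(1), of 0] \<open>p w \<noteq> 0\<close> by auto
  then have "infinite {t. q (?f t) = 0}"
    using U by (metis finite_Un infinite_UNIV_char_0)
  from Pol_infinite_roots[OF P(2) this, of 1] show ?thesis by simp
qed

lemma Pol_zero_affine_hull:
  fixes p :: "'a::euclidean_space \<Rightarrow> real"
  assumes p: "Pol d p" and C: "convex C" and z: "\<And>y. y \<in> C \<Longrightarrow> p y = 0" and y: "y \<in> affine hull C"
  shows "p y = 0"
proof -
  have "rel_interior C \<noteq> {}" using y rel_interior_eq_empty[OF C] by auto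
  then obtain c where c: "c \<in> rel_interior C" by blast
  then obtain e where e: "e > 0" "ball c e \<inter> affine hull C \<subseteq> C"
    using mem_rel_interior_ball[of c C] by blast
  have cC: "c \<in> affine hull C" using c rel_interior_subset hull_inc by (metis subsetD)
  let ?f = "\<lambda>t. c + t *\<^sub>R (y - c)"
  have P: "Pol d (\<lambda>t. p (?f t))"
    by (rule Pol_compose[OF p, of ?f]) (intro affine_intros)
  have n: "norm (y - c) + 1 > 0" using norm_ge_zero[of "y - c"] by linarith
  define h where "h = e / (norm (y - c) + 1)"
  have h: "h > 0" unfolding h_def using e(1) n by (rule divide_pos_pos)
  have "p (?f t) = 0" if t: "0 < t" "t < h" for t
  proof -
    have "?f t = (1 - t) *\<^sub>R c + t *\<^sub>R y" by (simp add: algebra_simps)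
    also have "\<dots> \<in> affine hull C" by (rule mem_affine[OF affine_affine_hull cC y]) simp
    finally have 1: "?f t \<in> affine hull C" .
    have "t * norm (y - c) \<le> t * (norm (y - c) + 1)" using t by (intro mult_left_mono) simp_all
    also have "\<dots> < h * (norm (y - c) + 1)" using t(2) n by (rule mult_strict_right_mono)
    also have "\<dots> = e" using n by (simp add: h_def)
    finally have "?f t \<in> ball c e" using t by (simp add: dist_norm)
    with 1 e(2) show ?thesis by (intro z) blast
  qed
  then have "{0<..<h} \<subseteq> {t. p (?f t) = 0}" by (simp add: subset_iff)
  moreover have "infinite {0<..<h}" using h by (simp add: infinite_Ioo)
  ultimately have "infinite {t. p (?f t) = 0}" using infinite_super by metis
  from Pol_infinite_roots[OF P this, of 1] show ?thesis by simp
qed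

lemma Pol_zero_interior:
  fixes p :: "'a::euclidean_space \<Rightarrow> real"
  assumes p: "Pol d p" and "convex C" "interior C \<noteq> {}" and z: "\<And>y. y \<in> C \<Longrightarrow> p y = 0"
  shows "p y = 0"
  using Pol_zero_affine_hull[OF assms(1,2,4)] affine_hull_nonempty_interior[OF assms(3)] by auto

text \<open>Divisibility by products\<close>

text \<open>Powers of two affine functions with different zero sets are coprime.  The factors \<open>A\<close> are split
off the cofactor \<open>s\<close> one at a time: on \<open>A = 0\<close> the product \<open>B y ^ m * s y\<close> vanishes and \<open>B\<close> does
not vanish identically.\<close>

lemma Pol_divide_common:
  assumes "Pol d p" "affine_fun A" "affine_fun B" "A w = 0" "B w \<noteq> 0" "A w \<noteq> A w'"
    and "Pol (d - int n) q" "\<And>y. p y = A y ^ n * q y"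
    and "Pol (d - int m) s" "\<And>y. p y = B y ^ m * s y"
  obtains g where "Pol (d - int n - int m) g" "\<And>y. p y = A y ^ n * B y ^ m * g y"
  using assms
proof (induction n arbitrary: q p d s thesis)
  case 0
  show ?case using 0(1)[of s] 0(10,11) by simp
next
  case (Suc n)
  have "s y = 0" if "A y = 0" for y
  proof (rule Pol_cancel[of "int m" "\<lambda>y. B y ^ m" _ s "{y. A y = 0}" w])
    show "affine {y. A y = 0}" using Suc.prems(3) by (rule affine_zero_set)
    show "B y ^ m * s y = 0" if "y \<in> {y. A y = 0}" for y
      using that Suc.prems(9)[of y] Suc.prems(11)[of y] by simp
  qed (use Suc.prems that in \<open>auto intro: Pol_affine_power\<close>)
  then obtain s1 where s1: "Pol (d - int m - 1) s1" "\<And>y. s y = A y * s1 y"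
    using Pol_divide[OF Suc.prems(10) Suc.prems(3) Suc.prems(7)] by blast
  have eq: "A y ^ n * q y = B y ^ m * s1 y" for y
  proof -
    have *: "A y * (A y ^ n * q y - B y ^ m * s1 y) = 0" for y
      using Suc.prems(9)[of y] Suc.prems(11)[of y] by (auto simp: s1 algebra_simps)
    have "A y ^ n * q y - B y ^ m * s1 y = 0"
    proof (rule Pol_cancel[of 1 A _ "\<lambda>y. A y ^ n * q y - B y ^ m * s1 y" UNIV w'])
      show "Pol (d - 1) (\<lambda>y. A y ^ n * q y - B y ^ m * s1 y)"
      proof (rule Pol_diff)
        show "Pol (d - 1) (\<lambda>y. A y ^ n * q y)"
          using Pol_mult[OF Pol_affine_power[OF Suc.prems(3), of n] Suc.prems(8)] by simp
        show "Pol (d - 1) (\<lambda>y. B y ^ m * s1 y)"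
          using Pol_mult[OF Pol_affine_power[OF Suc.prems(4), of m] s1(1)] by simp
      qed
    qed (use Suc.prems * in \<open>auto intro: Pol_affine\<close>)
    then show ?thesis by simp
  qed
  have P: "Pol (d - 1) (\<lambda>y. A y ^ n * q y)"
    using Pol_mult[OF Pol_affine_power[OF Suc.prems(3), of n] Suc.prems(8)] by simp
  obtain g where g: "Pol (d - 1 - int n - int m) g" "\<And>y. A y ^ n * q y = A y ^ n * B y ^ m * g y"
  proof (rule Suc.IH[OF _ P Suc.prems(3-7)])
    show "Pol (d - 1 - int n) q" using Suc.prems(8) by (simp add: algebra_simps)
    show "Pol (d - 1 - int m) s1" using s1(1) by (simp add: algebra_simps)
  qed (auto simp: eq)
  show ?case
    by (rule Suc.prems(1)[of g]) (use g Suc.prems(9) in \<open>auto simp: algebra_simps\<close>)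
qed

section \<open>Directional derivatives and multiple factors\<close>

definition dird :: "'a::real_normed_vector \<Rightarrow> ('a \<Rightarrow> real) \<Rightarrow> 'a \<Rightarrow> real" where
  "dird v p y = frechet_derivative p (at y) v"

lemma dirdI: "(p has_derivative l) (at y) \<Longrightarrow> dird v p y = l v"
  by (simp add: dird_def frechet_derivative_at[symmetric])

lemma Pol_has_derivative_ex:
  "Pol d p \<Longrightarrow> \<exists>D. (\<forall>y. (p has_derivative (\<lambda>v. D v y)) (at y)) \<and> (\<forall>v. Pol (d - 1) (D v))"
proof (induction rule: Pol.induct)
  case (zero k)
  show ?case by (rule exI[of _ "\<lambda>_ _. 0"]) (simp add: Pol.zero)
next
  case (const k c)
  show ?case by (rule exI[of _ "\<lambda>_ _. 0"]) (simp add: Pol.zero)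
next
  case (add k p q)
  then obtain D E where "\<forall>y. (p has_derivative (\<lambda>v. D v y)) (at y)" "\<forall>v. Pol (k - 1) (D v)"
    "\<forall>y. (q has_derivative (\<lambda>v. E v y)) (at y)" "\<forall>v. Pol (k - 1) (E v)" by blast
  then show ?case
    by (intro exI[of _ "\<lambda>v y. D v y + E v y"] conjI allI has_derivative_add Pol.add) blast+
next
  case (lin k p l)
  then obtain D where D: "\<And>y. (p has_derivative (\<lambda>v. D v y)) (at y)" "\<And>v. Pol (k - 1) (D v)" by blast
  have "((\<lambda>y. l y * p y) has_derivative (\<lambda>v. l y * D v y + l v * p y)) (at y)" for y
    by (rule has_derivative_mult[OF bounded_linear_imp_has_derivative[OF lin.hyps(2)] D(1)])
  moreover have "Pol (k + 1 - 1) (\<lambda>y. l y * D v y + l v * p y)" for v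
    using Pol.add[OF Pol.lin[OF D(2) lin.hyps(2), of v, simplified] Pol_cmul[OF lin.hyps(1), of "l v"]] by simp
  ultimately show ?case by (intro exI[of _ "\<lambda>v y. l y * D v y + l v * p y"]) blast
qed

lemma Pol_has_derivative: assumes "Pol d p" shows "(p has_derivative (\<lambda>v. dird v p y)) (at y)"
proof -
  obtain D where D: "\<And>y. (p has_derivative (\<lambda>v. D v y)) (at y)" using Pol_has_derivative_ex[OF assms] by blast
  have "dird v p y = D v y" for v by (rule dirdI[OF D])
  with D[of y] show ?thesis by simp
qed

lemma Pol_dird: assumes "Pol d p" shows "Pol (d - 1) (dird v p)"
proof -
  obtain D where D: "\<And>y. (p has_derivative (\<lambda>v. D v y)) (at y)" "\<And>v. Pol (d - 1) (D v)"
    using Pol_has_derivative_ex[OF assms] by blast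
  have "dird v p = D v" by (rule ext, rule dirdI[OF D(1)])
  with D(2)[of v] show ?thesis by simp
qed

lemma Pol_continuous_on: "Pol d p \<Longrightarrow> continuous_on S p"
  using Pol_has_derivative has_derivative_continuous continuous_at_imp_continuous_on by metis

lemma dird_linear: assumes "Pol d p" shows "linear (\<lambda>v. dird v p y)"
  using has_derivative_linear[OF Pol_has_derivative[OF assms]] .

lemma dird_const [simp]: "dird v (\<lambda>_. c) y = 0"
  using dirdI[OF has_derivative_const] by metis

lemma dird_add: "Pol d p \<Longrightarrow> Pol e q \<Longrightarrow> dird v (\<lambda>y. p y + q y) y = dird v p y + dird v q y"
  by (intro dirdI has_derivative_add Pol_has_derivative)

lemma dird_diff: "Pol d p \<Longrightarrow> Pol e q \<Longrightarrow> dird v (\<lambda>y. p y - q y) y = dird v p y - dird v q y"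
  by (intro dirdI has_derivative_diff Pol_has_derivative)

lemma dird_mult: "Pol d p \<Longrightarrow> Pol e q \<Longrightarrow> dird v (\<lambda>y. p y * q y) y = p y * dird v q y + dird v p y * q y"
  by (intro dirdI has_derivative_mult Pol_has_derivative)

lemma dird_affine:
  assumes "affine_fun A" shows "dird v A y = A (y + v) - A y"
proof -
  obtain c l where l: "bounded_linear l" "A = (\<lambda>y. c + l y)"
    using assms by (auto simp: affine_fun_def)
  interpret l: bounded_linear l by fact
  have "dird v A y = 0 + l v" unfolding l(2)
    by (rule dirdI[where l = "\<lambda>v. 0 + l v"]) (intro has_derivative_add has_derivative_const bounded_linear_imp_has_derivative l(1))
  then show ?thesis by (simp add: l(2) l.add)
qed

lemma dird_affine_const:
  assumes "affine_fun A" shows "dird v A y = dird v A z"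
proof -
  obtain c l where l: "bounded_linear l" "A = (\<lambda>y. c + l y)"
    using assms by (auto simp: affine_fun_def)
  interpret l: bounded_linear l by fact
  show ?thesis by (simp add: dird_affine[OF assms]) (simp add: l(2) l.add)
qed

lemma dird_compose:
  assumes p: "Pol d p" and f: "affine_fun f"
  shows "dird v (\<lambda>t. p (f t)) t = dird (f (t + v) - f t) p (f t)"
proof -
  obtain c l where l: "bounded_linear l" "f = (\<lambda>y. c + l y)"
    using f by (auto simp: affine_fun_def)
  interpret l: bounded_linear l by fact
  have "(f has_derivative (\<lambda>v. 0 + l v)) (at t)" unfolding l(2)
    by (intro has_derivative_add has_derivative_const bounded_linear_imp_has_derivative l(1))
  then have "(f has_derivative l) (at t)" by simp
  from has_derivative_compose[OF this Pol_has_derivative[OF p]]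
  show ?thesis by (subst dirdI) (auto simp: l(2) l.add)
qed

text \<open>Both iterated derivatives of \<open>l y * p y\<close> contain the symmetric first order terms, and the second
order term is symmetric by induction.\<close>

lemma dird_commute: "Pol d p \<Longrightarrow> dird v (dird w p) y = dird w (dird v p) y"
proof (induction rule: Pol.induct)
  case (zero k)
  have "dird v (\<lambda>_. 0) = (\<lambda>_. 0)" for v :: 'a by auto
  then show ?case by simp
next
  case (const k c)
  have "dird v (\<lambda>_. c) = (\<lambda>_. 0)" for v :: 'a by auto
  then show ?case by simp
next
  case (add k p q)
  have "dird v (\<lambda>y. p y + q y) = (\<lambda>y. dird v p y + dird v q y)" for v
    by (rule ext) (rule dird_add[OF add.hyps])
  then show ?case using add by (simp add: dird_add[OF Pol_dird Pol_dird])
next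
  case (lin k p l)
  note A = affine_fun_linear[OF lin.hyps(2)]
  have e: "dird v (\<lambda>y. l y * p y) = (\<lambda>y. l y * dird v p y + l v * p y)" for v
  proof (rule ext)
    fix y
    interpret l: bounded_linear l by (rule lin.hyps)
    show "dird v (\<lambda>y. l y * p y) y = l y * dird v p y + l v * p y"
      by (simp add: dird_mult[OF Pol_affine[OF A] lin.hyps(1)] dird_affine[OF A] l.add)
  qed
  have "dird v (\<lambda>y. l y * dird w p y + l w * p y) y = l y * dird v (dird w p) y + l v * dird w p y + l w * dird v p y" for v w
  proof -
    interpret l: bounded_linear l by (rule lin.hyps)
    have "dird v (\<lambda>y. l w * p y) y = l w * dird v p y"
      by (simp add: dird_mult[OF Pol.const[of 0] lin.hyps(1)])
    then show ?thesis
      by (simp add: dird_add[OF Pol_mult[OF Pol_affine[OF A] Pol_dird] Pol_cmul, OF lin.hyps(1) lin.hyps(1)]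
          dird_mult[OF Pol_affine[OF A] Pol_dird[OF lin.hyps(1)]] dird_affine[OF A] l.add)
  qed
  then show ?case unfolding e by (simp add: lin.IH)
qed

lemma dird_power:
  assumes A: "affine_fun A"
  shows "dird v (\<lambda>y. A y ^ n) y = real n * A y ^ (n - 1) * dird v A y"
proof (induction n)
  case (Suc n)
  have "dird v (\<lambda>y. A y * A y ^ n) y = A y * (real n * A y ^ (n - 1) * dird v A y) + dird v A y * A y ^ n"
    by (simp only: dird_mult[OF Pol_affine[OF A] Pol_affine_power[OF A]] Suc)
  then show ?case by (cases n) (simp_all add: algebra_simps)
qed simp

lemma Pol_dird_funpow: "Pol d p \<Longrightarrow> Pol (d - int j) ((dird v ^^ j) p)"
proof (induction j)
  case (Suc j)
  have "d - int (Suc j) = d - int j - 1" by simp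
  with Pol_dird[OF Suc.IH[OF Suc.prems], of v] show ?case by (simp only: funpow.simps o_apply)
qed simp

lemma dird_funpow_mult:
  assumes A: "affine_fun A" and v: "\<And>y. dird v A y = 1" and q: "Pol d q"
  shows "(dird v ^^ j) (\<lambda>y. A y * q y) = (\<lambda>y. A y * (dird v ^^ j) q y + real j * (dird v ^^ (j - 1)) q y)"
proof (induction j)
  case (Suc j)
  note P = Pol_dird_funpow[OF q]
  show ?case
  proof
    fix y
    have "dird v (\<lambda>y. real j * (dird v ^^ (j - 1)) q y) y = real j * (dird v ^^ j) q y"
      by (cases j) (simp_all add: dird_mult[OF Pol.const[of 0] P])
    then have "dird v (\<lambda>y. A y * (dird v ^^ j) q y + real j * (dird v ^^ (j - 1)) q y) y
        = (A y * (dird v ^^ Suc j) q y + (dird v ^^ j) q y) + real j * (dird v ^^ j) q y"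
      by (simp add: dird_add[OF Pol_mult[OF Pol_affine[OF A] P] Pol_cmul[OF P]]
          dird_mult[OF Pol_affine[OF A] P] v)
    then show "(dird v ^^ Suc j) (\<lambda>y. A y * q y) y
        = A y * (dird v ^^ Suc j) q y + real (Suc j) * (dird v ^^ (Suc j - 1)) q y"
      by (simp add: Suc algebra_simps)
  qed
qed simp

text \<open>After division by \<open>A\<close> the \<open>j\<close>-th derivative of the quotient is, on \<open>A = 0\<close>, the derivative of
order \<open>j + 1\<close> of the polynomial up to the factor \<open>j + 1\<close>, so the hypotheses pass on to the quotient.\<close>

lemma Pol_divide_power:
  assumes "Pol d p" and A: "affine_fun A" and v: "\<And>y t. A (y + t *\<^sub>R v) = A y + (t::real)"
    and z: "\<And>y j. A y = 0 \<Longrightarrow> j < n \<Longrightarrow> (dird v ^^ j) p y = 0"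
  obtains q where "Pol (d - int n) q" "\<And>y. p y = A y ^ n * q y"
proof -
  have dA: "dird v A y = 1" for y using v[of y 1] by (simp add: dird_affine[OF A])
  have nc: "A (0 + 1 *\<^sub>R v) \<noteq> A 0" using v[of 0 1] by simp
  have "\<exists>q. Pol (d - int n) q \<and> (\<forall>y. p y = A y ^ n * q y)"
    using assms(1) z
  proof (induction n arbitrary: d p)
    case 0
    then show ?case by (intro exI[of _ p]) simp
  next
    case (Suc n)
    obtain s where s: "Pol (d - 1) s" "\<And>y. p y = A y * s y"
      by (rule Pol_divide[OF Suc.prems(1) A nc]) (use Suc.prems(2)[of _ 0] in auto)
    have p: "p = (\<lambda>y. A y * s y)" by (rule ext) (rule s(2))
    have "(dird v ^^ j) s y = 0" if "A y = 0" "j < n" for y j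
      using Suc.prems(2)[OF that(1), of "Suc j"] that
      unfolding p dird_funpow_mult[OF A dA s(1)] by simp
    then obtain q where q: "Pol (d - 1 - int n) q" "\<And>y. s y = A y ^ n * q y"
      using Suc.IH[OF s(1)] by blast
    have "d - int (Suc n) = d - 1 - int n" by simp
    with q(1) have "Pol (d - int (Suc n)) q" by (simp only:)
    then show ?case by (intro exI[of _ q]) (simp add: s(2) q(2))
  qed
  with that show thesis by blast
qed

section \<open>Dimensions of function spaces\<close>

interpretation fs: vector_space "\<lambda>(c::real) (f :: real^3 \<Rightarrow> real) y. c * f y"
  by (rule vector_space_fun)

text \<open>The value of \<open>fun_dim\<close> says nothing about spaces that are not finite dimensional, so inductions
on the dimension are carried out with a finite basis.\<close>

definition fin_dim :: "(real^3 \<Rightarrow> real) set \<Rightarrow> nat \<Rightarrow> bool" where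
  "fin_dim V n \<longleftrightarrow> (\<exists>B. finite B \<and> fs.independent B \<and> card B = n \<and> fs.span B = V)"

lemma fin_dim_dim: "fin_dim V n \<Longrightarrow> fun_dim V = n"
  unfolding fin_dim_def fun_dim_def using fs.dim_eq_card fs.span_span by (metis fs.dim_span_eq_card_independent)

lemma fin_dim_0: "fin_dim {\<lambda>_. 0} 0"
  unfolding fin_dim_def
  by (intro exI[of _ "{}"]) (auto simp: fs.independent_empty fs.span_empty zero_fun_def)

text \<open>Dimension of an extension of \<open>W\<close>: the hypothesis says that the \<open>b j\<close> are linearly independent
modulo \<open>W\<close>, and the conclusion is about the span of \<open>W\<close> and all \<open>b j\<close>.\<close>

lemma fin_dim_extend:
  assumes "finite J" "fin_dim W n"
    and "\<And>c. (\<lambda>y. \<Sum>j\<in>J. c j * b j y) \<in> W \<Longrightarrow> \<forall>j\<in>J. c j = 0"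
  shows "fin_dim {v. \<exists>c. (\<lambda>y. v y - (\<Sum>j\<in>J. c j * b j y)) \<in> W} (n + card J)"
  using assms(1,3)
proof (induction J rule: finite_induct)
  case empty
  then show ?case using assms(2) by simp
next
  case (insert a J)
  let ?S = "\<lambda>J. {v. \<exists>c. (\<lambda>y. v y - (\<Sum>j\<in>J. c j * b j y)) \<in> W}"
  have "\<forall>j\<in>J. c j = 0" if "(\<lambda>y. \<Sum>j\<in>J. c j * b j y) \<in> W" for c
  proof -
    have "(\<Sum>j\<in>insert a J. (c(a := 0)) j * b j y) = (\<Sum>j\<in>J. c j * b j y)" for y
      using insert.hyps by (auto intro!: sum.cong)
    with that have "(\<lambda>y. \<Sum>j\<in>insert a J. (c(a := 0)) j * b j y) \<in> W" by simp
    from insert.prems[OF this] have *: "(c(a := 0)) j = 0" if "j \<in> insert a J" for j using that by blast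
    show ?thesis
    proof
      fix j assume "j \<in> J"
      then show "c j = 0" using *[of j] insert.hyps by (cases "j = a") auto
    qed
  qed
  from insert.IH[OF this] have "fin_dim (?S J) (n + card J)" by blast
  then obtain B where B: "finite B" "fs.independent B" "card B = n + card J" "fs.span B = ?S J"
    unfolding fin_dim_def by blast
  have "b a \<notin> fs.span B"
  proof
    assume "b a \<in> fs.span B"
    then obtain c where c: "(\<lambda>y. b a y - (\<Sum>j\<in>J. c j * b j y)) \<in> W" unfolding B(4) by blast
    have "(\<Sum>j\<in>insert a J. ((\<lambda>j. - c j)(a := 1)) j * b j y) = b a y - (\<Sum>j\<in>J. c j * b j y)" for y
    proof -
      have "(\<Sum>j\<in>J. ((\<lambda>j. - c j)(a := 1)) j * b j y) = (\<Sum>j\<in>J. - (c j * b j y))"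
        using insert.hyps by (intro sum.cong) auto
      then show ?thesis using insert.hyps by (simp add: sum_negf)
    qed
    with insert.prems[of "(\<lambda>j. - c j)(a := 1)"] c show False by simp
  qed
  moreover from this have "b a \<notin> B" using fs.span_base by blast
  ultimately have "fs.independent (insert (b a) B)" "card (insert (b a) B) = Suc (card B)"
    using B by (auto simp: fs.independent_insert)
  moreover have "fs.span (insert (b a) B) = ?S (insert a J)"
  proof (intro set_eqI iffI)
    fix v assume "v \<in> fs.span (insert (b a) B)"
    then obtain k where "v - (\<lambda>y. k * b a y) \<in> ?S J" unfolding fs.span_insert B(4) by blast
    then obtain c where c: "(\<lambda>y. v y - k * b a y - (\<Sum>j\<in>J. c j * b j y)) \<in> W" by auto
    have "(\<lambda>y. v y - k * b a y - (\<Sum>j\<in>J. c j * b j y)) = (\<lambda>y. v y - (\<Sum>j\<in>insert a J. (c(a := k)) j * b j y))"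
    proof
      fix y
      have "(\<Sum>j\<in>J. (c(a := k)) j * b j y) = (\<Sum>j\<in>J. c j * b j y)"
        using insert.hyps by (intro sum.cong) auto
      then show "v y - k * b a y - (\<Sum>j\<in>J. c j * b j y) = v y - (\<Sum>j\<in>insert a J. (c(a := k)) j * b j y)"
        using insert.hyps by simp
    qed
    with c show "v \<in> ?S (insert a J)" by (intro CollectI exI[of _ "c(a := k)"]) simp
  next
    fix v assume "v \<in> ?S (insert a J)"
    then obtain c where c: "(\<lambda>y. v y - (\<Sum>j\<in>insert a J. c j * b j y)) \<in> W" by blast
    have "(\<lambda>y. v y - (\<Sum>j\<in>insert a J. c j * b j y)) = (\<lambda>y. v y - c a * b a y - (\<Sum>j\<in>J. c j * b j y))"
      using insert.hyps by (simp add: algebra_simps)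
    with c have "(\<lambda>y. v y - c a * b a y - (\<Sum>j\<in>J. c j * b j y)) \<in> W" by simp
    then have "v - (\<lambda>y. c a * b a y) \<in> ?S J" by (intro CollectI exI[of _ c]) simp
    then show "v \<in> fs.span (insert (b a) B)" unfolding fs.span_insert B(4) by blast
  qed
  ultimately show ?case unfolding fin_dim_def using B insert.hyps
    by (intro exI[of _ "insert (b a) B"]) simp
qed

section \<open>Monomial bases\<close>

text \<open>The common part of the expansions into monomials in one, two and three variables: a family that
contains the constant one, and that is shifted to the next degree by the coordinate functions,
generates all polynomials.\<close>

lemma Pol_basis_expansion:
  fixes m :: "'j \<Rightarrow> 'a::real_normed_vector \<Rightarrow> real" and e :: "'s \<Rightarrow> 'a \<Rightarrow> real" and I :: "int \<Rightarrow> 'j set"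
  assumes fin: "\<And>k. finite (I k)" "finite S"
    and one: "\<And>k. 0 \<le> k \<Longrightarrow> \<exists>j\<in>I k. \<forall>y. m j y = 1"
    and coords: "\<And>l. bounded_linear l \<Longrightarrow> \<exists>a. \<forall>y. l y = (\<Sum>s\<in>S. a s * e s y)"
    and shift: "\<And>s k j. s \<in> S \<Longrightarrow> j \<in> I k \<Longrightarrow> \<exists>j'\<in>I (k + 1). \<forall>y. e s y * m j y = m j' y"
  shows "Pol k p \<Longrightarrow> \<exists>c. \<forall>y. p y = (\<Sum>j\<in>I k. c j * m j y)"
proof -
  define Q where "Q k p \<longleftrightarrow> (\<exists>c. \<forall>y. p y = (\<Sum>j\<in>I k. c j * m j y))" for k p
  have zero: "Q k (\<lambda>_. 0)" for k unfolding Q_def by (rule exI[of _ "\<lambda>_. 0"]) simp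
  have add: "Q k (\<lambda>y. p y + q y)" if pq: "Q k p" "Q k q" for k p q
  proof -
    obtain c d where "\<forall>y. p y = (\<Sum>j\<in>I k. c j * m j y)" "\<forall>y. q y = (\<Sum>j\<in>I k. d j * m j y)"
      using pq unfolding Q_def by blast
    then show ?thesis unfolding Q_def
      by (intro exI[of _ "\<lambda>j. c j + d j"]) (simp add: distrib_right sum.distrib)
  qed
  have sums: "Q k (\<lambda>y. \<Sum>i\<in>J. f i y)" if "\<And>i. i \<in> J \<Longrightarrow> Q k (f i)" for k J and f :: "'i \<Rightarrow> 'a \<Rightarrow> real"
    using that by (induction J rule: infinite_finite_induct) (auto intro: zero add)
  have mono: "Q k (\<lambda>y. a * m j y)" if "j \<in> I k" for k j a
  proof -
    have "(\<Sum>i\<in>I k. (if i = j then a else 0) * m i y) = a * m j y" for y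
      using that fin(1) by (subst sum.remove[of _ j]) (auto intro!: sum.neutral)
    then show ?thesis unfolding Q_def by (intro exI[of _ "\<lambda>i. if i = j then a else 0"]) simp
  qed
  have "Pol k p \<Longrightarrow> Q k p"
  proof (induction rule: Pol.induct)
    case (const k c)
    obtain j where "j \<in> I k" "\<forall>y. m j y = 1" using one[OF const] by blast
    with mono[of j k c] show ?case by simp
  next
    case (lin k p l)
    obtain c where c: "\<And>y. p y = (\<Sum>j\<in>I k. c j * m j y)" using lin.IH unfolding Q_def by blast
    obtain a where a: "\<And>y. l y = (\<Sum>s\<in>S. a s * e s y)" using coords[OF lin.hyps(2)] by blast
    have "Q (k + 1) (\<lambda>y. \<Sum>s\<in>S. \<Sum>j\<in>I k. (a s * e s y) * (c j * m j y))"
    proof (intro sums)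
      fix s j assume "s \<in> S" "j \<in> I k"
      then obtain j' where j': "j' \<in> I (k + 1)" "\<And>y. e s y * m j y = m j' y" using shift by blast
      have "(\<lambda>y. (a s * e s y) * (c j * m j y)) = (\<lambda>y. (a s * c j) * m j' y)"
        unfolding j'(2)[symmetric] by (simp add: mult_ac)
      with mono[OF j'(1)] show "Q (k + 1) (\<lambda>y. (a s * e s y) * (c j * m j y))" by simp
    qed
    then show ?case unfolding c a sum_product .
  qed (auto intro: zero add)
  then show "Pol k p \<Longrightarrow> \<exists>c. \<forall>y. p y = (\<Sum>j\<in>I k. c j * m j y)" unfolding Q_def .
qed

definition plane_exponents :: "int \<Rightarrow> (nat \<times> nat) set" where
  "plane_exponents k = {(a, b). int a + int b \<le> k}"

lemma finite_plane_exponents: "finite (plane_exponents k)"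
  by (rule finite_subset[of _ "{..nat k} \<times> {..nat k}"]) (auto simp: plane_exponents_def)

lemma finite_degs: "finite {a. int a \<le> k}"
  by (rule finite_subset[of _ "{..nat k}"]) auto

lemma card_degs: "-1 \<le> k \<Longrightarrow> card {a. int a \<le> k} = nat (k + 1)"
proof -
  assume "-1 \<le> k"
  then have "{a. int a \<le> k} = {..<nat (k + 1)}" by auto
  then show ?thesis by simp
qed

lemma card_plane_exponents: "-2 \<le> k \<Longrightarrow> 2 * int (card (plane_exponents k)) = (k + 1) * (k + 2)"
proof (induction k rule: int_ge_induct)
  case base
  have "plane_exponents (-2) = {}" by (auto simp: plane_exponents_def)
  then show ?case by simp
next
  case (step k)
  have e: "plane_exponents (k + 1) = plane_exponents k \<union> (\<lambda>a. (a, nat (k + 1) - a)) ` {a. int a \<le> k + 1}" (is "_ = _ \<union> ?D")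
  proof (intro set_eqI iffI)
    fix z assume z: "z \<in> plane_exponents (k + 1)"
    obtain a b where [simp]: "z = (a, b)" by force
    show "z \<in> plane_exponents k \<union> ?D"
    proof (cases "int a + int b \<le> k")
      case False
      then have "int a + int b = k + 1" using z by (auto simp: plane_exponents_def)
      then have "b = nat (k + 1) - a" "int a \<le> k + 1" by auto
      then show ?thesis by auto
    qed (auto simp: plane_exponents_def)
  next
    fix z assume "z \<in> plane_exponents k \<union> ?D"
    then show "z \<in> plane_exponents (k + 1)" by (auto simp: plane_exponents_def)
  qed
  have "plane_exponents k \<inter> ?D = {}" by (auto simp: plane_exponents_def)
  moreover have "card ?D = nat (k + 2)"
    using card_degs[of "k + 1"] step.hyps by (subst card_image) (auto intro: inj_onI)
  ultimately have "card (plane_exponents (k + 1)) = card (plane_exponents k) + nat (k + 2)"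
    unfolding e by (subst card_Un_disjoint) (auto simp: finite_plane_exponents finite_degs)
  then show ?case using step by (simp add: algebra_simps)
qed

lemma Pol_real_monomials:
  fixes p :: "real \<Rightarrow> real"
  assumes "Pol k p" shows "\<exists>c. \<forall>t. p t = (\<Sum>a\<in>{a. int a \<le> k}. c a * t ^ a)"
proof (rule Pol_basis_expansion[where S = "{()}" and e = "\<lambda>_ t. t", OF finite_degs _ _ _ _ assms])
  show "\<exists>a. \<forall>y. l y = (\<Sum>s\<in>{()}. a s * y)" if l: "bounded_linear l" for l :: "real \<Rightarrow> real"
  proof -
    interpret bounded_linear l by fact
    have "l y = (\<Sum>s\<in>{()}. l 1 * y)" for y using scaleR[of y 1] by (simp add: mult.commute)
    then show ?thesis by (intro exI[of _ "\<lambda>_. l 1"] allI)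
  qed
  show "\<exists>j'\<in>{a. int a \<le> k + 1}. \<forall>y::real. y * y ^ j = y ^ j'" if "j \<in> {a. int a \<le> k}" for k j
    using that by (intro bexI[of _ "Suc j"]) auto
qed (auto intro: exI[of _ 0])

lemma Pol_plane_monomials:
  fixes p :: "real \<times> real \<Rightarrow> real"
  assumes "Pol k p" shows "\<exists>c. \<forall>z. p z = (\<Sum>j\<in>plane_exponents k. c j * (fst z ^ fst j * snd z ^ snd j))"
proof (rule Pol_basis_expansion[where S = UNIV and e = "\<lambda>b z. if b then fst z else snd z", OF finite_plane_exponents _ _ _ _ assms])
  show "\<exists>j\<in>plane_exponents k. \<forall>y::real\<times>real. fst y ^ fst j * snd y ^ snd j = 1" if "0 \<le> k" for k
    using that by (intro bexI[of _ "(0, 0)"]) (auto simp: plane_exponents_def)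
  show "\<exists>a. \<forall>y. l y = (\<Sum>s\<in>UNIV. a s * (if s then fst y else snd y))" if l: "bounded_linear l" for l :: "real \<times> real \<Rightarrow> real"
  proof -
    interpret bounded_linear l by fact
    have 1: "l y = l (fst y *\<^sub>R (1, 0) + snd y *\<^sub>R (0, 1))" for y
      by (rule arg_cong[where f = l]) (simp add: prod_eq_iff)
    have "l y = (\<Sum>s\<in>UNIV. (if s then l (1, 0) else l (0, 1)) * (if s then fst y else snd y))" for y
      by (rule trans[OF 1], simp only: add scaleR real_scaleR_def) (simp add: UNIV_bool mult.commute)
    then show ?thesis by (intro exI[of _ "\<lambda>b. if b then l (1, 0) else l (0, 1)"] allI)
  qed
  show "\<exists>j'\<in>plane_exponents (k + 1). \<forall>y::real\<times>real. (if s then fst y else snd y) * (fst y ^ fst j * snd y ^ snd j) = fst y ^ fst j' * snd y ^ snd j'"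
    if "j \<in> plane_exponents k" for s k j
    using that by (intro bexI[of _ "if s then (Suc (fst j), snd j) else (fst j, Suc (snd j))"]) (auto simp: plane_exponents_def mult_ac)
qed simp

lemma real_monomials_zero:
  fixes c :: "nat \<Rightarrow> real"
  assumes "finite A" "infinite {t. (\<Sum>a\<in>A. c a * t ^ a) = 0}" "a \<in> A"
  shows "c a = 0"
proof -
  define n where "n = Max A"
  define d where "d = (\<lambda>a. if a \<in> A then c a else 0)"
  have "A \<subseteq> {..n}" using assms(1) by (auto simp: n_def)
  then have "(\<Sum>a\<in>A. c a * t ^ a) = (\<Sum>a\<le>n. d a * t ^ a)" for t
    by (intro sum.mono_neutral_cong_left) (auto simp: d_def)
  with assms(2) have "infinite {t. (\<Sum>a\<le>n. d a * t ^ a) = 0}" by simp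
  then have "d a = 0" using polyfun_finite_roots[of d n] assms(3) \<open>A \<subseteq> {..n}\<close> by blast
  then show ?thesis using assms(3) by (simp add: d_def)
qed

text \<open>For fixed \<open>t\<close> the sum is a polynomial in \<open>s\<close> with infinitely many roots; its coefficients are
polynomials in \<open>t\<close> with infinitely many roots.\<close>

lemma plane_monomials_zero:
  fixes c :: "nat \<times> nat \<Rightarrow> real"
  assumes "\<And>s t. 0 < s \<Longrightarrow> 0 < t \<Longrightarrow> s + t < 1 \<Longrightarrow> (\<Sum>j\<in>plane_exponents k. c j * (s ^ fst j * t ^ snd j)) = 0"
    and "z \<in> plane_exponents k"
  shows "c z = 0"
proof -
  obtain a b where z: "z = (a, b)" by force
  define e where "e = (\<lambda>a b. if (a, b) \<in> plane_exponents k then c (a, b) else 0)"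
  have eq: "(\<Sum>j\<in>plane_exponents k. c j * (s ^ fst j * t ^ snd j)) = (\<Sum>a\<le>nat k. (\<Sum>b\<le>nat k. e a b * t ^ b) * s ^ a)" for s t
  proof -
    have "(\<Sum>j\<in>plane_exponents k. c j * (s ^ fst j * t ^ snd j)) = (\<Sum>(a, b)\<in>{..nat k} \<times> {..nat k}. e a b * s ^ a * t ^ b)"
      by (rule sum.mono_neutral_cong_left) (auto simp: plane_exponents_def e_def split: if_splits)
    also have "\<dots> = (\<Sum>a\<le>nat k. \<Sum>b\<le>nat k. e a b * s ^ a * t ^ b)"
      by (rule sum.cartesian_product[symmetric])
    finally show ?thesis by (simp add: sum_distrib_left sum_distrib_right mult_ac)
  qed
  have le: "a \<le> nat k" "b \<le> nat k" using assms(2) by (auto simp: z plane_exponents_def)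
  have inf: "infinite {0<..<1/2::real}" by (simp add: infinite_Ioo)
  have "(\<Sum>b\<le>nat k. e a b * t ^ b) = 0" if t: "t \<in> {0<..<1/2}" for t
  proof (rule real_monomials_zero[of "{..nat k}" "\<lambda>a. \<Sum>b\<le>nat k. e a b * t ^ b"])
    have "{0<..<1/2} \<subseteq> {s. (\<Sum>a\<le>nat k. (\<Sum>b\<le>nat k. e a b * t ^ b) * s ^ a) = 0}"
      using assms(1)[unfolded eq, of _ t] t by auto
    then show "infinite {s. (\<Sum>a\<le>nat k. (\<Sum>b\<le>nat k. e a b * t ^ b) * s ^ a) = 0}"
      using inf infinite_super by blast
  qed (use le in auto)
  then have "{0<..<1/2} \<subseteq> {t. (\<Sum>b\<le>nat k. e a b * t ^ b) = 0}" by blast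
  then have "infinite {t. (\<Sum>b\<le>nat k. e a b * t ^ b) = 0}" using inf infinite_super by blast
  from real_monomials_zero[OF _ this] le have "e a b = 0" by auto
  then show ?thesis using assms(2) by (simp add: e_def z)
qed

section \<open>Polynomials on edges and faces\<close>

lemma mi_order_3: "mi_order \<alpha> = \<alpha> $ 1 + \<alpha> $ 2 + \<alpha> $ 3"
  by (simp add: mi_order_def sum_3)

lemma prod_UNIV_3: "prod f (UNIV::3 set) = f 1 * (f 2 * f 3)"
  unfolding UNIV_3 by simp

lemma finite_multi_indices: "finite {\<alpha>. int (mi_order \<alpha>) \<le> k}"
proof (rule finite_subset)
  show "{\<alpha>. int (mi_order \<alpha>) \<le> k} \<subseteq> (\<lambda>(a, b, c). vector [a, b, c]) ` ({..nat k} \<times> {..nat k} \<times> {..nat k})"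
  proof
    fix \<alpha> :: "nat^3" assume "\<alpha> \<in> {\<alpha>. int (mi_order \<alpha>) \<le> k}"
    then have "int (\<alpha> $ 1) + int (\<alpha> $ 2) + int (\<alpha> $ 3) \<le> k"
      by (simp add: mi_order_3)
    moreover have "\<alpha> = vector [\<alpha> $ 1, \<alpha> $ 2, \<alpha> $ 3]" by (simp add: vec_eq_iff forall_3)
    ultimately show "\<alpha> \<in> (\<lambda>(a, b, c). vector [a, b, c]) ` ({..nat k} \<times> {..nat k} \<times> {..nat k})"
      by (intro image_eqI[of _ _ "(\<alpha> $ 1, \<alpha> $ 2, \<alpha> $ 3)"]) auto
  qed
qed simp

lemma affine_fun_nth: "affine_fun (\<lambda>y::real^'n. y $ i)"
  by (intro affine_fun_linear bounded_linear_vec_nth)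

lemma Pol_monomial: "Pol (int (mi_order \<alpha>)) (\<lambda>y::real^3. \<Prod>i\<in>UNIV. (y $ i) ^ (\<alpha> $ i))"
proof -
  have "Pol (int (\<alpha> $ 1) + (int (\<alpha> $ 2) + int (\<alpha> $ 3))) (\<lambda>y::real^3. y $ 1 ^ (\<alpha> $ 1) * (y $ 2 ^ (\<alpha> $ 2) * y $ 3 ^ (\<alpha> $ 3)))"
    by (intro Pol_mult Pol_affine_power affine_fun_nth)
  then show ?thesis by (simp add: mi_order_3 prod_UNIV_3 add.assoc)
qed

lemma Pol_multi_index_sum:
  "Pol k p \<longleftrightarrow> (\<exists>c. \<forall>y::real^3. p y = (\<Sum>\<alpha> | int (mi_order \<alpha>) \<le> k. c \<alpha> * (\<Prod>i\<in>UNIV. (y $ i) ^ (\<alpha> $ i))))"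
proof
  assume "Pol k p"
  then show "\<exists>c. \<forall>y. p y = (\<Sum>\<alpha> | int (mi_order \<alpha>) \<le> k. c \<alpha> * (\<Prod>i\<in>UNIV. (y $ i) ^ (\<alpha> $ i)))"
  proof (rule Pol_basis_expansion[where S = UNIV and e = "\<lambda>i y. y $ i", OF finite_multi_indices, rotated -1])
    show "\<exists>\<alpha>\<in>{\<alpha>. int (mi_order \<alpha>) \<le> k}. \<forall>y::real^3. (\<Prod>i\<in>UNIV. (y $ i) ^ (\<alpha> $ i)) = 1" if "0 \<le> k" for k
      using that by (intro bexI[of _ 0]) (auto simp: mi_order_3)
    show "\<exists>a. \<forall>y. l y = (\<Sum>i\<in>UNIV. a i * y $ i)" if l: "bounded_linear l" for l :: "real^3 \<Rightarrow> real"
    proof -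
      interpret bounded_linear l by fact
      have "l y = (\<Sum>i\<in>UNIV. l (axis i 1) * y $ i)" for y
      proof -
        have "l y = l (\<Sum>i\<in>UNIV. y $ i *\<^sub>R axis i 1)"
          using basis_expansion[of y] by (simp add: scalar_mult_eq_scaleR)
        then show ?thesis by (simp add: sum scaleR mult.commute)
      qed
      then show ?thesis by (intro exI[of _ "\<lambda>i. l (axis i 1)"] allI)
    qed
    show "\<exists>\<beta>\<in>{\<alpha>. int (mi_order \<alpha>) \<le> k + 1}. \<forall>y::real^3. y $ j * (\<Prod>i\<in>UNIV. (y $ i) ^ (\<alpha> $ i)) = (\<Prod>i\<in>UNIV. (y $ i) ^ (\<beta> $ i))"
      if "\<alpha> \<in> {\<alpha>. int (mi_order \<alpha>) \<le> k}" for j k \<alpha>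
    proof (rule bexI[of _ "\<chi> i. if i = j then Suc (\<alpha> $ i) else \<alpha> $ i"])
      show "\<forall>y::real^3. y $ j * (\<Prod>i\<in>UNIV. (y $ i) ^ (\<alpha> $ i)) = (\<Prod>i\<in>UNIV. (y $ i) ^ ((\<chi> i. if i = j then Suc (\<alpha> $ i) else \<alpha> $ i) $ i))"
        using prod.remove[of UNIV j "\<lambda>i. y $ i ^ (if i = j then Suc (\<alpha> $ i) else \<alpha> $ i)" for y :: "real^3"]
          prod.remove[of UNIV j "\<lambda>i. y $ i ^ (\<alpha> $ i)" for y :: "real^3"] by simp
      show "(\<chi> i. if i = j then Suc (\<alpha> $ i) else \<alpha> $ i) \<in> {\<alpha>. int (mi_order \<alpha>) \<le> k + 1}"
        using that exhaust_3[of j] by (auto simp: mi_order_3)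
    qed
  qed simp
next
  assume "\<exists>c. \<forall>y. p y = (\<Sum>\<alpha> | int (mi_order \<alpha>) \<le> k. c \<alpha> * (\<Prod>i\<in>UNIV. (y $ i) ^ (\<alpha> $ i)))"
  then obtain c where "p = (\<lambda>y. \<Sum>\<alpha> | int (mi_order \<alpha>) \<le> k. c \<alpha> * (\<Prod>i\<in>UNIV. (y $ i) ^ (\<alpha> $ i)))" by blast
  moreover have "Pol k (\<lambda>y. \<Sum>\<alpha> | int (mi_order \<alpha>) \<le> k. c \<alpha> * (\<Prod>i\<in>UNIV. (y $ i) ^ (\<alpha> $ i)))"
    by (intro Pol_sum Pol_cmul Pol_mono[OF Pol_monomial]) simp
  ultimately show "Pol k p" by simp
qed

lemma polys_eq: "polys k S = {restr S p | p. Pol k p}"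
  unfolding polys_def Pol_multi_index_sum fun_eq_iff[symmetric] by blast

lemma restr_in_polys: "Pol k p \<Longrightarrow> restr S p \<in> polys k S"
  unfolding polys_eq by blast

text \<open>Edges and faces are affine images of a standard domain, and the parametrisation has an affine left
inverse; polynomials can be moved back and forth, so their restrictions have the dimension known
for the standard domain.\<close>

lemma fin_dim_polys_param:
  fixes m :: "'j \<Rightarrow> 'b::real_normed_vector \<Rightarrow> real" and \<phi> :: "'b \<Rightarrow> real^3"
  assumes J: "finite J" and \<phi>: "affine_fun \<phi>" "affine_fun \<tau>" "\<And>t. t \<in> D \<Longrightarrow> \<tau> (\<phi> t) = t"
    and m: "\<And>j. j \<in> J \<Longrightarrow> Pol k (m j)"
    and gen: "\<And>p. Pol k p \<Longrightarrow> \<exists>c. \<forall>t. p t = (\<Sum>j\<in>J. c j * m j t)"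
    and indep: "\<And>c. (\<And>t. t \<in> D \<Longrightarrow> (\<Sum>j\<in>J. c j * m j t) = 0) \<Longrightarrow> \<forall>j\<in>J. c j = 0"
  shows "fin_dim (polys k (\<phi> ` D)) (card J)"
proof -
  let ?b = "\<lambda>j. restr (\<phi> ` D) (\<lambda>y. m j (\<tau> y))"
  have S: "(\<Sum>j\<in>J. c j * ?b j y) = restr (\<phi> ` D) (\<lambda>y. \<Sum>j\<in>J. c j * m j (\<tau> y)) y" for c y
    by (auto simp: restr_def)
  have "fin_dim {v. \<exists>c. (\<lambda>y. v y - (\<Sum>j\<in>J. c j * ?b j y)) \<in> {\<lambda>_. 0}} (0 + card J)"
  proof (rule fin_dim_extend[OF J fin_dim_0])
    fix c assume "(\<lambda>y. \<Sum>j\<in>J. c j * ?b j y) \<in> {\<lambda>_. 0}"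
    then have z: "(\<Sum>j\<in>J. c j * ?b j y) = 0" for y by (simp add: fun_eq_iff)
    show "\<forall>j\<in>J. c j = 0"
    proof (rule indep)
      fix t assume t: "t \<in> D"
      have "restr (\<phi> ` D) (\<lambda>y. \<Sum>j\<in>J. c j * m j (\<tau> y)) (\<phi> t) = 0"
        using z[of "\<phi> t"] unfolding S .
      then show "(\<Sum>j\<in>J. c j * m j t) = 0" using t \<phi>(3)[OF t] by (simp add: restr_def)
    qed
  qed
  moreover have "{v. \<exists>c. (\<lambda>y. v y - (\<Sum>j\<in>J. c j * ?b j y)) \<in> {\<lambda>_. 0}} = polys k (\<phi> ` D)"
  proof (intro set_eqI iffI)
    fix v assume "v \<in> {v. \<exists>c. (\<lambda>y. v y - (\<Sum>j\<in>J. c j * ?b j y)) \<in> {\<lambda>_. 0}}"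
    then obtain c where "\<And>y. v y = (\<Sum>j\<in>J. c j * ?b j y)" by (auto simp: fun_eq_iff)
    then have "v = restr (\<phi> ` D) (\<lambda>y. \<Sum>j\<in>J. c j * m j (\<tau> y))" unfolding S by (intro ext)
    moreover have "Pol k (\<lambda>y. \<Sum>j\<in>J. c j * m j (\<tau> y))"
      by (intro Pol_sum Pol_cmul Pol_compose[OF m \<phi>(2)])
    ultimately show "v \<in> polys k (\<phi> ` D)" by (simp add: restr_in_polys)
  next
    fix v assume "v \<in> polys k (\<phi> ` D)"
    then obtain p where p: "Pol k p" "v = restr (\<phi> ` D) p" unfolding polys_eq by blast
    obtain c where c: "\<And>t. p (\<phi> t) = (\<Sum>j\<in>J. c j * m j t)"
      using gen[OF Pol_compose[OF p(1) \<phi>(1)]] by blast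
    have "v y = (\<Sum>j\<in>J. c j * ?b j y)" for y
      unfolding S p(2) using c \<phi>(3) by (auto simp: restr_def)
    then show "v \<in> {v. \<exists>c. (\<lambda>y. v y - (\<Sum>j\<in>J. c j * ?b j y)) \<in> {\<lambda>_. 0}}"
      by (intro CollectI exI[of _ c]) simp
  qed
  ultimately show ?thesis by simp
qed

lemma fin_dim_polys_segment:
  assumes "affine_fun \<phi>" "affine_fun \<tau>" "\<And>t::real. \<tau> (\<phi> t) = t"
  shows "fin_dim (polys k (\<phi> ` {0..1})) (card {a. int a \<le> k})"
proof (rule fin_dim_polys_param[where m = "\<lambda>a t. t ^ a", OF finite_degs assms])
  show "Pol k (\<lambda>t::real. t ^ j)" if "j \<in> {a. int a \<le> k}" for j
    using Pol_mono[OF Pol_affine_power[OF affine_fun_id, of j]] that by simp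
  show "\<exists>c. \<forall>t. p t = (\<Sum>j | int j \<le> k. c j * t ^ j)" if "Pol k p" for p
    by (rule Pol_real_monomials[OF that])
  show "\<forall>j\<in>{a. int a \<le> k}. c j = 0" if "\<And>t. t \<in> {0..1} \<Longrightarrow> (\<Sum>j | int j \<le> k. c j * t ^ j) = 0" for c :: "nat \<Rightarrow> real"
  proof -
    have "{0..1} \<subseteq> {t. (\<Sum>j | int j \<le> k. c j * t ^ j) = 0}" using that by blast
    then have "infinite {t. (\<Sum>j | int j \<le> k. c j * t ^ j) = 0}"
      by (rule infinite_super) (simp add: infinite_Icc)
    from real_monomials_zero[OF finite_degs this] show ?thesis by (intro ballI)
  qed
qed

definition triangle :: "(real \<times> real) set" where
  "triangle = {(s, t). 0 \<le> s \<and> 0 \<le> t \<and> s + t \<le> 1}"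

lemma fin_dim_polys_triangle:
  assumes "affine_fun \<phi>" "affine_fun \<tau>" "\<And>z::real\<times>real. \<tau> (\<phi> z) = z"
  shows "fin_dim (polys k (\<phi> ` triangle)) (card (plane_exponents k))"
proof (rule fin_dim_polys_param[where m = "\<lambda>j z. fst z ^ fst j * snd z ^ snd j", OF finite_plane_exponents assms])
  show "Pol k (\<lambda>z::real\<times>real. fst z ^ fst j * snd z ^ snd j)" if "j \<in> plane_exponents k" for j
    using Pol_mono[OF Pol_mult[OF Pol_affine_power[OF affine_fun_fst, of "fst j"] Pol_affine_power[OF affine_fun_snd, of "snd j"]]] that
    by (auto simp: plane_exponents_def)
  show "\<exists>c. \<forall>t. p t = (\<Sum>j\<in>plane_exponents k. c j * (fst t ^ fst j * snd t ^ snd j))" if "Pol k p" for p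
    by (rule Pol_plane_monomials[OF that])
  show "\<forall>j\<in>plane_exponents k. c j = 0" if "\<And>t. t \<in> triangle \<Longrightarrow> (\<Sum>j\<in>plane_exponents k. c j * (fst t ^ fst j * snd t ^ snd j)) = 0" for c
  proof
    fix j assume "j \<in> plane_exponents k"
    then show "c j = 0"
    proof (rule plane_monomials_zero[rotated])
      fix s t :: real assume "0 < s" "0 < t" "s + t < 1"
      then show "(\<Sum>j\<in>plane_exponents k. c j * (s ^ fst j * t ^ snd j)) = 0"
        using that[of "(s, t)"] by (simp add: triangle_def)
    qed
  qed
qed

section \<open>Moments of polynomials\<close>

lemma integrable_on_compact:
  fixes f :: "'a::euclidean_space \<Rightarrow> real"
  assumes "compact S" "continuous_on S f" shows "f integrable_on S"
  using set_borel_integral_eq_integral(1)[of S f] borel_integrable_compact[OF assms]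
  by (simp add: set_integrable_def)

lemma integral_zero_interior:
  fixes f :: "'a::euclidean_space \<Rightarrow> real"
  assumes S: "compact S" "continuous_on S f" and nn: "\<And>y. y \<in> S \<Longrightarrow> 0 \<le> f y" and z: "integral S f = 0"
    and y: "y \<in> interior S"
  shows "f y = 0"
proof -
  obtain a b where ab: "y \<in> box a b" "cbox a b \<subseteq> interior S"
    by (rule open_contains_cbox[OF open_interior y])
  have sub: "cbox a b \<subseteq> S" using ab(2) interior_subset by blast
  have c: "continuous_on (cbox a b) f" using S(2) sub by (rule continuous_on_subset)
  have "integral (cbox a b) f \<le> integral S f"
    by (rule integral_subset_le[OF sub integrable_continuous[OF c] integrable_on_compact[OF S]]) (use nn in auto)
  moreover have "0 \<le> integral (cbox a b) f"
    by (rule integral_nonneg[OF integrable_continuous[OF c]]) (use nn sub in auto)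
  ultimately have "integral (cbox a b) f = 0" using z by simp
  then have "(f has_integral 0) (cbox a b)" using integrable_integral[OF integrable_continuous[OF c]] by simp
  moreover have "0 \<le> f z" if "z \<in> box a b" for z
    using that nn sub box_subset_cbox[of a b] by (meson subsetD)
  ultimately show ?thesis
    using has_integral_0_cbox_imp_0[OF c, of y] ab(1) box_subset_cbox[of a b] by (metis empty_iff subsetD)
qed

lemma Pol_integral_square_zero:
  fixes q :: "'a::euclidean_space \<Rightarrow> real"
  assumes S: "compact S" "convex S" "interior S \<noteq> {}" and w: "Pol d w" "\<And>y. y \<in> S \<Longrightarrow> 0 \<le> w y" "w y0 \<noteq> 0"
    and q: "Pol e q" and z: "integral S (\<lambda>y. w y * q y * q y) = 0"
  shows "q y = 0"
proof -
  have P: "Pol (d + e + e) (\<lambda>y. w y * q y * q y)" by (intro Pol_mult w q)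
  have "w y * q y * q y = 0" for y
  proof (rule Pol_zero_interior[OF P, of "interior S"])
    show "w y * q y * q y = 0" if "y \<in> interior S" for y
      using integral_zero_interior[OF S(1) Pol_continuous_on[OF P] _ z that] w(2) by (simp add: mult.assoc)
  qed (use S convex_interior in auto)
  then have "w y * (q y * q y) = 0" for y by (simp add: mult.assoc)
  from Pol_cancel[OF w(1) Pol_mult[OF q q] affine_UNIV UNIV_I w(3) UNIV_I this] show ?thesis by simp
qed

lemma triangle_hull: "triangle = convex hull {(0, 0), (1, 0), (0, 1)}"
proof -
  have "triangle = {u *\<^sub>R (0, 0) + v *\<^sub>R (1, 0) + w *\<^sub>R (0, 1) | u v w. 0 \<le> u \<and> 0 \<le> v \<and> 0 \<le> w \<and> u + v + w = 1}"
    (is "_ = ?R")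
  proof (intro set_eqI iffI)
    fix z assume z: "z \<in> triangle"
    then show "z \<in> ?R"
      by (intro CollectI exI[of _ "1 - fst z - snd z"] exI[of _ "fst z"] exI[of _ "snd z"])
        (auto simp: triangle_def)
  qed (auto simp: triangle_def)
  then show ?thesis by (simp only: convex_hull_3)
qed

lemma compact_triangle: "compact triangle" and convex_triangle: "convex triangle"
  unfolding triangle_hull by (simp_all add: compact_convex_hull finite_imp_compact)

lemma interior_triangle: "interior triangle \<noteq> {}"
proof -
  have "open {z::real\<times>real. 0 < fst z}" "open {z::real\<times>real. 0 < snd z}" "open {z::real\<times>real. fst z + snd z < 1}"
    by (intro open_Collect_less continuous_intros)+
  then have "open ({z::real\<times>real. 0 < fst z} \<inter> {z. 0 < snd z} \<inter> {z. fst z + snd z < 1})" by (intro open_Int)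
  moreover have "{z::real\<times>real. 0 < fst z} \<inter> {z. 0 < snd z} \<inter> {z. fst z + snd z < 1} \<subseteq> triangle"
    by (auto simp: triangle_def)
  ultimately have "{z::real\<times>real. 0 < fst z} \<inter> {z. 0 < snd z} \<inter> {z. fst z + snd z < 1} \<subseteq> interior triangle"
    by (rule interior_maximal[rotated])
  moreover have "(1/4, 1/4) \<in> {z::real\<times>real. 0 < fst z} \<inter> {z. 0 < snd z} \<inter> {z. fst z + snd z < 1}" by simp
  ultimately show ?thesis by blast
qed

section \<open>Half-spaces, and derivatives within convex sets\<close>

lemma convex_affine_nonneg:
  assumes "affine_fun A" shows "convex {y. 0 \<le> (A y :: real)}"
  unfolding convex_alt
proof (intro ballI allI impI)
  fix a b and u :: real assume *: "a \<in> {y. 0 \<le> A y}" "b \<in> {y. 0 \<le> A y}" "0 \<le> u \<and> u \<le> 1"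
  have "(1 - u) *\<^sub>R a + u *\<^sub>R b = a + u *\<^sub>R (b - a)" by (simp add: algebra_simps)
  moreover have "A a + u * (A b - A a) = (1 - u) * A a + u * A b" by (simp add: algebra_simps)
  ultimately show "(1 - u) *\<^sub>R a + u *\<^sub>R b \<in> {y. 0 \<le> A y}"
    using affine_fun_line[OF assms, of a u b] * by simp
qed

lemma affine_fun_continuous: "affine_fun A \<Longrightarrow> continuous_on S A"
  unfolding affine_fun_def using linear_continuous_on continuous_on_add[OF continuous_on_const] by blast

text \<open>All vertex numbers in some order.  Arguments about a face, an edge or an interior plane use names
for the other vertices and are symmetric in them.\<close>

definition four :: "nat \<Rightarrow> nat \<Rightarrow> nat \<Rightarrow> nat \<Rightarrow> bool" where
  "four i j k l \<longleftrightarrow> distinct [i, j, k, l] \<and> {..3} = {i, j, k, l}"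

lemma four_sum: "four i j k l \<Longrightarrow> sum f {..3} = f i + f j + f k + f l"
  by (auto simp: four_def add.assoc)

lemma four_swap: "four i j k l \<Longrightarrow> four j i k l" "four i j k l \<Longrightarrow> four i k j l" "four i j k l \<Longrightarrow> four i j l k"
  by (auto simp: four_def)

lemma four_le: "four i j k l \<Longrightarrow> i \<le> 3 \<and> j \<le> 3 \<and> k \<le> 3 \<and> l \<le> 3"
  unfolding four_def by (metis atMost_iff insertCI)

lemma four_exists:
  assumes "i \<le> 3" "j \<le> 3" "i \<noteq> j" obtains k l where "four i j k l"
proof -
  have "card ({..3} - {i, j}) = 2" using assms by (simp add: card_Diff_subset)
  then obtain k l where kl: "{..3} - {i, j} = {k, l}" "k \<noteq> l" by (auto simp: card_2_iff)
  then have "four i j k l" using assms unfolding four_def by (auto simp: set_eq_iff)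
  then show thesis by (rule that)
qed

lemma four_exists1:
  assumes "i \<le> 3" obtains j k l where "four i j k l"
proof -
  have "(if i = 0 then 1 else 0::nat) \<le> 3" "i \<noteq> (if i = 0 then 1 else 0)" by auto
  from four_exists[OF assms this] that show thesis by blast
qed

lemma ball_small_step:
  fixes v :: "'a::real_normed_vector"
  assumes "0 < e" obtains t where "0 < t" "q + t *\<^sub>R v \<in> ball q e"
proof (rule that[of "e / (norm v + 1)"])
  have n: "norm v + 1 > 0" using norm_ge_zero[of v] by linarith
  show "0 < e / (norm v + 1)" using assms n by simp
  have "e * norm v < e * (norm v + 1)" using assms by simp
  then have "e / (norm v + 1) * norm v < e" using n by (simp add: pos_divide_less_eq)
  then show "q + (e / (norm v + 1)) *\<^sub>R v \<in> ball q e" using assms n by (simp add: dist_norm)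
qed

text \<open>At a boundary point the two derivatives agree on all directions that point into the set.  These
contain a ball up to translation, hence span the space.\<close>

lemma has_derivative_within_convex_unique:
  fixes f :: "'a::euclidean_space \<Rightarrow> 'b::euclidean_space"
  assumes C: "convex C" "interior C \<noteq> {}" "p \<in> C"
    and A: "(f has_derivative A) (at p within C)" and B: "(f has_derivative B) (at p within C)"
  shows "A = B"
proof -
  interpret A: bounded_linear A using A by (rule has_derivative_bounded_linear)
  interpret B: bounded_linear B using B by (rule has_derivative_bounded_linear)
  have eq: "A (q - p) = B (q - p)" if q: "q \<in> C" for q
  proof -
    let ?g = "\<lambda>t::real. p + t *\<^sub>R (q - p)"
    have im: "?g ` {0..1} \<subseteq> C"
    proof safe
      fix t :: real assume t: "t \<in> {0..1}"
      have "?g t = (1 - t) *\<^sub>R p + t *\<^sub>R q" by (simp add: algebra_simps)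
      also have "\<dots> \<in> C" using C(1,3) q t by (intro convexD) auto
      finally show "?g t \<in> C" .
    qed
    have dg: "(?g has_derivative (\<lambda>t. t *\<^sub>R (q - p))) (at 0 within {0..1})"
      by (auto intro!: derivative_eq_intros)
    have "((\<lambda>t. f (?g t)) has_derivative (\<lambda>t. D (t *\<^sub>R (q - p)))) (at 0 within {0..1})"
      if "(f has_derivative D) (at p within C)" for D
      by (rule has_derivative_in_compose[OF dg]) (use has_derivative_subset[OF that im] in simp)
    from this[OF A] this[OF B]
    have "((\<lambda>t. f (?g t)) has_vector_derivative A (q - p)) (at 0 within {0..1})"
      "((\<lambda>t. f (?g t)) has_vector_derivative B (q - p)) (at 0 within {0..1})"
      by (simp_all add: has_vector_derivative_def A.scaleR B.scaleR)
    then show ?thesis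
      by (intro vector_derivative_unique_within_closed_interval[of 0 1 0]) auto
  qed
  obtain q e where e: "0 < e" "ball q e \<subseteq> C"
    using C(2) by (metis ex_in_conv mem_interior)
  show ?thesis
  proof
    fix v
    obtain t where t: "0 < t" "q + t *\<^sub>R v \<in> ball q e" using ball_small_step[OF e(1)] .
    have 1: "A (q + t *\<^sub>R v - p) = B (q + t *\<^sub>R v - p)" using e t by (intro eq) blast
    have 2: "A (q - p) = B (q - p)" using e by (intro eq) auto
    have "A (t *\<^sub>R v) = B (t *\<^sub>R v)"
      using 1 2 A.diff[of "q + t *\<^sub>R v - p" "q - p"] B.diff[of "q + t *\<^sub>R v - p" "q - p"] by simp
    then show "A v = B v" using t by (simp add: A.scaleR B.scaleR)
  qed
qed

lemma has_derivative_within_Un: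
  assumes "(f has_derivative D) (at y within S)" "(f has_derivative D) (at y within S')"
  shows "(f has_derivative D) (at y within (S \<union> S'))"
proof -
  note D = assms[unfolded has_derivative_within]
  from D show ?thesis unfolding has_derivative_within
    by (intro conjI) (blast, subst at_within_union, rule filterlim_sup, blast+)
qed

lemma has_derivative_within_UN:
  assumes "finite I" "bounded_linear D" "\<And>i. i \<in> I \<Longrightarrow> (f has_derivative D) (at y within S i)"
  shows "(f has_derivative D) (at y within (\<Union>i\<in>I. S i))"
  using assms(1,3)
proof (induction I rule: finite_induct)
  case empty
  then show ?case using assms(2) by (simp add: has_derivative_def)
next
  case (insert a I)
  then show ?case by (simp add: has_derivative_within_Un)
qed

section \<open>Barycentric coordinates and the Alfeld split\<close>

locale tetrahedron =
  fixes x :: "nat \<Rightarrow> real^3"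
  assumes nondeg: "nondegenerate x"
begin

lemma vertices_inj: "inj_on x {..3}" and vertices_indep: "\<not> affine_dependent (x ` {..3})"
  using nondeg by (auto simp: nondegenerate_def)

definition lam :: "nat \<Rightarrow> real^3 \<Rightarrow> real" where
  "lam i y = (SOME u. sum u {..3} = 1 \<and> (\<Sum>j\<le>3. u j *\<^sub>R x j) = y) i"

lemma lam_sum: "(\<Sum>i\<le>3. lam i y) = 1" and lam_comb: "(\<Sum>i\<le>3. lam i y *\<^sub>R x i) = y"
proof -
  have "card (x ` {..3}) = Suc DIM(real^3)" using card_image[OF vertices_inj] by simp
  then have "affine hull (x ` {..3}) = UNIV" by (rule affine_independent_span_eq[OF vertices_indep])
  then obtain u where u: "sum u (x ` {..3}) = 1" "(\<Sum>v\<in>x ` {..3}. u v *\<^sub>R v) = y"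
    using affine_hull_finite[of "x ` {..3}"] by blast
  have "\<exists>u. sum u {..3} = 1 \<and> (\<Sum>j\<le>3. u j *\<^sub>R x j) = y"
    using u by (intro exI[of _ "\<lambda>j. u (x j)"]) (simp add: sum.reindex[OF vertices_inj])
  from someI_ex[OF this] show "(\<Sum>i\<le>3. lam i y) = 1" "(\<Sum>i\<le>3. lam i y *\<^sub>R x i) = y"
    unfolding lam_def by blast+
qed

lemma lam_eqI:
  assumes "sum u {..3} = 1" "(\<Sum>j\<le>3. u j *\<^sub>R x j) = y" "i \<le> 3" shows "lam i y = u i"
proof (rule ccontr)
  assume ne: "lam i y \<noteq> u i"
  define w where "w = (\<lambda>v. (\<lambda>j. lam j y - u j) (the_inv_into {..3} x v))"
  have w: "w (x j) = lam j y - u j" if "j \<le> 3" for j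
    using that by (simp add: w_def the_inv_into_f_f[OF vertices_inj])
  have "sum w (x ` {..3}) = 0"
    using assms(1) lam_sum[of y] by (simp add: sum.reindex[OF vertices_inj] w sum_subtractf)
  moreover have "(\<Sum>v\<in>x ` {..3}. w v *\<^sub>R v) = 0"
    using assms(2) lam_comb[of y] by (simp add: sum.reindex[OF vertices_inj] w sum_subtractf scaleR_diff_left)
  moreover have "\<exists>v\<in>x ` {..3}. w v \<noteq> 0" using ne assms(3) w[of i] by (intro bexI[of _ "x i"]) auto
  ultimately have "affine_dependent (x ` {..3})"
    by (subst affine_dependent_explicit_finite) auto
  with vertices_indep show False by simp
qed

lemma lam_x: "i \<le> 3 \<Longrightarrow> j \<le> 3 \<Longrightarrow> lam i (x j) = (if i = j then 1 else 0)"
proof -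
  assume i: "i \<le> 3" and j: "j \<le> 3"
  have "(\<Sum>k\<le>3. (if k = j then 1 else 0) *\<^sub>R x k) = x j"
    using j by (subst sum.remove[of _ j]) (auto intro!: sum.neutral)
  moreover have "(\<Sum>k\<le>3. (if k = j then 1 else 0::real)) = 1" using j by simp
  ultimately show ?thesis using lam_eqI[of "\<lambda>k. if k = j then 1 else 0" "x j" i] i by simp
qed

lemma lam_affine_aux: "i \<le> 3 \<Longrightarrow> a + b + c = 1 \<Longrightarrow> lam i (a *\<^sub>R u + b *\<^sub>R v + c *\<^sub>R w) = a * lam i u + b * lam i v + c * lam i w"
proof (rule lam_eqI)
  assume "a + b + c = 1"
  then show "(\<Sum>i\<le>3. a * lam i u + b * lam i v + c * lam i w) = 1"
    by (simp add: sum.distrib sum_distrib_left[symmetric] lam_sum)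
  have "(\<Sum>j\<le>3. (a * lam j u + b * lam j v + c * lam j w) *\<^sub>R x j)
    = a *\<^sub>R (\<Sum>j\<le>3. lam j u *\<^sub>R x j) + b *\<^sub>R (\<Sum>j\<le>3. lam j v *\<^sub>R x j) + c *\<^sub>R (\<Sum>j\<le>3. lam j w *\<^sub>R x j)"
    by (simp add: sum.distrib scaleR_add_left scaleR_sum_right)
  then show "(\<Sum>j\<le>3. (a * lam j u + b * lam j v + c * lam j w) *\<^sub>R x j) = a *\<^sub>R u + b *\<^sub>R v + c *\<^sub>R w"
    unfolding lam_comb .
qed

lemma lam_affine: assumes "i \<le> 3" shows "affine_fun (lam i)"
proof -
  have "linear (\<lambda>y. lam i y - lam i 0)"
  proof (rule linearI)
    fix u v show "lam i (u + v) - lam i 0 = lam i u - lam i 0 + (lam i v - lam i 0)"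
      using lam_affine_aux[OF assms, of 1 1 "-1" u v 0] by simp
  next
    fix r :: real and u show "lam i (r *\<^sub>R u) - lam i 0 = r *\<^sub>R (lam i u - lam i 0)"
      using lam_affine_aux[OF assms, of r "1 - r" 0 u 0 0] by (simp add: algebra_simps)
  qed
  then have "bounded_linear (\<lambda>y. lam i y - lam i 0)" by (rule linear_conv_bounded_linear[THEN iffD1])
  then show ?thesis unfolding affine_fun_def
    by (intro exI[of _ "lam i 0"] exI[of _ "\<lambda>y. lam i y - lam i 0"]) auto
qed

lemma lam_dir: "i \<le> 3 \<Longrightarrow> lam i (y + t *\<^sub>R (u - v)) = lam i y + t * (lam i u - lam i v)"
  using lam_affine_aux[of i 1 t "-t" y u v] by (simp add: algebra_simps)

lemma lam_barycenter: "i \<le> 3 \<Longrightarrow> lam i (barycenter x) = 1 / 4"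
  by (rule lam_eqI) (simp_all add: barycenter_def scaleR_sum_right)

lemma lam_diff_affine: "i \<le> 3 \<Longrightarrow> j \<le> 3 \<Longrightarrow> affine_fun (\<lambda>y. lam i y - lam j y)"
  by (intro affine_fun_diff lam_affine)

lemma tetra_eq: "tetra x = {y. \<forall>i\<le>3. 0 \<le> lam i y}"
proof (intro subset_antisym subsetI)
  have "convex (\<Inter>i\<in>{..3}. {y. 0 \<le> lam i y})"
    by (intro convex_INT convex_affine_nonneg lam_affine) auto
  moreover have "(\<Inter>i\<in>{..3}. {y. 0 \<le> lam i y}) = {y. \<forall>i\<le>3. 0 \<le> lam i y}" by auto
  ultimately have "tetra x \<subseteq> {y. \<forall>i\<le>3. 0 \<le> lam i y}"
    unfolding tetra_def by (intro hull_minimal) (auto simp: lam_x)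
  then show "y \<in> {y. \<forall>i\<le>3. 0 \<le> lam i y}" if "y \<in> tetra x" for y using that by blast
next
  fix y assume "y \<in> {y. \<forall>i\<le>3. 0 \<le> lam i y}"
  then have "(\<Sum>i\<le>3. lam i y *\<^sub>R x i) \<in> convex hull (x ` {..3})"
    by (intro convex_sum lam_sum) (auto intro: hull_inc)
  then show "y \<in> tetra x" unfolding tetra_def lam_comb .
qed

text \<open>As the barycenter has all coordinates \<open>1/4\<close>, a point with smallest coordinate \<open>lam i y\<close> is the
convex combination of barycenter and remaining vertices with weights \<open>4 * lam i y\<close> and
\<open>lam j y - lam i y\<close>.\<close>

lemma cell_eq: assumes i: "i \<le> 3" shows "alfeld_cell x i = {y. 0 \<le> lam i y \<and> (\<forall>j\<le>3. lam i y \<le> lam j y)}"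
proof (intro subset_antisym subsetI)
  have "convex ({y. 0 \<le> lam i y} \<inter> (\<Inter>j\<in>{..3}. {y. 0 \<le> lam j y - lam i y}))"
    using i by (intro convex_Int convex_INT convex_affine_nonneg lam_affine lam_diff_affine) auto
  moreover have "{y. 0 \<le> lam i y} \<inter> (\<Inter>j\<in>{..3}. {y. 0 \<le> lam j y - lam i y}) = {y. 0 \<le> lam i y \<and> (\<forall>j\<le>3. lam i y \<le> lam j y)}"
    by auto
  ultimately have c: "convex {y. 0 \<le> lam i y \<and> (\<forall>j\<le>3. lam i y \<le> lam j y)}" by simp
  fix y assume "y \<in> alfeld_cell x i"
  moreover have "alfeld_cell x i \<subseteq> {y. 0 \<le> lam i y \<and> (\<forall>j\<le>3. lam i y \<le> lam j y)}"
    unfolding alfeld_cell_def tetra_def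
    by (rule hull_minimal[where S=convex, OF _ c]) (use i in \<open>auto simp: lam_x lam_barycenter\<close>)
  ultimately show "y \<in> {y. 0 \<le> lam i y \<and> (\<forall>j\<le>3. lam i y \<le> lam j y)}" by blast
next
  fix y assume y: "y \<in> {y. 0 \<le> lam i y \<and> (\<forall>j\<le>3. lam i y \<le> lam j y)}"
  obtain j k l where f: "four i j k l" using four_exists1[OF i] .
  define u where "u = (\<lambda>m. if m = i then 4 * lam i y else lam m y - lam i y)"
  have d: "j \<noteq> i" "k \<noteq> i" "l \<noteq> i" using f by (auto simp: four_def)
  have "sum u {..3} = 1"
    using lam_sum[of y] d unfolding four_sum[OF f] by (simp add: u_def)
  moreover have "(\<Sum>m\<in>{..3}. u m *\<^sub>R (x(i := barycenter x)) m) = y"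
  proof -
    have "(4 * lam i y) *\<^sub>R barycenter x = lam i y *\<^sub>R (x i + x j + x k + x l)"
      by (simp add: barycenter_def four_sum[OF f])
    then have "(\<Sum>m\<in>{..3}. u m *\<^sub>R (x(i := barycenter x)) m) = lam i y *\<^sub>R x i + lam j y *\<^sub>R x j + lam k y *\<^sub>R x k + lam l y *\<^sub>R x l"
      using d by (simp add: four_sum[OF f] u_def scaleR_diff_left scaleR_add_right)
    also have "\<dots> = y" using lam_comb[of y] unfolding four_sum[OF f] .
    finally show ?thesis .
  qed
  moreover have "\<forall>m\<in>{..3}. 0 \<le> u m" using y i by (auto simp: u_def)
  moreover have "(\<Sum>m\<in>{..3}. u m *\<^sub>R (x(i := barycenter x)) m) \<in> convex hull (x(i := barycenter x) ` {..3})"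
    if "sum u {..3} = 1" "\<forall>m\<in>{..3}. 0 \<le> u m"
    by (intro convex_sum that convex_convex_hull hull_inc imageI) (use that in auto)
  ultimately show "y \<in> alfeld_cell x i" unfolding alfeld_cell_def tetra_def by metis
qed

lemma cell_subset: "i \<le> 3 \<Longrightarrow> alfeld_cell x i \<subseteq> tetra x"
  unfolding cell_eq tetra_eq by force

lemma tetra_cells: "tetra x = (\<Union>i\<in>{..3}. alfeld_cell x i)"
proof (intro subset_antisym subsetI)
  fix y assume y: "y \<in> tetra x"
  have "Min ((\<lambda>i. lam i y) ` {..3}) \<in> (\<lambda>i. lam i y) ` {..3}" by (rule Min_in) auto
  then obtain i where "i \<in> {..3::nat}" "Min ((\<lambda>i. lam i y) ` {..3}) = lam i y" by blast
  moreover have "Min ((\<lambda>i. lam i y) ` {..3}) \<le> lam j y" if "j \<le> 3" for j using that by (intro Min_le) auto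
  ultimately have i: "i \<in> {..3::nat}" "\<forall>j\<in>{..3}. lam i y \<le> lam j y" by auto
  then have "y \<in> alfeld_cell x i" using y by (auto simp: cell_eq tetra_eq)
  with i show "y \<in> (\<Union>i\<in>{..3}. alfeld_cell x i)" by blast
qed (use cell_subset in auto)

lemma closed_cell: "closed (alfeld_cell x i)" and convex_cell: "convex (alfeld_cell x i)"
  and closed_tetra: "closed (tetra x)" and compact_tetra: "compact (tetra x)" and convex_tetra: "convex (tetra x)"
  unfolding alfeld_cell_def tetra_def
  by (intro compact_imp_closed compact_convex_hull finite_imp_compact finite_imageI finite_atMost convex_convex_hull)+

lemma interior_cell: assumes i: "i \<le> 3" shows "interior (alfeld_cell x i) \<noteq> {}"
proof -
  let ?U = "{y. 0 < lam i y} \<inter> (\<Inter>j\<in>{..3}-{i}. {y. lam i y < lam j y})"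
  have "open ?U"
    using i by (intro open_Int open_INT ballI open_Collect_less continuous_on_const) (auto intro: affine_fun_continuous lam_affine)
  moreover have "?U \<subseteq> alfeld_cell x i"
  proof
    fix y assume y: "y \<in> ?U"
    then have "lam i y \<le> lam j y" if "j \<le> 3" for j
      using that by (cases "j = i") (auto intro: less_imp_le)
    with y show "y \<in> alfeld_cell x i" using i by (auto simp: cell_eq)
  qed
  ultimately have "?U \<subseteq> interior (alfeld_cell x i)" by (rule interior_maximal[rotated])
  moreover have "barycenter x + (1/8) *\<^sub>R (barycenter x - x i) \<in> ?U"
    using i by (auto simp: lam_dir lam_barycenter lam_x)
  ultimately show ?thesis by blast
qed

lemma interior_tetra: "interior (tetra x) \<noteq> {}"
  using interior_cell[of 0] interior_mono[OF cell_subset[of 0]] by auto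

lemma frontier_tetra: "frontier (tetra x) = {y \<in> tetra x. \<exists>i\<le>3. lam i y = 0}"
proof (intro subset_antisym subsetI)
  fix y assume y: "y \<in> frontier (tetra x)"
  then have yT: "y \<in> tetra x" using closed_tetra frontier_subset_closed by blast
  let ?U = "\<Inter>j\<in>{..3}. {y. 0 < lam j y}"
  have "open ?U" by (intro open_INT ballI open_Collect_less continuous_on_const) (auto intro: affine_fun_continuous lam_affine)
  moreover have "?U \<subseteq> tetra x" by (auto simp: tetra_eq less_imp_le)
  ultimately have "?U \<subseteq> interior (tetra x)" by (rule interior_maximal[rotated])
  then have "y \<notin> ?U" using y by (auto simp: frontier_def)
  then obtain j where "j \<le> 3" "\<not> 0 < lam j y" by auto
  then show "y \<in> {y \<in> tetra x. \<exists>i\<le>3. lam i y = 0}" using yT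
    by (auto simp: tetra_eq intro!: exI[of _ j] antisym)
next
  fix y assume "y \<in> {y \<in> tetra x. \<exists>i\<le>3. lam i y = 0}"
  then obtain i where y: "y \<in> tetra x" and i: "i \<le> 3" "lam i y = 0" by blast
  have "y \<notin> interior (tetra x)"
  proof
    assume "y \<in> interior (tetra x)"
    then obtain e where e: "0 < e" "ball y e \<subseteq> tetra x" by (auto simp: mem_interior)
    define v where "v = barycenter x - x i"
    obtain t where t: "0 < t" "y + t *\<^sub>R v \<in> ball y e" using ball_small_step[OF e(1)] .
    have "y + t *\<^sub>R v \<in> tetra x" using e t by blast
    then have "0 \<le> lam i (y + t *\<^sub>R v)" using i by (simp add: tetra_eq)
    moreover have "lam i (y + t *\<^sub>R v) = t * (1/4 - 1)"
      using i by (simp add: v_def lam_dir lam_barycenter lam_x)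
    ultimately show False using t by simp
  qed
  then show "y \<in> frontier (tetra x)" using y closed_tetra by (simp add: frontier_def)
qed

end

section \<open>Splines as glued families of polynomials\<close>

lemma dird_square_mult:
  assumes A: "affine_fun A" and q: "Pol d q"
  shows "dird w (\<lambda>y. A y ^ 2 * q y) = (\<lambda>y. A y * (2 * dird w A 0 * q y + A y * dird w q y))"
proof
  fix y
  have c: "dird w A y = dird w A 0" by (rule dird_affine_const[OF A])
  have "dird w (\<lambda>y. A y * (A y * q y)) y = A y * (A y * dird w q y + dird w A y * q y) + dird w A y * (A y * q y)"
    by (simp only: dird_mult[OF Pol_affine[OF A] Pol_mult[OF Pol_affine[OF A] q]] dird_mult[OF Pol_affine[OF A] q])
  then show "dird w (\<lambda>y. A y ^ 2 * q y) y = A y * (2 * dird w A 0 * q y + A y * dird w q y)"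
    by (simp add: power2_eq_square mult.assoc c algebra_simps)
qed

lemma dird2_square_mult:
  assumes A: "affine_fun A" and q: "Pol d q" and y: "A y = 0"
  shows "dird v (dird w (\<lambda>y. A y ^ 2 * q y)) y = 2 * dird v A 0 * dird w A 0 * q y"
proof -
  have "Pol d (\<lambda>y. 2 * dird w A 0 * q y + A y * dird w q y)"
    by (rule Pol.add[OF Pol_cmul[OF q]]) (use Pol_mult[OF Pol_affine[OF A] Pol_dird[OF q]] in simp)
  from dird_mult[OF Pol_affine[OF A] this, of v y] show ?thesis
    unfolding dird_square_mult[OF A q] using y by (simp add: dird_affine_const[OF A, of v y 0])
qed

lemma has_derivative_within_isolated:
  assumes "closed S" "y \<notin> S" "bounded_linear D" shows "(f has_derivative D) (at y within S)"
proof -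
  have "at y within S = bot"
    using assms(1,2) by (meson closed_limpt trivial_limit_within trivial_limit_def)
  then show ?thesis using assms(3) by (simp add: has_derivative_def)
qed

context tetrahedron
begin

text \<open>The algebraic form of \<open>C\<^sup>1\<close> smoothness across the plane that contains the common face of two cells.\<close>

definition C1_family :: "(nat \<Rightarrow> real^3 \<Rightarrow> real) \<Rightarrow> bool" where
  "C1_family f \<longleftrightarrow> (\<forall>i\<le>3. \<forall>j\<le>3. \<exists>d q. Pol d q \<and> (\<forall>y. f i y - f j y = (lam i y - lam j y) ^ 2 * q y))"

definition cell_no :: "real^3 \<Rightarrow> nat" where
  "cell_no y = (LEAST i. i \<le> 3 \<and> y \<in> alfeld_cell x i)"

text \<open>On overlaps the cell with the smallest number decides.  That choice does not depend on the family,
so gluing is linear even for families that do not match.\<close>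

definition glue :: "(nat \<Rightarrow> real^3 \<Rightarrow> real) \<Rightarrow> real^3 \<Rightarrow> real" where
  "glue f = (\<lambda>y. if y \<in> tetra x then f (cell_no y) y else 0)"

definition spline_family :: "int \<Rightarrow> (nat \<Rightarrow> real^3 \<Rightarrow> real) \<Rightarrow> bool" where
  "spline_family r f \<longleftrightarrow> (\<forall>i\<le>3. Pol r (f i)) \<and> C1_family f"

lemma cell_no: assumes "y \<in> tetra x" shows "cell_no y \<le> 3" "y \<in> alfeld_cell x (cell_no y)"
proof -
  obtain i where i: "i \<le> 3 \<and> y \<in> alfeld_cell x i" using assms unfolding tetra_cells by auto
  from LeastI[of "\<lambda>i. i \<le> 3 \<and> y \<in> alfeld_cell x i", OF i]
  show "cell_no y \<le> 3" "y \<in> alfeld_cell x (cell_no y)" unfolding cell_no_def by auto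
qed

lemma cells_lam_eq: "i \<le> 3 \<Longrightarrow> j \<le> 3 \<Longrightarrow> y \<in> alfeld_cell x i \<Longrightarrow> y \<in> alfeld_cell x j \<Longrightarrow> lam i y = lam j y"
  by (auto simp: cell_eq intro: antisym)

lemma C1_family_eq:
  assumes "C1_family f" "i \<le> 3" "j \<le> 3" "lam i y = lam j y" shows "f i y = f j y"
proof -
  obtain d q where "\<And>y. f i y - f j y = (lam i y - lam j y) ^ 2 * q y"
    using assms(1-3) unfolding C1_family_def by blast
  from this[of y] assms(4) show ?thesis by simp
qed

lemma C1_family_dird:
  assumes f: "C1_family f" "i \<le> 3" "j \<le> 3" and P: "Pol d (f i)" "Pol d (f j)" and y: "lam i y = lam j y"
  shows "dird v (f i) y = dird v (f j) y"
proof -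
  obtain e q where q: "Pol e q" "\<And>y. f i y - f j y = (lam i y - lam j y) ^ 2 * q y"
    using f unfolding C1_family_def by blast
  have "dird v (f i) y - dird v (f j) y = dird v (\<lambda>y. f i y - f j y) y"
    by (simp only: dird_diff[OF P])
  also have "\<dots> = 0" unfolding q(2) dird_square_mult[OF lam_diff_affine[OF f(2,3)] q(1)] using y by simp
  finally show ?thesis by simp
qed

lemma glue_eq:
  assumes "C1_family f" "i \<le> 3" "y \<in> alfeld_cell x i" shows "glue f y = f i y"
proof -
  have y: "y \<in> tetra x" using assms(2,3) cell_subset by blast
  from C1_family_eq[OF assms(1) cell_no(1)[OF y] assms(2) cells_lam_eq[OF cell_no(1)[OF y] assms(2) cell_no(2)[OF y] assms(3)]]
  show ?thesis using y by (simp add: glue_def)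
qed

lemma glue_outside: "y \<notin> tetra x \<Longrightarrow> glue f y = 0"
  by (simp add: glue_def)

lemma piecewise_has_derivative:
  assumes D: "bounded_linear D"
    and g: "\<And>i z. i \<le> 3 \<Longrightarrow> z \<in> alfeld_cell x i \<Longrightarrow> g z = p i z"
    and p: "\<And>i. i \<le> 3 \<Longrightarrow> y \<in> alfeld_cell x i \<Longrightarrow> (p i has_derivative D) (at y)"
  shows "(g has_derivative D) (at y within tetra x)"
  unfolding tetra_cells
proof (rule has_derivative_within_UN[OF finite_atMost D])
  fix i :: nat assume "i \<in> {..3}"
  then have i: "i \<le> 3" by simp
  show "(g has_derivative D) (at y within alfeld_cell x i)"
  proof (cases "y \<in> alfeld_cell x i")
    case True
    show ?thesis
      by (rule has_derivative_transform[OF True g[OF i] has_derivative_at_withinI[OF p[OF i True]]])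
  next
    case False
    then show ?thesis by (rule has_derivative_within_isolated[OF closed_cell _ D])
  qed
qed

lemma frechet_within_tetra:
  assumes "y \<in> tetra x" "(g has_derivative D) (at y within tetra x)"
  shows "frechet_derivative (g :: real^3 \<Rightarrow> real) (at y within tetra x) = D"
proof (rule has_derivative_within_convex_unique[OF convex_tetra interior_tetra assms(1)])
  show "(g has_derivative frechet_derivative g (at y within tetra x)) (at y within tetra x)"
    using assms(2) by (meson differentiable_def frechet_derivative_works)
qed (rule assms(2))

lemma glue_has_derivative:
  assumes f: "spline_family r f" and i: "i \<le> 3" "y \<in> alfeld_cell x i"
  shows "(glue f has_derivative (\<lambda>v. dird v (f i) y)) (at y within tetra x)"
proof (rule piecewise_has_derivative[where p = f])
  have P: "Pol r (f j)" if "j \<le> 3" for j using f that by (auto simp: spline_family_def)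
  have C: "C1_family f" using f by (simp add: spline_family_def)
  show "bounded_linear (\<lambda>v. dird v (f i) y)"
    using dird_linear[OF P[OF i(1)]] by (rule linear_conv_bounded_linear[THEN iffD1])
  show "glue f z = f j z" if "j \<le> 3" "z \<in> alfeld_cell x j" for j z by (rule glue_eq[OF C that])
  show "(f j has_derivative (\<lambda>v. dird v (f i) y)) (at y)" if j: "j \<le> 3" "y \<in> alfeld_cell x j" for j
  proof -
    have "dird v (f j) y = dird v (f i) y" for v
      by (rule C1_family_dird[OF C j(1) i(1) P P cells_lam_eq]) (use i j in auto)
    then show ?thesis using Pol_has_derivative[OF P[OF j(1)], of y] by simp
  qed
qed

lemma partial_der_glue:
  assumes "spline_family r f" "i \<le> 3" "y \<in> alfeld_cell x i"
  shows "partial_der (tetra x) j (glue f) y = dird (axis j 1) (f i) y"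
  using frechet_within_tetra[OF _ glue_has_derivative[OF assms]] assms cell_subset
  by (simp add: partial_der_def subset_eq)

lemma dird_inner:
  assumes "Pol d (p :: real^3 \<Rightarrow> real)" shows "(\<chi> j. dird (axis j 1) p y) \<bullet> v = dird v p y"
proof -
  interpret l: linear "\<lambda>v. dird v p y" by (rule dird_linear[OF assms])
  have "dird v p y = dird (\<Sum>j\<in>UNIV. v $ j *\<^sub>R axis j 1) p y"
    using basis_expansion[of v] by (simp add: scalar_mult_eq_scaleR)
  also have "\<dots> = (\<Sum>j\<in>UNIV. v $ j * dird (axis j 1) p y)" by (simp add: l.sum l.scale)
  finally show ?thesis by (simp add: inner_vec_def mult.commute)
qed

lemma grad_glue:
  assumes f: "spline_family r f" "i \<le> 3" "y \<in> alfeld_cell x i"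
  shows "grad (tetra x) (glue f) y \<bullet> v = dird v (f i) y"
proof -
  have "Pol r (f i)" using f by (auto simp: spline_family_def)
  from dird_inner[OF this] show ?thesis by (simp add: grad_def partial_der_glue[OF f])
qed

lemma vertex_cell: "m \<le> 3 \<Longrightarrow> i \<le> 3 \<Longrightarrow> x m \<in> alfeld_cell x i \<longleftrightarrow> i \<noteq> m"
proof -
  assume m: "m \<le> 3" and i: "i \<le> 3"
  have "\<exists>j\<le>3. j \<noteq> m" by (rule exI[of _ "if m = 0 then 1 else 0"]) auto
  then obtain j where "j \<le> 3" "j \<noteq> m" by blast
  then show ?thesis using m i by (auto simp: cell_eq lam_x)
qed

text \<open>Splines are \<open>C\<^sup>2\<close> at the vertices of the tetrahedron.  The three cells at \<open>x m\<close> give an identity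
\<open>u\<^sup>2 q1 + v\<^sup>2 q2 + w\<^sup>2 q3 = 0\<close> with \<open>u + v + w = 0\<close>.  Along each edge at \<open>x m\<close> one of \<open>u, v, w\<close> vanishes
and the other two are opposite, so the sum of two of the three \<open>q\<close> vanishes at \<open>x m\<close>.  Then each
\<open>q\<close> does, and the Hessian of a difference \<open>u\<^sup>2 q1\<close> at \<open>x m\<close> is \<open>2 * q1 (x m)\<close> times a fixed matrix.\<close>

lemma C2_at_vertex:
  assumes f: "spline_family r f" and i: "i \<le> 3" "j \<le> 3" "i \<noteq> m" "j \<noteq> m" and m: "m \<le> 3"
  shows "dird v (dird w (f i)) (x m) = dird v (dird w (f j)) (x m)"
proof (cases "i = j")
  case False
  obtain k l where "four i j k l" using four_exists[OF i(1,2) False] .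
  then obtain k where k: "four m i j k"
  proof -
    assume *: "four i j k l"
    then have "m = k \<or> m = l" using i m unfolding four_def by (metis atMost_iff insertE singletonD)
    with * have "four m i j l \<or> four m i j k" by (auto simp: four_def)
    then show thesis using that by blast
  qed
  have k3: "k \<le> 3" using four_le[OF k] by simp
  have ne: "m \<noteq> i" "m \<noteq> j" "m \<noteq> k" "i \<noteq> j" "i \<noteq> k" "j \<noteq> k" using k by (auto simp: four_def)
  have P: "Pol r (f n)" if "n \<le> 3" for n using f that by (auto simp: spline_family_def)
  have "C1_family f" using f by (simp add: spline_family_def)
  then obtain d1 q1 d2 q2 d3 q3 where q1: "Pol d1 q1" "\<And>y. f i y - f j y = (lam i y - lam j y)\<^sup>2 * q1 y"
    and q2: "Pol d2 q2" "\<And>y. f j y - f k y = (lam j y - lam k y)\<^sup>2 * q2 y"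
    and q3: "Pol d3 q3" "\<And>y. f k y - f i y = (lam k y - lam i y)\<^sup>2 * q3 y"
    unfolding C1_family_def using i(1,2) k3 by meson
  have eq: "(lam i y - lam j y)\<^sup>2 * q1 y + (lam j y - lam k y)\<^sup>2 * q2 y + (lam k y - lam i y)\<^sup>2 * q3 y = 0" for y
    unfolding q1(2)[symmetric] q2(2)[symmetric] q3(2)[symmetric] by simp
  \<comment> \<open>On a ray from \<open>x m\<close> the factor \<open>t\<^sup>2\<close> cancels as polynomials in \<open>t\<close>, so \<open>t = 0\<close> is allowed.\<close>
  have cancel: "a (x m) + b (x m) = 0"
    if ab: "Pol da a" "Pol db b" and z: "\<And>t. t\<^sup>2 * a (x m + t *\<^sub>R u) + t\<^sup>2 * b (x m + t *\<^sub>R u) = 0" for a b u da db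
  proof -
    have aff: "affine_fun (\<lambda>t. x m + t *\<^sub>R u)" by (intro affine_intros)
    have "Pol (max da db) (\<lambda>t. a (x m + t *\<^sub>R u) + b (x m + t *\<^sub>R u))"
      by (intro Pol.add Pol_mono[OF Pol_compose[OF ab(1) aff]] Pol_mono[OF Pol_compose[OF ab(2) aff]]) auto
    from Pol_cancel[OF Pol_affine_power[OF affine_fun_id] this affine_UNIV, of 1 2 0]
    show ?thesis using z by (simp add: distrib_left)
  qed
  have lm: "lam n (x m + t *\<^sub>R (x n' - x m)) = (if n = n' then t else 0)" if "n \<le> 3" "n' \<le> 3" "n \<noteq> m" for n n' t
    using that m by (simp add: lam_dir lam_x)
  have 1: "q1 (x m) + q3 (x m) = 0"
    by (rule cancel[OF q1(1) q3(1), of "x i - x m"])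
      (use eq[of "x m + t *\<^sub>R (x i - x m)" for t] i k3 ne in \<open>simp add: lm\<close>)
  have 2: "q1 (x m) + q2 (x m) = 0"
    by (rule cancel[OF q1(1) q2(1), of "x j - x m"])
      (use eq[of "x m + t *\<^sub>R (x j - x m)" for t] i k3 ne in \<open>simp add: lm\<close>)
  have 3: "q2 (x m) + q3 (x m) = 0"
    by (rule cancel[OF q2(1) q3(1), of "x k - x m"])
      (use eq[of "x m + t *\<^sub>R (x k - x m)" for t] i k3 ne in \<open>simp add: lm\<close>)
  have q0: "q1 (x m) = 0" using 1 2 3 by linarith
  have w: "dird w (\<lambda>y. f i y - f j y) = (\<lambda>y. dird w (f i) y - dird w (f j) y)"
    by (rule ext) (rule dird_diff[OF P[OF i(1)] P[OF i(2)]])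
  have "dird v (dird w (f i)) (x m) - dird v (dird w (f j)) (x m) = dird v (dird w (\<lambda>y. f i y - f j y)) (x m)"
    unfolding w by (rule dird_diff[OF Pol_dird[OF P[OF i(1)]] Pol_dird[OF P[OF i(2)]], symmetric])
  also have "\<dots> = 0"
    unfolding q1(2) using ne i m
    by (subst dird2_square_mult[OF lam_diff_affine[OF i(1,2)] q1(1)]) (auto simp: lam_x q0)
  finally show ?thesis by simp
qed simp

lemma partial_der2_glue:
  assumes f: "spline_family r f" and i: "i \<le> 3" "i \<noteq> m" and m: "m \<le> 3"
  shows "partial_der (tetra x) a (partial_der (tetra x) b (glue f)) (x m) = dird (axis a 1) (dird (axis b 1) (f i)) (x m)"
proof -
  have P: "Pol r (f n)" if "n \<le> 3" for n using f that by (auto simp: spline_family_def)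
  have mi: "x m \<in> tetra x" using m by (simp add: tetra_eq lam_x)
  have "(partial_der (tetra x) b (glue f) has_derivative (\<lambda>v. dird v (dird (axis b 1) (f i)) (x m))) (at (x m) within tetra x)"
  proof (rule piecewise_has_derivative[where p = "\<lambda>i. dird (axis b 1) (f i)"])
    show "bounded_linear (\<lambda>v. dird v (dird (axis b 1) (f i)) (x m))"
      using dird_linear[OF Pol_dird[OF P[OF i(1)]]] by (rule linear_conv_bounded_linear[THEN iffD1])
    show "partial_der (tetra x) b (glue f) z = dird (axis b 1) (f j) z" if "j \<le> 3" "z \<in> alfeld_cell x j" for j z
      by (rule partial_der_glue[OF f that])
    show "(dird (axis b 1) (f j) has_derivative (\<lambda>v. dird v (dird (axis b 1) (f i)) (x m))) (at (x m))"
      if j: "j \<le> 3" "x m \<in> alfeld_cell x j" for j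
    proof -
      have "j \<noteq> m" using j m vertex_cell by blast
      then have "dird v (dird (axis b 1) (f j)) (x m) = dird v (dird (axis b 1) (f i)) (x m)" for v
        using C2_at_vertex[OF f j(1) i(1) _ i(2) m] by blast
      then show ?thesis using Pol_has_derivative[OF Pol_dird[OF P[OF j(1)]], of "axis b 1" "x m"] by simp
    qed
  qed
  from frechet_within_tetra[OF mi this] show ?thesis by (simp add: partial_der_def)
qed

lemma interface_affine_hull:
  assumes f: "four i j k l" and y: "lam i y = lam j y"
  shows "y \<in> affine hull (alfeld_cell x i \<inter> alfeld_cell x j)"
proof -
  note le = four_le[OF f]
  have ne: "i \<noteq> j" "i \<noteq> k" "i \<noteq> l" "j \<noteq> k" "j \<noteq> l" "k \<noteq> l" using f by (auto simp: four_def)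
  define u where "u = lam i y"
  have "barycenter x \<in> alfeld_cell x i \<inter> alfeld_cell x j" "x k \<in> alfeld_cell x i \<inter> alfeld_cell x j" "x l \<in> alfeld_cell x i \<inter> alfeld_cell x j"
    using le ne by (auto simp: cell_eq lam_barycenter lam_x)
  then have "{barycenter x, x k, x l} \<subseteq> alfeld_cell x i \<inter> alfeld_cell x j" by blast
  from hull_mono[OF this, of affine]
  have sub: "affine hull {barycenter x, x k, x l} \<subseteq> affine hull (alfeld_cell x i \<inter> alfeld_cell x j)" .
  have "y = (4 * u) *\<^sub>R barycenter x + (lam k y - u) *\<^sub>R x k + (lam l y - u) *\<^sub>R x l"
  proof -
    have "(4 * u) *\<^sub>R barycenter x = u *\<^sub>R (x i + x j + x k + x l)"
      by (simp add: barycenter_def four_sum[OF f])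
    then have "(4 * u) *\<^sub>R barycenter x + (lam k y - u) *\<^sub>R x k + (lam l y - u) *\<^sub>R x l
       = u *\<^sub>R x i + u *\<^sub>R x j + lam k y *\<^sub>R x k + lam l y *\<^sub>R x l"
      by (simp add: scaleR_diff_left scaleR_add_right)
    also have "\<dots> = y" using lam_comb[of y] y unfolding four_sum[OF f] u_def by simp
    finally show ?thesis by simp
  qed
  moreover have "4 * u + (lam k y - u) + (lam l y - u) = 1"
    using lam_sum[of y] y unfolding four_sum[OF f] u_def by simp
  ultimately have "y \<in> affine hull {barycenter x, x k, x l}" unfolding affine_hull_3 by blast
  then show ?thesis using sub by blast
qed

text \<open>The common face of two cells spans the plane \<open>lam i = lam j\<close>.  Equality of the values there gives
one factor \<open>lam i - lam j\<close>; equality of the gradients, in a direction across the plane, gives the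
second one.\<close>

lemma C1_family_necessary:
  assumes d: "\<omega> differentiable_on tetra x"
    and P: "\<And>i. i \<le> 3 \<Longrightarrow> Pol r (f i)" and eq: "\<And>i y. i \<le> 3 \<Longrightarrow> y \<in> alfeld_cell x i \<Longrightarrow> \<omega> y = f i y"
  shows "C1_family f"
  unfolding C1_family_def
proof (intro allI impI)
  fix i j :: nat assume i: "i \<le> 3" and j: "j \<le> 3"
  show "\<exists>d q. Pol d q \<and> (\<forall>y. f i y - f j y = (lam i y - lam j y)\<^sup>2 * q y)"
  proof (cases "i = j")
    case True
    then show ?thesis by (intro exI[of _ 0] exI[of _ "\<lambda>_. 0"]) (simp add: Pol.zero)
  next
    case False
    obtain k l where f: "four i j k l" using four_exists[OF i j False] .
    let ?A = "\<lambda>y. lam i y - lam j y" and ?C = "alfeld_cell x i \<inter> alfeld_cell x j"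
    have A: "affine_fun ?A" by (rule lam_diff_affine[OF i j])
    have Anc: "?A (x i) \<noteq> ?A (x j)" using i j False by (simp add: lam_x)
    have C: "convex ?C" by (intro convex_Int convex_cell)
    have pd: "Pol r (\<lambda>y. f i y - f j y)" by (intro Pol_diff P i j)
    have "f i y - f j y = 0" if "?A y = 0" for y
    proof (rule Pol_zero_affine_hull[OF pd C])
      show "f i y - f j y = 0" if "y \<in> ?C" for y using eq[OF i, of y] eq[OF j, of y] that by simp
    qed (use interface_affine_hull[OF f, of y] that in auto)
    then obtain q where q: "Pol (r - 1) q" "\<And>y. f i y - f j y = ?A y * q y"
      using Pol_divide[OF pd A Anc] by blast
    have "q y = 0" if y: "y \<in> ?C" for y
    proof -
      have "y \<in> tetra x" using y cell_subset[OF i] by blast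
      then obtain D where D: "(\<omega> has_derivative D) (at y within tetra x)"
        using d by (auto simp: differentiable_on_def differentiable_def)
      have "D = (\<lambda>v. dird v (f n) y)" if n: "n \<le> 3" "y \<in> alfeld_cell x n" for n
      proof (rule has_derivative_within_convex_unique[OF convex_cell interior_cell[OF n(1)] n(2)])
        show "(\<omega> has_derivative D) (at y within alfeld_cell x n)"
          by (rule has_derivative_subset[OF D cell_subset[OF n(1)]])
        show "(\<omega> has_derivative (\<lambda>v. dird v (f n) y)) (at y within alfeld_cell x n)"
          by (rule has_derivative_transform[OF n(2) eq[OF n(1)] has_derivative_at_withinI[OF Pol_has_derivative[OF P[OF n(1)]]]])
      qed
      from this[OF i] this[OF j] y have "dird v (f i) y = dird v (f j) y" for v by (metis IntE)
      then have "dird (x i - x j) (\<lambda>y. f i y - f j y) y = 0"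
        by (simp add: dird_diff[OF P[OF i] P[OF j]])
      moreover have "dird (x i - x j) ?A y = 2"
        using i j False lam_dir[of i y 1 "x i" "x j"] lam_dir[of j y 1 "x i" "x j"]
        by (simp add: dird_affine[OF A] lam_x)
      moreover have "?A y = 0" using cells_lam_eq[OF i j] y by simp
      ultimately show "q y = 0" unfolding q(2) dird_mult[OF Pol_affine[OF A] q(1)] by simp
    qed
    then have "q y = 0" if "?A y = 0" for y
      by (rule Pol_zero_affine_hull[OF q(1) C]) (use interface_affine_hull[OF f, of y] that in auto)
    then obtain s where s: "Pol (r - 1 - 1) s" "\<And>y. q y = ?A y * s y"
      using Pol_divide[OF q(1) A Anc] by blast
    show ?thesis using s(1) by (intro exI[of _ "r - 1 - 1"] exI[of _ s]) (simp add: q(2) s(2) power2_eq_square)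
  qed
qed

lemma glue_in_M_space:
  assumes f: "spline_family (int r) f" shows "glue f \<in> M_space r x"
proof -
  have P: "Pol (int r) (f n)" if "n \<le> 3" for n using f that by (auto simp: spline_family_def)
  have C: "C1_family f" using f by (simp add: spline_family_def)
  have d: "glue f differentiable_on tetra x"
    unfolding differentiable_on_def tetra_cells
    using glue_has_derivative[OF f] unfolding differentiable_def tetra_cells by (metis UN_E atMost_iff)
  have "continuous_on (tetra x) (grad (tetra x) (glue f))"
    unfolding tetra_cells
  proof (rule continuous_on_closed_Union)
    fix i :: nat assume "i \<in> {..3}"
    then have i: "i \<le> 3" by simp
    have "continuous_on (alfeld_cell x i) (\<lambda>y. \<chi> j. dird (axis j 1) (f i) y)"
      by (intro continuous_intros Pol_continuous_on[OF Pol_dird[OF P[OF i]]])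
    moreover have "grad (tetra x) (glue f) y = (\<chi> j. dird (axis j 1) (f i) y)" if "y \<in> alfeld_cell x i" for y
      by (simp add: grad_def partial_der_glue[OF f i that])
    ultimately show "continuous_on (alfeld_cell x i) (grad (\<Union>i\<in>{..3}. alfeld_cell x i) (glue f))"
      unfolding tetra_cells[symmetric] by (simp cong: continuous_on_cong)
  qed (auto simp: closed_cell)
  moreover have "restr (alfeld_cell x i) (glue f) \<in> polys (int r) (alfeld_cell x i)" if i: "i \<le> 3" for i
  proof -
    have "restr (alfeld_cell x i) (glue f) = restr (alfeld_cell x i) (f i)"
      using glue_eq[OF C i] by (auto simp: restr_def)
    then show ?thesis using restr_in_polys[OF P[OF i]] by simp
  qed
  ultimately show ?thesis
    using d differentiable_imp_continuous_on[OF d] glue_outside by (simp add: M_space_def)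
qed

lemma M_space_iff: "\<omega> \<in> M_space r x \<longleftrightarrow> (\<exists>f. spline_family (int r) f \<and> \<omega> = glue f)"
proof
  assume w: "\<omega> \<in> M_space r x"
  then have "\<forall>i. \<exists>p. i \<le> 3 \<longrightarrow> Pol (int r) p \<and> restr (alfeld_cell x i) \<omega> = restr (alfeld_cell x i) p"
    unfolding M_space_def polys_eq by blast
  then obtain f where f: "\<And>i. i \<le> 3 \<Longrightarrow> Pol (int r) (f i)"
    "\<And>i. i \<le> 3 \<Longrightarrow> restr (alfeld_cell x i) \<omega> = restr (alfeld_cell x i) (f i)" by metis
  have eq: "\<omega> y = f i y" if "i \<le> 3" "y \<in> alfeld_cell x i" for i y
    using f(2)[OF that(1)] that(2) by (metis restr_def)
  have C: "C1_family f"
    by (rule C1_family_necessary[OF _ f(1) eq]) (use w in \<open>auto simp: M_space_def\<close>)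
  have "\<omega> = glue f"
  proof
    fix y show "\<omega> y = glue f y"
    proof (cases "y \<in> tetra x")
      case True
      then show ?thesis using eq[OF cell_no[OF True]] by (simp add: glue_def)
    next
      case False
      then show ?thesis using w by (simp add: M_space_def glue_outside)
    qed
  qed
  then show "\<exists>f. spline_family (int r) f \<and> \<omega> = glue f"
    using f(1) C by (auto simp: spline_family_def)
qed (use glue_in_M_space in blast)

end

section \<open>Splines vanishing to higher order on the boundary\<close>

text \<open>Second order Taylor expansion of the primitive of \<open>t ^ n\<close>, with polynomial remainder.\<close>

lemma power_second_order:
  assumes U: "affine_fun U" and V: "affine_fun V"
  shows "\<exists>d R. Pol d R \<and> (\<forall>y. (U y :: real) ^ Suc n / real (Suc n) - V y ^ Suc n / real (Suc n) = V y ^ n * (U y - V y) + (U y - V y)\<^sup>2 * R y)"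
proof -
  have "\<exists>d R. Pol d R \<and> (\<forall>y. U y ^ Suc n - V y ^ Suc n = real (Suc n) * V y ^ n * (U y - V y) + (U y - V y)\<^sup>2 * R y)"
  proof (induction n)
    case 0
    show ?case by (intro exI[of _ 0] exI[of _ "\<lambda>_. 0"]) (simp add: Pol.zero)
  next
    case (Suc n)
    then obtain d R where R: "Pol d R" "\<And>y. U y ^ Suc n - V y ^ Suc n = real (Suc n) * V y ^ n * (U y - V y) + (U y - V y)\<^sup>2 * R y" by blast
    have "U y ^ Suc (Suc n) - V y ^ Suc (Suc n)
      = real (Suc (Suc n)) * V y ^ Suc n * (U y - V y) + (U y - V y)\<^sup>2 * (U y * R y + real (Suc n) * V y ^ n)" for y
    proof -
      have "U y ^ Suc (Suc n) - V y ^ Suc (Suc n) = U y * (U y ^ Suc n - V y ^ Suc n) + (U y - V y) * V y ^ Suc n"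
        by (simp add: algebra_simps)
      also have "\<dots> = U y * (real (Suc n) * V y ^ n * (U y - V y) + (U y - V y)\<^sup>2 * R y) + (U y - V y) * V y ^ Suc n"
        unfolding R(2) ..
      also have "\<dots> = real (Suc (Suc n)) * V y ^ Suc n * (U y - V y) + (U y - V y)\<^sup>2 * (U y * R y + real (Suc n) * V y ^ n)"
        by (simp add: power2_eq_square algebra_simps)
      finally show ?thesis .
    qed
    moreover have "Pol (max (1 + d) (int n)) (\<lambda>y. U y * R y + real (Suc n) * V y ^ n)"
      by (intro Pol.add Pol_cmul Pol_mono[OF Pol_mult[OF Pol_affine[OF U] R(1)]] Pol_mono[OF Pol_affine_power[OF V]]) auto
    ultimately show ?case by blast
  qed
  then obtain d R where R: "Pol d R" "\<And>y. U y ^ Suc n - V y ^ Suc n = real (Suc n) * V y ^ n * (U y - V y) + (U y - V y)\<^sup>2 * R y" by blast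
  have "U y ^ Suc n / real (Suc n) - V y ^ Suc n / real (Suc n) = V y ^ n * (U y - V y) + (U y - V y)\<^sup>2 * (1 / real (Suc n) * R y)" for y
    unfolding diff_divide_distrib[symmetric] R(2) by (simp add: field_simps)
  with Pol_cmul[OF R(1), of "1 / real (Suc n)"] show ?thesis by blast
qed

context tetrahedron
begin

lemma lam_Pol: "i \<le> 3 \<Longrightarrow> Pol 1 (lam i)" by (intro Pol_affine lam_affine)

lemma C1_family_cong_sum:
  assumes "\<And>j. j \<in> J \<Longrightarrow> C1_family (f j)"
  shows "C1_family (\<lambda>i y. \<Sum>j\<in>J. f j i y)"
  using assms
proof (induction J rule: infinite_finite_induct)
  case (insert a J)
  show ?case unfolding C1_family_def
  proof (intro allI impI)
    fix i j :: nat assume ij: "i \<le> 3" "j \<le> 3"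
    obtain d q where q: "Pol d q" "\<And>y. f a i y - f a j y = (lam i y - lam j y) ^ 2 * q y"
      using insert.prems[of a] ij unfolding C1_family_def by blast
    obtain e p where p: "Pol e p" "\<And>y. (\<Sum>k\<in>J. f k i y) - (\<Sum>k\<in>J. f k j y) = (lam i y - lam j y) ^ 2 * p y"
      using insert.IH insert.prems ij unfolding C1_family_def by blast
    have "Pol (max d e) (\<lambda>y. q y + p y)" by (intro Pol.add Pol_mono[OF q(1)] Pol_mono[OF p(1)]) auto
    moreover have "(\<Sum>k\<in>insert a J. f k i y) - (\<Sum>k\<in>insert a J. f k j y) = (lam i y - lam j y) ^ 2 * (q y + p y)" for y
      using q(2)[of y] p(2)[of y] insert.hyps by (simp add: distrib_left)
    ultimately show "\<exists>d q. Pol d q \<and> (\<forall>y. (\<Sum>k\<in>insert a J. f k i y) - (\<Sum>k\<in>insert a J. f k j y) = (lam i y - lam j y) ^ 2 * q y)"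
      by blast
  qed
qed (auto simp: C1_family_def intro: Pol.zero)

lemma C1_family_mult:
  assumes "C1_family f" "Pol e s" shows "C1_family (\<lambda>i y. s y * f i y)"
  unfolding C1_family_def
proof (intro allI impI)
  fix i j :: nat assume ij: "i \<le> 3" "j \<le> 3"
  obtain d q where q: "Pol d q" "\<And>y. f i y - f j y = (lam i y - lam j y) ^ 2 * q y"
    using assms(1) ij unfolding C1_family_def by blast
  have "s y * f i y - s y * f j y = (lam i y - lam j y) ^ 2 * (s y * q y)" for y
    unfolding right_diff_distrib[symmetric] q(2) by simp
  with Pol_mult[OF assms(2) q(1)] show "\<exists>d q. Pol d q \<and> (\<forall>y. s y * f i y - s y * f j y = (lam i y - lam j y) ^ 2 * q y)" by blast
qed

lemma C1_family_add: "C1_family f \<Longrightarrow> C1_family g \<Longrightarrow> C1_family (\<lambda>i y. f i y + g i y)"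
  using C1_family_cong_sum[of "UNIV :: bool set" "\<lambda>b. if b then f else g"] by (simp add: UNIV_bool add.commute)

lemma C1_family_diff: "C1_family f \<Longrightarrow> C1_family g \<Longrightarrow> C1_family (\<lambda>i y. f i y - g i y)"
  using C1_family_add[of f "\<lambda>i y. (-1) * g i y"] C1_family_mult[of g 0 "\<lambda>_. -1"] by (simp add: Pol.const)

lemma spline_family_diff: "spline_family r f \<Longrightarrow> spline_family r g \<Longrightarrow> spline_family r (\<lambda>i y. f i y - g i y)"
  by (simp add: spline_family_def Pol_diff C1_family_diff)

lemma glue_diff: "glue (\<lambda>i y. f i y - g i y) = (\<lambda>y. glue f y - glue g y)"
  by (auto simp: glue_def)

lemma glue_add: "glue (\<lambda>i y. f i y + g i y) = (\<lambda>y. glue f y + glue g y)"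
  by (auto simp: glue_def)

lemma glue_sum: "glue (\<lambda>i y. \<Sum>j\<in>J. c j * f j i y) = (\<lambda>y. \<Sum>j\<in>J. c j * glue (f j) y)"
  by (auto simp: glue_def)

lemma glue_cong: "(\<And>i y. i \<le> 3 \<Longrightarrow> f i y = g i y) \<Longrightarrow> glue f = glue g"
  using cell_no(1) by (auto simp: glue_def fun_eq_iff)

text \<open>The splines of degree \<open>r\<close> that vanish to order \<open>k\<close> on the boundary.  On the cell \<open>T_i\<close> the only
boundary face is \<open>lam i = 0\<close>, so the order is the power of \<open>lam i\<close> in the piece.\<close>

definition level :: "int \<Rightarrow> nat \<Rightarrow> (real^3 \<Rightarrow> real) set" where
  "level r k = {glue (\<lambda>i y. lam i y ^ k * h i y) | h.
     (\<forall>i\<le>3. Pol (r - int k) (h i)) \<and> C1_family (\<lambda>i y. lam i y ^ k * h i y)}"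

lemma levelI:
  assumes "\<omega> = glue (\<lambda>i y. lam i y ^ k * h i y)" "\<And>i. i \<le> 3 \<Longrightarrow> Pol (r - int k) (h i)"
    "C1_family (\<lambda>i y. lam i y ^ k * h i y)"
  shows "\<omega> \<in> level r k"
  unfolding level_def using assms by (intro CollectI exI[of _ h]) simp

lemma levelE:
  assumes "\<omega> \<in> level r k"
  obtains h where "\<omega> = glue (\<lambda>i y. lam i y ^ k * h i y)" "\<And>i. i \<le> 3 \<Longrightarrow> Pol (r - int k) (h i)"
    "C1_family (\<lambda>i y. lam i y ^ k * h i y)"
  using assms unfolding level_def by auto

lemma face_affine_hull:
  assumes f: "four i j k l" and y: "lam i y = 0"
  shows "y \<in> affine hull (alfeld_cell x i \<inter> {y. lam i y = 0})"
proof -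
  note le = four_le[OF f]
  have ne: "i \<noteq> j" "i \<noteq> k" "i \<noteq> l" "j \<noteq> k" "j \<noteq> l" "k \<noteq> l" using f by (auto simp: four_def)
  have "{x j, x k, x l} \<subseteq> alfeld_cell x i \<inter> {y. lam i y = 0}"
    using le ne by (auto simp: cell_eq lam_x)
  from hull_mono[OF this, of affine]
  have sub: "affine hull {x j, x k, x l} \<subseteq> affine hull (alfeld_cell x i \<inter> {y. lam i y = 0})" .
  have "y = lam j y *\<^sub>R x j + lam k y *\<^sub>R x k + lam l y *\<^sub>R x l"
    using lam_comb[of y] y unfolding four_sum[OF f] by simp
  moreover have "lam j y + lam k y + lam l y = 1"
    using lam_sum[of y] y unfolding four_sum[OF f] by simp
  ultimately have "y \<in> affine hull {x j, x k, x l}" unfolding affine_hull_3 by blast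
  then show ?thesis using sub by blast
qed

lemma convex_face: "i \<le> 3 \<Longrightarrow> convex (alfeld_cell x i \<inter> {y. lam i y = 0})"
  by (intro convex_Int convex_cell affine_imp_convex affine_zero_set lam_affine)

lemma spline_face_zero:
  assumes f: "spline_family r f" and i: "i \<le> 3"
    and z: "\<And>y. lam i y = 0 \<Longrightarrow> f i y = 0" "\<And>y v. lam i y = 0 \<Longrightarrow> dird v (f i) y = 0"
  shows "\<exists>h. Pol (r - 2) h \<and> (\<forall>y. f i y = lam i y ^ 2 * h y)"
proof -
  obtain j k l where "four i j k l" using four_exists1[OF i] .
  then have j: "j \<le> 3" "i \<noteq> j" using four_le by (auto simp: four_def)
  have P: "Pol r (f i)" using f i by (simp add: spline_family_def)
  have "lam i (y + t *\<^sub>R (x i - x j)) = lam i y + t" for y t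
    using i j by (simp add: lam_dir lam_x)
  then obtain h where "Pol (r - int 2) h" "\<And>y. f i y = lam i y ^ 2 * h y"
  proof (rule Pol_divide_power[OF P lam_affine[OF i], of "x i - x j" 2])
    show "(dird (x i - x j) ^^ n) (f i) y = 0" if "lam i y = 0" "n < 2" for y n
      using z[OF that(1)] that(2) by (cases n) auto
  qed blast+
  then show ?thesis by auto
qed

lemma M_ring_iff:
  "\<omega> \<in> M_ring_space r x \<longleftrightarrow> (\<exists>f. spline_family (int r) f \<and> \<omega> = glue f \<and>
     (\<forall>i\<le>3. \<forall>y. lam i y = 0 \<longrightarrow> f i y = 0 \<and> (\<forall>v. dird v (f i) y = 0)))"
proof
  assume "\<omega> \<in> M_ring_space r x"
  then have w: "\<omega> \<in> M_space r x" "\<And>y. y \<in> frontier (tetra x) \<Longrightarrow> \<omega> y = 0 \<and> grad (tetra x) \<omega> y = 0"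
    by (auto simp: M_ring_space_def)
  obtain f where f: "spline_family (int r) f" "\<omega> = glue f" using w(1) M_space_iff by blast
  have C: "C1_family f" using f by (simp add: spline_family_def)
  have "f i y = 0 \<and> dird v (f i) y = 0" if i: "i \<le> 3" and y: "lam i y = 0" for i y v
  proof -
    have P: "Pol (int r) (f i)" using f i by (simp add: spline_family_def)
    have z: "f i y = 0 \<and> dird v (f i) y = 0" if y: "y \<in> alfeld_cell x i" "lam i y = 0" for y v
    proof -
      have "y \<in> frontier (tetra x)" using y i cell_subset[OF i] by (auto simp: frontier_tetra)
      from w(2)[OF this] show ?thesis
        unfolding f(2) using glue_eq[OF C i y(1)] grad_glue[OF f(1) i y(1), of v] by simp
    qed
    obtain j k l where four: "four i j k l" using four_exists1[OF i] .
    have "f i y = 0"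
      by (rule Pol_zero_affine_hull[OF P convex_face[OF i] _ face_affine_hull[OF four y]]) (use z in blast)
    moreover have "dird v (f i) y = 0"
      by (rule Pol_zero_affine_hull[OF Pol_dird[OF P] convex_face[OF i] _ face_affine_hull[OF four y]]) (use z in blast)
    ultimately show ?thesis by simp
  qed
  then show "\<exists>f. spline_family (int r) f \<and> \<omega> = glue f \<and>
     (\<forall>i\<le>3. \<forall>y. lam i y = 0 \<longrightarrow> f i y = 0 \<and> (\<forall>v. dird v (f i) y = 0))" using f by blast
next
  assume "\<exists>f. spline_family (int r) f \<and> \<omega> = glue f \<and>
     (\<forall>i\<le>3. \<forall>y. lam i y = 0 \<longrightarrow> f i y = 0 \<and> (\<forall>v. dird v (f i) y = 0))"
  then obtain f where f: "spline_family (int r) f" "\<omega> = glue f"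
    and z: "\<And>i y. i \<le> 3 \<Longrightarrow> lam i y = 0 \<Longrightarrow> f i y = 0" "\<And>i y v. i \<le> 3 \<Longrightarrow> lam i y = 0 \<Longrightarrow> dird v (f i) y = 0" by blast
  have C: "C1_family f" using f by (simp add: spline_family_def)
  have "\<omega> y = 0 \<and> grad (tetra x) \<omega> y = 0" if y: "y \<in> frontier (tetra x)" for y
  proof -
    obtain i where i: "i \<le> 3" "lam i y = 0" "y \<in> tetra x" using y by (auto simp: frontier_tetra)
    then have yi: "y \<in> alfeld_cell x i" by (simp add: cell_eq tetra_eq)
    have "grad (tetra x) \<omega> y \<bullet> grad (tetra x) \<omega> y = 0"
      unfolding f(2) grad_glue[OF f(1) i(1) yi] by (rule z(2)[OF i(1,2)])
    then show ?thesis using glue_eq[OF C i(1) yi] z(1)[OF i(1,2)] by (simp add: f(2))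
  qed
  then show "\<omega> \<in> M_ring_space r x" unfolding M_ring_space_def using f M_space_iff by blast
qed

lemma M_ring_level: "M_ring_space r x = level (int r) 2"
proof (intro set_eqI iffI)
  fix \<omega> assume "\<omega> \<in> M_ring_space r x"
  then obtain f where f: "spline_family (int r) f" "\<omega> = glue f"
    and z: "\<And>i y. i \<le> 3 \<Longrightarrow> lam i y = 0 \<Longrightarrow> f i y = 0" "\<And>i y v. i \<le> 3 \<Longrightarrow> lam i y = 0 \<Longrightarrow> dird v (f i) y = 0"
    unfolding M_ring_iff by blast
  have "\<forall>i. \<exists>h. i \<le> 3 \<longrightarrow> Pol (int r - 2) h \<and> (\<forall>y. f i y = lam i y ^ 2 * h y)"
    using spline_face_zero[OF f(1) _ z] by blast
  then obtain h where h: "\<And>i. i \<le> 3 \<Longrightarrow> Pol (int r - 2) (h i)" "\<And>i y. i \<le> 3 \<Longrightarrow> f i y = lam i y ^ 2 * h i y" by metis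
  have "C1_family f" using f by (simp add: spline_family_def)
  then have "C1_family (\<lambda>i y. lam i y ^ 2 * h i y)" unfolding C1_family_def using h(2) by simp
  moreover have "\<omega> = glue (\<lambda>i y. lam i y ^ 2 * h i y)" unfolding f(2) by (rule glue_cong) (rule h(2))
  ultimately show "\<omega> \<in> level (int r) 2" unfolding level_def using h(1) by auto
next
  fix \<omega> assume "\<omega> \<in> level (int r) 2"
  then obtain h where h: "\<omega> = glue (\<lambda>i y. lam i y ^ 2 * h i y)" "\<And>i. i \<le> 3 \<Longrightarrow> Pol (int r - 2) (h i)"
    "C1_family (\<lambda>i y. lam i y ^ 2 * h i y)" unfolding level_def by auto
  have "Pol (int r) (\<lambda>y. lam i y ^ 2 * h i y)" if "i \<le> 3" for i
    using Pol_mult[OF Pol_affine_power[OF lam_affine[OF that], of 2] h(2)[OF that]] by simp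
  then have s: "spline_family (int r) (\<lambda>i y. lam i y ^ 2 * h i y)" using h(3) by (simp add: spline_family_def)
  show "\<omega> \<in> M_ring_space r x"
    unfolding M_ring_iff
  proof (intro exI conjI allI impI)
    fix i y v assume i: "i \<le> 3" "lam i y = 0"
    show "lam i y ^ 2 * h i y = 0" using i by simp
    show "dird v (\<lambda>y. lam i y ^ 2 * h i y) y = 0"
      using i dird_square_mult[OF lam_affine[OF i(1)] h(2)[OF i(1)]] by simp
  qed (rule s, rule h(1))
qed

text \<open>On the plane \<open>lam i = lam j\<close>, with \<open>u\<close> the common value, the values of the two pieces give
\<open>h i = h j\<close>.  The derivatives in the direction \<open>x i - x j\<close>, in which \<open>lam i\<close> grows and \<open>lam j\<close>
falls with slope one, give \<open>u ^ (k - 1) * (2 * k * h i + u * E) = 0\<close> with a polynomial \<open>E\<close>.  After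
cancellation \<open>h i = 0\<close> at \<open>u = 0\<close>.\<close>

lemma leading_coeff_vanishes_on_edges:
  assumes i: "i \<le> 3" and j: "j \<le> 3" and ne: "i \<noteq> j" and k: "1 \<le> k"
    and hi: "Pol d (h i)" and hj: "Pol d (h j)" and C: "C1_family (\<lambda>i y. lam i y ^ k * h i y)"
    and y: "lam i y = 0" "lam j y = 0"
  shows "h i y = 0"
proof -
  let ?S = "{y. lam i y - lam j y = 0}" and ?b = "barycenter x"
  have S: "affine ?S" by (rule affine_zero_set[OF lam_diff_affine[OF i j]])
  have bS: "?b \<in> ?S" using i j by (simp add: lam_barycenter)
  obtain m where m: "k = Suc m" using k by (cases k) auto
  note L = lam_affine[OF i] lam_affine[OF j]
  have P: "Pol (int k + d) (\<lambda>y. lam i y ^ k * h i y)" "Pol (int k + d) (\<lambda>y. lam j y ^ k * h j y)"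
    by (intro Pol_mult Pol_affine_power L hi hj)+
  have eq: "h i y - h j y = 0" if "y \<in> ?S" for y
  proof (rule Pol_cancel[OF Pol_affine_power[OF L(1), of k] Pol_diff[OF hi hj] S bS])
    show "lam i z ^ k * (h i z - h j z) = 0" if "z \<in> ?S" for z
      using C1_family_eq[OF C i j, of z] that by (simp add: right_diff_distrib)
  qed (use that i in \<open>auto simp: lam_barycenter\<close>)
  let ?v = "x i - x j"
  let ?E = "\<lambda>y. 2 * real k * h i y + lam i y * (dird ?v (h i) y - dird ?v (h j) y)"
  have dl: "dird ?v (lam i) y = 1" "dird ?v (lam j) y = -1" for y
    using lam_dir[OF i, of y 1 "x i" "x j"] lam_dir[OF j, of y 1 "x i" "x j"] i j ne
    by (simp_all add: dird_affine L lam_x)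
  have PE: "Pol d ?E"
    by (rule Pol.add[OF Pol_cmul[OF hi]])
      (use Pol_mult[OF lam_Pol[OF i] Pol_diff[OF Pol_dird[OF hi] Pol_dird[OF hj]], of ?v ?v] in simp)
  have "?E y = 0" if "y \<in> ?S" for y
  proof (rule Pol_cancel[OF Pol_affine_power[OF L(1), of m] PE S bS])
    fix z assume z: "z \<in> ?S"
    then have l: "lam j z = lam i z" by simp
    \<comment> \<open>The summand with \<open>h j\<close> has the opposite sign and \<open>h j = h i\<close> here, hence the factor \<open>2\<close>.\<close>
    have "dird ?v (\<lambda>y. lam i y ^ k * h i y) z = dird ?v (\<lambda>y. lam j y ^ k * h j y) z"
      by (rule C1_family_dird[OF C i j P]) (simp add: l)
    then have "lam i z ^ k * dird ?v (h i) z + real k * lam i z ^ m * h i z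
        = lam i z ^ k * dird ?v (h j) z - real k * lam i z ^ m * h i z"
      using eq[OF z]
      by (simp add: dird_mult[OF Pol_affine_power[OF L(1)] hi] dird_mult[OF Pol_affine_power[OF L(2)] hj]
          dird_power[OF L(1)] dird_power[OF L(2)] dl l m del: power_Suc of_nat_Suc)
    then show "lam i z ^ m * ?E z = 0" by (simp add: m algebra_simps)
  qed (use that i in \<open>auto simp: lam_barycenter\<close>)
  from this[of y] y k show ?thesis by simp
qed

text \<open>Division by \<open>lam j\<close> modulo \<open>lam i\<close>: the projection along \<open>x j - x k\<close> keeps the plane \<open>lam i = 0\<close> and
maps it onto the line \<open>lam i = lam j = 0\<close>, where \<open>p\<close> vanishes.\<close>

lemma divide_on_plane:
  assumes f: "four i j k l" and p: "Pol d p" and z: "\<And>y. lam i y = 0 \<Longrightarrow> lam j y = 0 \<Longrightarrow> p y = 0"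
  obtains q where "Pol (d - 1) q" "\<And>y. lam i y = 0 \<Longrightarrow> p y = lam j y * q y"
proof -
  note le = four_le[OF f]
  have ne: "i \<noteq> j" "i \<noteq> k" "j \<noteq> k" using f by (auto simp: four_def)
  obtain q where q: "Pol (d - 1) q" "\<And>y. p y = p (y - lam j y *\<^sub>R (x j - x k)) + lam j y * q y"
    using Pol_project[OF p lam_affine[of j], of "x j - x k"] le by blast
  have "p (y - lam j y *\<^sub>R (x j - x k)) = 0" if "lam i y = 0" for y
    using that le ne lam_dir[of i y "- lam j y" "x j" "x k"] lam_dir[of j y "- lam j y" "x j" "x k"]
    by (intro z) (simp_all add: lam_x)
  then have "p y = lam j y * q y" if "lam i y = 0" for y
    using that by (subst q(2)) simp
  with q(1) show thesis by (rule that)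
qed

text \<open>The sides of the face are split off one after the other: on the line of the next side the
coordinates split off before do not vanish identically and can be cancelled.\<close>

lemma face_factor:
  assumes f: "four i j k l" and p: "Pol d p"
    and z: "\<And>y. lam i y = 0 \<Longrightarrow> lam j y = 0 \<or> lam k y = 0 \<or> lam l y = 0 \<Longrightarrow> p y = 0"
  obtains s where "Pol (d - 3) s" "\<And>y. lam i y = 0 \<Longrightarrow> p y = lam j y * lam k y * lam l y * s y"
proof -
  note le = four_le[OF f]
  have ne: "i \<noteq> j" "i \<noteq> k" "i \<noteq> l" "j \<noteq> k" "j \<noteq> l" "k \<noteq> l" using f by (auto simp: four_def)
  have fk: "four i k j l" and fl: "four i l j k" using f four_swap by blast+
  have S: "affine {y. lam i y = 0 \<and> lam n y = 0}" if "n \<le> 3" for n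
  proof -
    have "{y. lam i y = 0 \<and> lam n y = 0} = {y. lam i y = 0} \<inter> {y. lam n y = 0}" by auto
    then show ?thesis using le that by (auto intro!: affine_Int affine_zero_set lam_affine)
  qed
  obtain p1 where p1: "Pol (d - 1) p1" "\<And>y. lam i y = 0 \<Longrightarrow> p y = lam j y * p1 y"
    using divide_on_plane[OF f p] z by blast
  have z1: "p1 y = 0" if "lam i y = 0" "lam n y = 0" "n = k \<or> n = l" for y n
    by (rule Pol_cancel[OF lam_Pol[of j] p1(1) S[of n], of "x j"])
      (use that z p1(2) le ne in \<open>auto simp: lam_x\<close>)
  obtain p2 where p2: "Pol (d - 1 - 1) p2" "\<And>y. lam i y = 0 \<Longrightarrow> p1 y = lam k y * p2 y"
    using divide_on_plane[OF fk p1(1)] z1 by blast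
  have z2: "p2 y = 0" if "lam i y = 0" "lam l y = 0" for y
    by (rule Pol_cancel[OF lam_Pol[of k] p2(1) S[of l], of "x k"])
      (use that z1 p2(2) le ne in \<open>auto simp: lam_x\<close>)
  obtain s where s: "Pol (d - 1 - 1 - 1) s" "\<And>y. lam i y = 0 \<Longrightarrow> p2 y = lam l y * s y"
    using divide_on_plane[OF fl p2(1)] z2 by blast
  show thesis by (rule that[of s]) (use s p1(2) p2(2) in \<open>auto simp: algebra_simps\<close>)
qed

lemma level_Suc_I:
  assumes P: "\<And>i. i \<le> 3 \<Longrightarrow> Pol (r - int k) (h i)" and C: "C1_family (\<lambda>i y. lam i y ^ k * h i y)"
    and z: "\<And>i y. i \<le> 3 \<Longrightarrow> lam i y = 0 \<Longrightarrow> h i y = 0"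
  shows "glue (\<lambda>i y. lam i y ^ k * h i y) \<in> level r (Suc k)"
proof -
  have "\<exists>g. Pol (r - int (Suc k)) g \<and> (\<forall>y. h i y = lam i y * g y)" if i: "i \<le> 3" for i
  proof -
    obtain j k' l where "four i j k' l" using four_exists1[OF i] .
    then have j: "j \<le> 3" "i \<noteq> j" using four_le by (auto simp: four_def)
    have "lam i (x i) \<noteq> lam i (x j)" using i j by (simp add: lam_x)
    then obtain g where g: "Pol (r - int k - 1) g" "\<And>y. h i y = lam i y * g y"
      by (rule Pol_divide[OF P[OF i] lam_affine[OF i] _ z[OF i]]) blast+
    have "r - int (Suc k) = r - int k - 1" by simp
    with g(1) have "Pol (r - int (Suc k)) g" by (simp only:)
    with g(2) show ?thesis by blast
  qed
  then obtain g where g: "\<And>i. i \<le> 3 \<Longrightarrow> Pol (r - int (Suc k)) (g i)" "\<And>i y. i \<le> 3 \<Longrightarrow> h i y = lam i y * g i y"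
    by metis
  have eq: "lam i y ^ k * h i y = lam i y ^ Suc k * g i y" if "i \<le> 3" for i y
    using g(2)[OF that] by simp
  have "C1_family (\<lambda>i y. lam i y ^ Suc k * g i y)"
    using C eq unfolding C1_family_def by metis
  moreover have "glue (\<lambda>i y. lam i y ^ k * h i y) = glue (\<lambda>i y. lam i y ^ Suc k * g i y)"
    by (rule glue_cong) (rule eq)
  ultimately show ?thesis unfolding level_def using g(1) by blast
qed

text \<open>The pieces, and hence the cofactors of \<open>lam i ^ k\<close>, are determined by the spline; if it also has
pieces divisible by \<open>lam i ^ Suc k\<close>, the cofactor is divisible by \<open>lam i\<close>.\<close>

lemma level_Suc_D:
  assumes P: "\<And>i. i \<le> 3 \<Longrightarrow> Pol (r - int k) (h i)" and C: "C1_family (\<lambda>i y. lam i y ^ k * h i y)"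
    and l: "glue (\<lambda>i y. lam i y ^ k * h i y) \<in> level r (Suc k)" and i: "i \<le> 3" and y: "lam i y = 0"
  shows "h i y = 0"
proof -
  obtain g where g: "glue (\<lambda>i y. lam i y ^ k * h i y) = glue (\<lambda>i y. lam i y ^ Suc k * g i y)"
     "\<And>i. i \<le> 3 \<Longrightarrow> Pol (r - int (Suc k)) (g i)" "C1_family (\<lambda>i y. lam i y ^ Suc k * g i y)"
    by (rule levelE[OF l]) (rule that)
  have PD: "Pol (r - int k) (\<lambda>y. h i y - lam i y * g i y)"
    using Pol_diff[OF P[OF i] Pol_mono[OF Pol_mult[OF lam_Pol[OF i] g(2)[OF i]]]] by simp
  note PP = Pol_mult[OF Pol_affine_power[OF lam_affine[OF i], of k] PD]
  have "lam i y ^ k * (h i y - lam i y * g i y) = 0" for y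
  proof (rule Pol_zero_interior[OF PP convex_cell interior_cell[OF i]])
    fix y assume y: "y \<in> alfeld_cell x i"
    show "lam i y ^ k * (h i y - lam i y * g i y) = 0"
      using glue_eq[OF C i y] glue_eq[OF g(3) i y] g(1) by (auto simp: algebra_simps)
  qed
  from Pol_cancel[OF Pol_affine_power[OF lam_affine[OF i], of k] PD affine_UNIV UNIV_I _ UNIV_I this, of "x i"]
  have "h i y - lam i y * g i y = 0" using i by (simp add: lam_x)
  then show ?thesis using y by simp
qed

lemma level_mono: "level r (Suc k) \<subseteq> level r k"
proof
  fix \<omega> assume "\<omega> \<in> level r (Suc k)"
  then obtain g where g: "\<omega> = glue (\<lambda>i y. lam i y ^ Suc k * g i y)"
     "\<And>i. i \<le> 3 \<Longrightarrow> Pol (r - int (Suc k)) (g i)" "C1_family (\<lambda>i y. lam i y ^ Suc k * g i y)"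
    using that by (rule levelE)
  have eq: "lam i y ^ Suc k * g i y = lam i y ^ k * (lam i y * g i y)" for i y by simp
  have "Pol (r - int k) (\<lambda>y. lam i y * g i y)" if "i \<le> 3" for i
    using Pol_mult[OF lam_Pol[OF that] g(2)[OF that]] by simp
  with g(1,3) show "\<omega> \<in> level r k" unfolding eq by (intro levelI[where h = "\<lambda>i y. lam i y * g i y"])
qed

lemma level_add: "u \<in> level r k \<Longrightarrow> v \<in> level r k \<Longrightarrow> (\<lambda>y. u y + v y) \<in> level r k"
proof -
  assume "u \<in> level r k" "v \<in> level r k"
  then obtain g h where g: "u = glue (\<lambda>i y. lam i y ^ k * g i y)"
     "\<And>i. i \<le> 3 \<Longrightarrow> Pol (r - int k) (g i)" "C1_family (\<lambda>i y. lam i y ^ k * g i y)"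
    and h: "v = glue (\<lambda>i y. lam i y ^ k * h i y)"
     "\<And>i. i \<le> 3 \<Longrightarrow> Pol (r - int k) (h i)" "C1_family (\<lambda>i y. lam i y ^ k * h i y)"
    unfolding level_def by blast
  have eq: "lam i y ^ k * g i y + lam i y ^ k * h i y = lam i y ^ k * (g i y + h i y)" for i y
    by (simp add: distrib_left)
  have "(\<lambda>y. u y + v y) = glue (\<lambda>i y. lam i y ^ k * (g i y + h i y))"
    unfolding eq[symmetric] glue_add g(1) h(1) ..
  moreover have "C1_family (\<lambda>i y. lam i y ^ k * (g i y + h i y))"
    using C1_family_add[OF g(3) h(3)] unfolding eq .
  ultimately show ?thesis
    by (intro levelI[where h = "\<lambda>i y. g i y + h i y"] Pol.add g(2) h(2))
qed

lemma level_negative: assumes "r < int k" shows "level r k = {\<lambda>_. 0}"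
proof (intro set_eqI iffI)
  fix \<omega> assume "\<omega> \<in> level r k"
  then obtain g where g: "\<omega> = glue (\<lambda>i y. lam i y ^ k * g i y)"
     "\<And>i. i \<le> 3 \<Longrightarrow> Pol (r - int k) (g i)"
    unfolding level_def by blast
  have "g i y = 0" if "i \<le> 3" for i y using Pol_neg[OF g(2)[OF that]] assms by simp
  then have "glue (\<lambda>i y. lam i y ^ k * g i y) = glue (\<lambda>_ _. 0)" by (intro glue_cong) simp
  then show "\<omega> \<in> {\<lambda>_. 0}" unfolding g(1) by (simp add: glue_def)
next
  fix \<omega> :: "real^3 \<Rightarrow> real" assume "\<omega> \<in> {\<lambda>_. 0}"
  then have "\<omega> = glue (\<lambda>i y. lam i y ^ k * 0)" by (auto simp: glue_def)
  moreover have "C1_family (\<lambda>i y. lam i y ^ k * 0)"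
    unfolding C1_family_def by (auto intro: Pol.zero)
  ultimately show "\<omega> \<in> level r k" unfolding level_def
    by (intro CollectI exI[of _ "\<lambda>_ _. 0"]) (simp add: Pol.zero)
qed

end

section \<open>Bubble splines and the dimension of the boundary space\<close>

lemma ex_Pol_add: "\<exists>d. Pol d p \<Longrightarrow> \<exists>d. Pol d q \<Longrightarrow> \<exists>d. Pol d (\<lambda>y. p y + q y)"
proof -
  assume "\<exists>d. Pol d p" "\<exists>d. Pol d q"
  then obtain d e where "Pol d p" "Pol e q" by blast
  then have "Pol (max d e) (\<lambda>y. p y + q y)" by (intro Pol.add) (auto elim: Pol_mono)
  then show ?thesis by blast
qed

lemma ex_Pol_mult: "\<exists>d. Pol d p \<Longrightarrow> \<exists>d. Pol d q \<Longrightarrow> \<exists>d. Pol d (\<lambda>y. p y * q y)"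
  using Pol_mult by blast

lemma ex_Pol_diff: "\<exists>d. Pol d p \<Longrightarrow> \<exists>d. Pol d q \<Longrightarrow> \<exists>d. Pol d (\<lambda>y. p y - q y)"
  using ex_Pol_add[of p "\<lambda>y. - q y"] Pol_cmul[of _ q "-1"] by auto

lemma atMost_3: "{..3::nat} = {0, 1, 2, 3}"
  by (auto simp: le_Suc_eq numeral_3_eq_3)

text \<open>The vertices of the face opposite to the vertex \<open>m\<close>, in increasing order.\<close>

definition opp1 :: "nat \<Rightarrow> nat" where "opp1 m = (if m = 0 then 1 else 0)"
definition opp2 :: "nat \<Rightarrow> nat" where "opp2 m = (if m \<le> 1 then 2 else 1)"
definition opp3 :: "nat \<Rightarrow> nat" where "opp3 m = (if m \<le> 2 then 3 else 2)"

lemma four_opp: assumes "m \<le> 3" shows "four m (opp1 m) (opp2 m) (opp3 m)"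
proof -
  have "m \<in> {0, 1, 2, 3}" using assms unfolding atMost_3[symmetric] by simp
  then show ?thesis
    by (auto simp: four_def opp1_def opp2_def opp3_def atMost_3)
qed

context tetrahedron
begin

definition face_pt :: "nat \<Rightarrow> nat \<Rightarrow> nat \<Rightarrow> real \<times> real \<Rightarrow> real^3" where
  "face_pt a b c z = x a + fst z *\<^sub>R (x b - x a) + snd z *\<^sub>R (x c - x a)"

lemma affine_face_pt: "affine_fun (face_pt a b c)"
  unfolding face_pt_def by (intro affine_intros)

lemma lam_face_pt:
  assumes "four i a b c"
  shows "lam i (face_pt a b c z) = 0" "lam a (face_pt a b c z) = 1 - fst z - snd z"
    "lam b (face_pt a b c z) = fst z" "lam c (face_pt a b c z) = snd z"
proof -
  have "i \<noteq> a" "i \<noteq> b" "i \<noteq> c" "a \<noteq> b" "a \<noteq> c" "b \<noteq> c" using assms by (auto simp: four_def)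
  then show "lam i (face_pt a b c z) = 0" "lam a (face_pt a b c z) = 1 - fst z - snd z"
    "lam b (face_pt a b c z) = fst z" "lam c (face_pt a b c z) = snd z"
    using four_le[OF assms] by (simp_all add: face_pt_def lam_dir lam_x)
qed

lemma face_pt_lam:
  assumes f: "four i a b c" and y: "lam i y = 0"
  shows "face_pt a b c (lam b y, lam c y) = y"
proof -
  have a: "lam a y = 1 - lam b y - lam c y" using lam_sum[of y] y unfolding four_sum[OF f] by simp
  have "y = lam a y *\<^sub>R x a + lam b y *\<^sub>R x b + lam c y *\<^sub>R x c"
    using lam_comb[of y] y unfolding four_sum[OF f] by simp
  then show ?thesis unfolding face_pt_def a by (simp add: algebra_simps)
qed

text \<open>The bubble spline of \<open>m\<close> and \<open>n\<close> has on the cell \<open>T_i\<close> the piece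
\<open>lam i ^ Suc n * bubble_lead m n i\<close>.  This is the integral of \<open>t ^ n * (t - A) * (t - B) * (t - C)\<close>
over \<open>[0, lam i]\<close>, where \<open>A, B, C\<close> are the coordinates other than \<open>lam m\<close>.\<close>

definition bubble_lead :: "nat \<Rightarrow> nat \<Rightarrow> nat \<Rightarrow> real^3 \<Rightarrow> real" where
  "bubble_lead m n i y = (let A = lam (opp1 m) y; B = lam (opp2 m) y; C = lam (opp3 m) y; u = lam i y in
     1 / real (Suc (n + 3)) * u ^ 3 - (A + B + C) * (1 / real (Suc (n + 2)) * u ^ 2)
     + (A * B + A * C + B * C) * (1 / real (Suc (n + 1)) * u) - A * B * C * (1 / real (Suc n)))"

lemma bubble_lead_Pol: assumes "m \<le> 3" "i \<le> 3" shows "Pol 3 (bubble_lead m n i)"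
proof -
  note le = four_le[OF four_opp[OF assms(1)]]
  have L: "Pol 1 (lam (opp1 m))" "Pol 1 (lam (opp2 m))" "Pol 1 (lam (opp3 m))" "Pol 1 (lam i)"
    using le assms by (auto intro: lam_Pol)
  have p: "Pol (int N) (\<lambda>y. lam i y ^ N)" for N by (rule Pol_affine_power[OF lam_affine[OF assms(2)]])
  have 1: "Pol 3 (\<lambda>y. 1 / real (Suc (n + 3)) * lam i y ^ 3)" using Pol_cmul[OF p[of 3], of "1 / real (Suc (n + 3))"] by simp
  have 2: "Pol 3 (\<lambda>y. (lam (opp1 m) y + lam (opp2 m) y + lam (opp3 m) y) * (1 / real (Suc (n + 2)) * lam i y ^ 2))"
    using Pol_mult[OF Pol.add[OF Pol.add[OF L(1,2)] L(3)] Pol_cmul[OF p[of 2], of "1 / real (Suc (n + 2))"]] by simp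
  have 3: "Pol 3 (\<lambda>y. (lam (opp1 m) y * lam (opp2 m) y + lam (opp1 m) y * lam (opp3 m) y + lam (opp2 m) y * lam (opp3 m) y) * (1 / real (Suc (n + 1)) * lam i y))"
    using Pol_mult[OF Pol.add[OF Pol.add[OF Pol_mult[OF L(1,2)] Pol_mult[OF L(1,3)]] Pol_mult[OF L(2,3)]] Pol_cmul[OF L(4), of "1 / real (Suc (n + 1))"]] by simp
  have 4: "Pol 3 (\<lambda>y. lam (opp1 m) y * lam (opp2 m) y * lam (opp3 m) y * (1 / real (Suc n)))"
    using Pol_cmul[OF Pol_mult[OF Pol_mult[OF L(1,2)] L(3)], of "1 / real (Suc n)"] by (simp add: mult.commute)
  have "Pol 3 (\<lambda>y. bubble_lead m n i y)" unfolding bubble_lead_def Let_def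
    by (intro Pol_diff Pol.add 1 2 3 4)
  then show ?thesis by simp
qed

text \<open>The integrand vanishes at \<open>t = lam j\<close> because \<open>lam j\<close> is one of \<open>A, B, C\<close>; so the first order term
of the expansion at \<open>lam j\<close> disappears.\<close>

lemma bubble_C1_aux:
  assumes m: "m \<le> 3" and i: "i \<le> 3" and j: "j \<le> 3" "j \<noteq> m"
  shows "\<exists>d q. Pol d q \<and> (\<forall>y. lam i y ^ Suc n * bubble_lead m n i y - lam j y ^ Suc n * bubble_lead m n j y = (lam i y - lam j y)\<^sup>2 * q y)"
proof -
  let ?A = "lam (opp1 m)" and ?B = "lam (opp2 m)" and ?C = "lam (opp3 m)"
  note f = four_opp[OF m]
  note le = four_le[OF f]
  have L: "\<exists>d. Pol d ?A" "\<exists>d. Pol d ?B" "\<exists>d. Pol d ?C" using le by (auto intro: lam_Pol)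
  have "\<exists>R. (\<exists>d. Pol d R) \<and> (\<forall>y. lam i y ^ Suc N / real (Suc N) - lam j y ^ Suc N / real (Suc N)
     = lam j y ^ N * (lam i y - lam j y) + (lam i y - lam j y)\<^sup>2 * R y)" for N
    using power_second_order[OF lam_affine[OF i] lam_affine[OF j(1)], of N] by blast
  then obtain R where R: "\<And>N. \<exists>d. Pol d (R N)" "\<And>N y. lam i y ^ Suc N / real (Suc N) - lam j y ^ Suc N / real (Suc N)
     = lam j y ^ N * (lam i y - lam j y) + (lam i y - lam j y)\<^sup>2 * R N y" by metis
  define q where "q = (\<lambda>y. R (n + 3) y - (?A y + ?B y + ?C y) * R (n + 2) y
    + (?A y * ?B y + ?A y * ?C y + ?B y * ?C y) * R (n + 1) y - ?A y * ?B y * ?C y * R n y)"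
  have q: "\<exists>d. Pol d q" unfolding q_def
    by (intro ex_Pol_diff ex_Pol_add ex_Pol_mult L R(1))
  have form: "lam i y ^ Suc n * bubble_lead m n i y = lam i y ^ Suc (n + 3) / real (Suc (n + 3))
     - (?A y + ?B y + ?C y) * (lam i y ^ Suc (n + 2) / real (Suc (n + 2)))
     + (?A y * ?B y + ?A y * ?C y + ?B y * ?C y) * (lam i y ^ Suc (n + 1) / real (Suc (n + 1)))
     - ?A y * ?B y * ?C y * (lam i y ^ Suc n / real (Suc n))" for i y
  proof -
    define a b c d where "a = 1 / real (Suc (n + 3))" and "b = 1 / real (Suc (n + 2))" and "c = 1 / real (Suc (n + 1))" and "d = 1 / real (Suc n)"
    have "lam i y ^ Suc (n + 3) / real (Suc (n + 3)) = a * lam i y ^ Suc (n + 3)"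
       "lam i y ^ Suc (n + 2) / real (Suc (n + 2)) = b * lam i y ^ Suc (n + 2)"
       "lam i y ^ Suc (n + 1) / real (Suc (n + 1)) = c * lam i y ^ Suc (n + 1)"
       "lam i y ^ Suc n / real (Suc n) = d * lam i y ^ Suc n" by (simp_all add: a_def b_def c_def d_def)
    note this
    moreover have "lam i y ^ Suc n * bubble_lead m n i y = lam i y ^ Suc n * (a * lam i y ^ 3 - (?A y + ?B y + ?C y) * (b * lam i y ^ 2)
     + (?A y * ?B y + ?A y * ?C y + ?B y * ?C y) * (c * lam i y) - ?A y * ?B y * ?C y * d)"
      by (simp only: bubble_lead_def Let_def a_def b_def c_def d_def)
    moreover have "lam i y ^ Suc (n + 3) = lam i y ^ Suc n * lam i y ^ 3" "lam i y ^ Suc (n + 2) = lam i y ^ Suc n * lam i y ^ 2"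
      "lam i y ^ Suc (n + 1) = lam i y ^ Suc n * lam i y"
      using power_add[of "lam i y" "Suc n" 3] power_add[of "lam i y" "Suc n" 2] power_add[of "lam i y" "Suc n" 1]
      by (simp_all del: power_Suc)
    ultimately show ?thesis by (simp only:) (simp add: algebra_simps)
  qed
  have "lam i y ^ Suc n * bubble_lead m n i y - lam j y ^ Suc n * bubble_lead m n j y = (lam i y - lam j y)\<^sup>2 * q y" for y
  proof -
    have "j \<in> {opp1 m, opp2 m, opp3 m}" using f j unfolding four_def by auto
    then have z: "(lam j y - ?A y) * (lam j y - ?B y) * (lam j y - ?C y) = 0" by auto
    define D where "D = lam i y - lam j y"
    have "lam i y ^ Suc n * bubble_lead m n i y - lam j y ^ Suc n * bubble_lead m n j y
      = (lam i y ^ Suc (n + 3) / real (Suc (n + 3)) - lam j y ^ Suc (n + 3) / real (Suc (n + 3)))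
     - (?A y + ?B y + ?C y) * (lam i y ^ Suc (n + 2) / real (Suc (n + 2)) - lam j y ^ Suc (n + 2) / real (Suc (n + 2)))
     + (?A y * ?B y + ?A y * ?C y + ?B y * ?C y) * (lam i y ^ Suc (n + 1) / real (Suc (n + 1)) - lam j y ^ Suc (n + 1) / real (Suc (n + 1)))
     - ?A y * ?B y * ?C y * (lam i y ^ Suc n / real (Suc n) - lam j y ^ Suc n / real (Suc n))"
      unfolding form by (simp only: right_diff_distrib)
    also have "\<dots> = (lam j y ^ (n + 3) * D + D\<^sup>2 * R (n + 3) y) - (?A y + ?B y + ?C y) * (lam j y ^ (n + 2) * D + D\<^sup>2 * R (n + 2) y)
     + (?A y * ?B y + ?A y * ?C y + ?B y * ?C y) * (lam j y ^ (n + 1) * D + D\<^sup>2 * R (n + 1) y)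
     - ?A y * ?B y * ?C y * (lam j y ^ n * D + D\<^sup>2 * R n y)"
      unfolding R(2) D_def ..
    also have "\<dots> = D * lam j y ^ n * ((lam j y - ?A y) * (lam j y - ?B y) * (lam j y - ?C y)) + D\<^sup>2 * q y"
      unfolding q_def by (simp add: power_add power3_eq_cube power2_eq_square algebra_simps)
    finally show ?thesis unfolding z D_def by simp
  qed
  with q show ?thesis by blast
qed

lemma bubble_C1: assumes m: "m \<le> 3" shows "C1_family (\<lambda>i y. lam i y ^ Suc n * bubble_lead m n i y)"
  unfolding C1_family_def
proof (intro allI impI)
  fix i j :: nat assume i: "i \<le> 3" and j: "j \<le> 3"
  let ?f = "\<lambda>i y. lam i y ^ Suc n * bubble_lead m n i y"
  consider "j \<noteq> m" | "i \<noteq> m" | "i = j" by blast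
  then show "\<exists>d q. Pol d q \<and> (\<forall>y. ?f i y - ?f j y = (lam i y - lam j y)\<^sup>2 * q y)"
  proof cases
    case 1
    show ?thesis by (rule bubble_C1_aux[OF m i j 1])
  next
    case 2
    obtain d q where q: "Pol d q" "\<And>y. ?f j y - ?f i y = (lam j y - lam i y)\<^sup>2 * q y"
      using bubble_C1_aux[OF m j i 2, of n] by blast
    have "?f i y - ?f j y = (lam i y - lam j y)\<^sup>2 * (-1 * q y)" for y
      using q(2)[of y] by (simp add: power2_commute[of "lam i y"] del: power_Suc)
    with Pol_cmul[OF q(1), of "-1"] show ?thesis by blast
  next
    case 3
    then show ?thesis by (intro exI[of _ 0] exI[of _ "\<lambda>_. 0"]) (simp add: Pol.zero)
  qed
qed

lemma bubble_lead_face: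
  assumes m: "m \<le> 3" and i: "i \<le> 3" and y: "lam i y = 0"
  shows "bubble_lead m n i y = (if i = m then - (lam (opp1 i) y * lam (opp2 i) y * lam (opp3 i) y) / real (Suc n) else 0)"
proof (cases "i = m")
  case False
  then have "i \<in> {opp1 m, opp2 m, opp3 m}" using four_opp[OF m] i unfolding four_def by auto
  then have "lam (opp1 m) y * lam (opp2 m) y * lam (opp3 m) y = 0" using y by auto
  then show ?thesis using False y by (simp add: bubble_lead_def Let_def)
qed (use y in \<open>simp add: bubble_lead_def Let_def\<close>)

text \<open>A basis of the splines of boundary order \<open>n + 1\<close> modulo those of order \<open>n + 2\<close>: bubble splines
times monomials in two coordinates of the face.  The class of a spline in the quotient is
the restriction of its leading coefficients to their faces.\<close>

lemma fin_dim_level_step: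
  assumes W: "fin_dim (level r (Suc (Suc n))) D"
  shows "fin_dim (level r (Suc n)) (D + card ({..3::nat} \<times> plane_exponents (r - int n - 4)))"
proof -
  let ?T = "plane_exponents (r - int n - 4)" and ?J = "{..3::nat} \<times> plane_exponents (r - int n - 4)"
  define mon where "mon = (\<lambda>(j::nat \<times> nat \<times> nat) y. lam (opp2 (fst j)) y ^ fst (snd j) * lam (opp3 (fst j)) y ^ snd (snd j))"
  define H where "H = (\<lambda>c i y. \<Sum>j\<in>?J. c j * (mon j y * bubble_lead (fst j) n i y))"
  define b where "b = (\<lambda>j. glue (\<lambda>i y. lam i y ^ Suc n * (mon j y * bubble_lead (fst j) n i y)))"
  have finJ: "finite ?J" by (simp add: finite_plane_exponents)
  have Pm: "Pol (r - int n - 4) (mon j)" if "j \<in> ?J" for j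
  proof -
    have le: "opp2 (fst j) \<le> 3" "opp3 (fst j) \<le> 3" using four_le[OF four_opp[of "fst j"]] that by auto
    have "Pol (int (fst (snd j)) + int (snd (snd j))) (mon j)"
      unfolding mon_def by (intro Pol_mult Pol_affine_power lam_affine le)
    then show ?thesis by (rule Pol_mono) (use that in \<open>auto simp: plane_exponents_def\<close>)
  qed
  have PH: "Pol (r - int (Suc n)) (H c i)" if i: "i \<le> 3" for c i
  proof -
    have "Pol (r - int (Suc n)) (\<lambda>y. \<Sum>j\<in>?J. c j * (mon j y * bubble_lead (fst j) n i y))"
    proof (intro Pol_sum Pol_cmul)
      fix j assume j: "j \<in> ?J"
      then have "fst j \<le> 3" by auto
      from Pol_mult[OF Pm[OF j] bubble_lead_Pol[OF this i]]
      show "Pol (r - int (Suc n)) (\<lambda>y. mon j y * bubble_lead (fst j) n i y)" by (simp add: algebra_simps)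
    qed
    then show ?thesis by (simp add: H_def)
  qed
  have Hsum: "lam i y ^ Suc n * H c i y = (\<Sum>j\<in>?J. c j * (lam i y ^ Suc n * (mon j y * bubble_lead (fst j) n i y)))" for c i y
    unfolding H_def sum_distrib_left by (intro sum.cong refl) (rule mult.left_commute)
  have Hglue: "glue (\<lambda>i y. lam i y ^ Suc n * H c i y) = (\<lambda>y. \<Sum>j\<in>?J. c j * b j y)" for c
    unfolding Hsum glue_sum b_def ..
  have CH: "C1_family (\<lambda>i y. lam i y ^ Suc n * H c i y)" for c
    unfolding Hsum
  proof (rule C1_family_cong_sum)
    fix j assume j: "j \<in> ?J"
    then have "C1_family (\<lambda>i y. c j * mon j y * (lam i y ^ Suc n * bubble_lead (fst j) n i y))"
      by (intro C1_family_mult[OF bubble_C1 Pol_cmul[OF Pm[OF j]]]) auto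
    moreover have "c j * mon j y * (lam i y ^ Suc n * bubble_lead (fst j) n i y)
       = c j * (lam i y ^ Suc n * (mon j y * bubble_lead (fst j) n i y))" for i y
      by (simp only: mult.assoc mult.left_commute)
    ultimately show "C1_family (\<lambda>i y. c j * (lam i y ^ Suc n * (mon j y * bubble_lead (fst j) n i y)))" by (simp only:)
  qed
  have Hface: "H c i y = - (lam (opp1 i) y * lam (opp2 i) y * lam (opp3 i) y) / real (Suc n)
      * (\<Sum>t\<in>?T. c (i, t) * mon (i, t) y)"
    if i: "i \<le> 3" and y: "lam i y = 0" for c i y
  proof -
    let ?E = "- (lam (opp1 i) y * lam (opp2 i) y * lam (opp3 i) y) / real (Suc n)"
    have "H c i y = (\<Sum>j\<in>{i} \<times> ?T. c j * (mon j y * bubble_lead (fst j) n i y))"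
      unfolding H_def using finJ i
      by (intro sum.mono_neutral_right) (auto simp: bubble_lead_face[OF _ i y] split: if_splits)
    also have "\<dots> = (\<Sum>t\<in>?T. c (i, t) * (mon (i, t) y * bubble_lead i n i y))"
    proof -
      have "{i} \<times> ?T = Pair i ` ?T" by auto
      then show ?thesis by (simp add: sum.reindex inj_on_def)
    qed
    also have "\<dots> = ?E * (\<Sum>t\<in>?T. c (i, t) * mon (i, t) y)"
      unfolding bubble_lead_face[OF i i y] sum_distrib_left by (intro sum.cong refl) simp
    finally show ?thesis .
  qed
  have "fin_dim {v. \<exists>c. (\<lambda>y. v y - (\<Sum>j\<in>?J. c j * b j y)) \<in> level r (Suc (Suc n))} (D + card ?J)"
  proof (rule fin_dim_extend[OF finJ W])
    fix c assume "(\<lambda>y. \<Sum>j\<in>?J. c j * b j y) \<in> level r (Suc (Suc n))"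
    then have l: "glue (\<lambda>i y. lam i y ^ Suc n * H c i y) \<in> level r (Suc (Suc n))" unfolding Hglue .
    have z: "H c i y = 0" if "i \<le> 3" "lam i y = 0" for i y
      by (rule level_Suc_D[OF PH CH l that])
    show "\<forall>j\<in>?J. c j = 0"
    proof
      fix j assume j: "j \<in> ?J"
      obtain i t where it: "j = (i, t)" using surj_pair[of j] by blast
      have i: "i \<le> 3" and t: "t \<in> ?T" using j by (auto simp: it)
      have "(\<lambda>t. c (i, t)) t = 0"
      proof (rule plane_monomials_zero[OF _ t])
        fix u v :: real assume uv: "0 < u" "0 < v" "u + v < 1"
        note f = four_opp[OF i]
        note pp = lam_face_pt[OF f, of "(u, v)", unfolded fst_conv snd_conv]
        show "(\<Sum>t\<in>?T. c (i, t) * (u ^ fst t * v ^ snd t)) = 0"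
          using z[OF i pp(1)] uv unfolding Hface[OF i pp(1)] mon_def fst_conv snd_conv pp by simp
      qed
      then show "c j = 0" by (simp add: it)
    qed
  qed
  moreover have "{v. \<exists>c. (\<lambda>y. v y - (\<Sum>j\<in>?J. c j * b j y)) \<in> level r (Suc (Suc n))} = level r (Suc n)"
  proof (intro set_eqI iffI)
    fix v assume "v \<in> {v. \<exists>c. (\<lambda>y. v y - (\<Sum>j\<in>?J. c j * b j y)) \<in> level r (Suc (Suc n))}"
    then obtain c where "(\<lambda>y. v y - (\<Sum>j\<in>?J. c j * b j y)) \<in> level r (Suc n)"
      using level_mono by blast
    moreover have "(\<lambda>y. \<Sum>j\<in>?J. c j * b j y) \<in> level r (Suc n)"
      by (rule levelI[OF Hglue[symmetric] PH CH])
    ultimately have "(\<lambda>y. v y - (\<Sum>j\<in>?J. c j * b j y) + (\<Sum>j\<in>?J. c j * b j y)) \<in> level r (Suc n)"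
      by (rule level_add)
    then show "v \<in> level r (Suc n)" by simp
  next
    fix v assume "v \<in> level r (Suc n)"
    then obtain h where h: "v = glue (\<lambda>i y. lam i y ^ Suc n * h i y)" "\<And>i. i \<le> 3 \<Longrightarrow> Pol (r - int (Suc n)) (h i)"
      "C1_family (\<lambda>i y. lam i y ^ Suc n * h i y)" by (rule levelE) (rule that)
    define Q where "Q = (\<lambda>i c. \<forall>y. lam i y = 0 \<longrightarrow> h i y = lam (opp1 i) y * lam (opp2 i) y * lam (opp3 i) y *
        (\<Sum>t\<in>?T. c t * mon (i, t) y))"
    have "\<exists>c. Q i c" if i: "i \<le> 3" for i
    proof -
      note f = four_opp[OF i]
      note le = four_le[OF f]
      have ne: "i \<noteq> opp1 i" "i \<noteq> opp2 i" "i \<noteq> opp3 i" using f by (auto simp: four_def)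
      have "h i y = 0" if "lam i y = 0" "lam (opp1 i) y = 0 \<or> lam (opp2 i) y = 0 \<or> lam (opp3 i) y = 0" for y
        using that leading_coeff_vanishes_on_edges[OF i _ _ _ h(2)[OF i] h(2) h(3)] le ne by (metis le_add1 plus_1_eq_Suc)
      then obtain s where s: "Pol (r - int (Suc n) - 3) s" "\<And>y. lam i y = 0 \<Longrightarrow> h i y = lam (opp1 i) y * lam (opp2 i) y * lam (opp3 i) y * s y"
        using face_factor[OF f h(2)[OF i]] by blast
      obtain c where c: "\<And>z. s (face_pt (opp1 i) (opp2 i) (opp3 i) z) = (\<Sum>t\<in>plane_exponents (r - int (Suc n) - 3). c t * (fst z ^ fst t * snd z ^ snd t))"
        using Pol_plane_monomials[OF Pol_compose[OF s(1) affine_face_pt]] by blast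
      have T: "plane_exponents (r - int (Suc n) - 3) = ?T" by (simp add: algebra_simps)
      have "s y = (\<Sum>t\<in>?T. c t * mon (i, t) y)" if "lam i y = 0" for y
        using c[of "(lam (opp2 i) y, lam (opp3 i) y)"] unfolding face_pt_lam[OF f that] T mon_def fst_conv snd_conv .
      with s(2) show ?thesis unfolding Q_def by (intro exI[of _ c]) simp
    qed
    then have "\<forall>i. \<exists>c. i \<le> 3 \<longrightarrow> Q i c" by blast
    from choice[OF this] obtain c where Qc: "\<forall>i. i \<le> 3 \<longrightarrow> Q i (c i)" by (elim exE)
    have c: "h i y = lam (opp1 i) y * lam (opp2 i) y * lam (opp3 i) y *
        (\<Sum>t\<in>?T. c i t * mon (i, t) y)" if "i \<le> 3" "lam i y = 0" for i y
      using Qc[rule_format, OF that(1)] that(2) unfolding Q_def by simp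
    \<comment> \<open>On the face \<open>lam i = 0\<close> the bubble of \<open>i\<close> has leading coefficient minus the product of the three other coordinates over \<open>n + 1\<close>.\<close>
    define c' where "c' = (\<lambda>(i, t). - real (Suc n) * c i t)"
    have z: "h i y - H c' i y = 0" if i: "i \<le> 3" and y: "lam i y = 0" for i y
    proof -
      have "(\<Sum>t\<in>?T. c' (i, t) * mon (i, t) y) = - real (Suc n) * (\<Sum>t\<in>?T. c i t * mon (i, t) y)"
        unfolding sum_distrib_left by (intro sum.cong refl) (auto simp: c'_def mult.assoc)
      then show ?thesis unfolding Hface[OF i y] c[OF i y] by (simp del: of_nat_Suc)
    qed
    have eq: "lam i y ^ Suc n * (h i y - H c' i y) = lam i y ^ Suc n * h i y - lam i y ^ Suc n * H c' i y" for i y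
      by (rule right_diff_distrib)
    have "C1_family (\<lambda>i y. lam i y ^ Suc n * (h i y - H c' i y))"
      unfolding eq by (rule C1_family_diff[OF h(3) CH])
    from level_Suc_I[OF Pol_diff[OF h(2) PH] this z]
    have "glue (\<lambda>i y. lam i y ^ Suc n * (h i y - H c' i y)) \<in> level r (Suc (Suc n))" .
    then have "(\<lambda>y. v y - (\<Sum>j\<in>?J. c' j * b j y)) \<in> level r (Suc (Suc n))"
      unfolding eq glue_diff h(1)[symmetric] Hglue .
    then show "v \<in> {v. \<exists>c. (\<lambda>y. v y - (\<Sum>j\<in>?J. c j * b j y)) \<in> level r (Suc (Suc n))}" by blast
  qed
  ultimately show ?thesis by simp
qed

text \<open>Downward induction on the boundary order \<open>n + 1\<close>, in terms of \<open>N = r - n\<close>; at \<open>N = 0\<close> the order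
exceeds the degree and only the zero spline is left.  Each step adds
\<open>2 * (N - 1) * (N - 2)\<close> to \<open>2 * (N - 1) * (N - 2) * (N - 3) / 3\<close>.\<close>

lemma fin_dim_level:
  assumes "r - int (Suc n) = int N - 1"
  shows "\<exists>D. fin_dim (level r (Suc n)) D \<and> (1 \<le> N \<longrightarrow> 3 * int D = 2 * (int N - 1) * (int N - 2) * (int N - 3))"
  using assms
proof (induction N arbitrary: n)
  case 0
  then have "level r (Suc n) = {\<lambda>_. 0}" by (intro level_negative) simp
  then show ?case using fin_dim_0 by auto
next
  case (Suc N)
  have "r - int (Suc (Suc n)) = int N - 1" using Suc.prems by simp
  then obtain D where D: "fin_dim (level r (Suc (Suc n))) D"
    "1 \<le> N \<Longrightarrow> 3 * int D = 2 * (int N - 1) * (int N - 2) * (int N - 3)" using Suc.IH by blast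
  have rn: "r - int n - 4 = int N - 3" using Suc.prems by simp
  have card: "card ({..3::nat} \<times> plane_exponents (int N - 3)) = 4 * card (plane_exponents (int N - 3))" by (simp add: card_cartesian_product)
  have "fin_dim (level r (Suc n)) (D + 4 * card (plane_exponents (int N - 3)))"
    using fin_dim_level_step[OF D(1)] unfolding rn card .
  moreover have "3 * int (D + 4 * card (plane_exponents (int N - 3))) = 2 * (int (Suc N) - 1) * (int (Suc N) - 2) * (int (Suc N) - 3)"
  proof (cases "N = 0")
    case True
    then have "level r (Suc (Suc n)) = {\<lambda>_. 0}" using Suc.prems by (intro level_negative) simp
    then have "D = 0" using fin_dim_dim[OF D(1)] fin_dim_dim[OF fin_dim_0] by simp
    moreover have "plane_exponents (-3) = {}" by (auto simp: plane_exponents_def)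
    ultimately show ?thesis using True by simp
  next
    case False
    then have "2 * int (card (plane_exponents (int N - 3))) = (int N - 3 + 1) * (int N - 3 + 2)" by (intro card_plane_exponents) simp
    then have "12 * int (card (plane_exponents (int N - 3))) = 6 * ((int N - 2) * (int N - 1))" by simp
    moreover have "3 * int D = 2 * (int N - 1) * (int N - 2) * (int N - 3)" using D(2) False by simp
    ultimately show ?thesis by (simp add: algebra_simps)
  qed
  ultimately show ?case by blast
qed

lemma dim_M_ring:
  assumes "2 \<le> r"
  shows "real (fun_dim (M_ring_space r x)) = 2 * ((real r - 4) * (real r - 3) * (real r - 2) / 3)"
proof -
  have "int r - int (Suc 1) = int (r - 1) - 1" using assms by simp
  from fin_dim_level[OF this] obtain D where D: "fin_dim (level (int r) 2) D"
    "3 * int D = 2 * (int (r - 1) - 1) * (int (r - 1) - 2) * (int (r - 1) - 3)" using assms by (auto simp: numeral_2_eq_2)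
  have "3 * int D = 2 * ((int r - 4) * (int r - 3) * (int r - 2))"
    unfolding D(2) using assms by (simp add: of_nat_diff algebra_simps)
  then have "real_of_int (3 * int D) = real_of_int (2 * ((int r - 4) * (int r - 3) * (int r - 2)))" by simp
  then have "3 * real D = 2 * ((real r - 4) * (real r - 3) * (real r - 2))" by simp
  then show ?thesis unfolding M_ring_level fin_dim_dim[OF D(1)] by simp
qed

end

section \<open>Polynomials determined by their moments\<close>

text \<open>Vectors orthogonal to \<open>a\<close> and \<open>b\<close> are multiples of their cross product, so \<open>g\<close> is parallel to \<open>n\<close>.\<close>

lemma orthogonal_three_zero:
  fixes g n a b :: "real^3"
  assumes "cross3 a b \<noteq> 0" "n \<noteq> 0" "n \<bullet> a = 0" "n \<bullet> b = 0" "g \<bullet> a = 0" "g \<bullet> b = 0" "g \<bullet> n = 0"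
  shows "g = 0"
proof -
  define w where "w = cross3 a b"
  have par: "(w \<bullet> w) *\<^sub>R u = (w \<bullet> u) *\<^sub>R w" if "u \<bullet> a = 0" "u \<bullet> b = 0" for u
  proof -
    have "cross3 u w = 0" unfolding w_def Lagrange using that by simp
    then have "cross3 w (cross3 u w) = 0" by simp
    then show ?thesis unfolding Lagrange by simp
  qed
  have ww: "w \<bullet> w \<noteq> 0" using assms(1) by (simp add: w_def)
  have "w \<bullet> n \<noteq> 0" using par[OF assms(3,4)] assms(2) ww by auto
  moreover have "(w \<bullet> g) * (w \<bullet> n) = (w \<bullet> w) * (g \<bullet> n)"
  proof -
    have "((w \<bullet> w) *\<^sub>R g) \<bullet> n = ((w \<bullet> g) *\<^sub>R w) \<bullet> n" using par[OF assms(5,6)] by simp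
    then show ?thesis by simp
  qed
  ultimately have "w \<bullet> g = 0" using assms(7) by simp
  then show ?thesis using par[OF assms(5,6)] ww by simp
qed

text \<open>\<open>P\<close> has zeros of order \<open>N\<close> at both ends, so it is \<open>t ^ N * (1 - t) ^ N * g t\<close> up to sign, and \<open>g\<close> itself
is an admissible test function.\<close>

lemma Pol_segment_zero:
  fixes P :: "real \<Rightarrow> real"
  assumes P: "Pol d P" and 0: "\<And>j. j < N \<Longrightarrow> (dird 1 ^^ j) P 0 = 0" and 1: "\<And>j. j < N \<Longrightarrow> (dird 1 ^^ j) P 1 = 0"
    and I: "\<And>q. Pol (d - 2 * int N) q \<Longrightarrow> integral {0..1} (\<lambda>t. P t * q t) = 0"
  shows "P t = 0"
proof -
  have A: "affine_fun (\<lambda>t::real. t)" and B: "affine_fun (\<lambda>t::real. t - 1)" by (intro affine_intros)+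
  obtain q where q: "Pol (d - int N) q" "\<And>t. P t = t ^ N * q t"
    by (rule Pol_divide_power[OF P A, of 1 N]) (use 0 in auto)
  obtain s where s: "Pol (d - int N) s" "\<And>t. P t = (t - 1) ^ N * s t"
  proof (rule Pol_divide_power[OF P B, of 1 N])
    show "(dird 1 ^^ j) P y = 0" if "y - 1 = 0" "j < N" for y j using 1[OF that(2)] that(1) by simp
  qed auto
  obtain g where g: "Pol (d - int N - int N) g" "\<And>t. P t = t ^ N * (t - 1) ^ N * g t"
    by (rule Pol_divide_common[OF P A B _ _ _ q s, of 0 1]) auto
  have sgn: "t ^ N * (t - 1) ^ N = (-1) ^ N * (t ^ N * (1 - t) ^ N)" for t :: real
    by (simp add: power_mult_distrib[symmetric]) (simp add: algebra_simps)
  have w: "Pol (int N + int N) (\<lambda>t::real. t ^ N * (1 - t) ^ N)"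
    by (intro Pol_mult Pol_affine_power affine_intros)
  have "integral {0..1} (\<lambda>t. P t * g t) = integral {0..1} (\<lambda>t. (-1) ^ N * (t ^ N * (1 - t) ^ N * g t * g t))"
    unfolding g(2) sgn by (simp add: mult.assoc)
  then have "integral {0..1} (\<lambda>t. t ^ N * (1 - t) ^ N * g t * g t) = 0"
    using I[of g] g(1) by simp
  from Pol_integral_square_zero[OF compact_Icc convex_closed_interval _ w _ _ g(1), of 0 1 "1/2", OF _ _ _ this]
  show ?thesis
    unfolding g(2) by (simp add: zero_le_mult_iff)
qed

text \<open>The same argument on a triangle, with zeros of order \<open>N\<close> on its three sides.\<close>

lemma Pol_triangle_zero:
  fixes P :: "real \<times> real \<Rightarrow> real"
  assumes P: "Pol d P"
    and z: "\<And>z v j. fst z = 0 \<or> snd z = 0 \<or> 1 - fst z - snd z = 0 \<Longrightarrow> j < N \<Longrightarrow> (dird v ^^ j) P z = 0"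
    and I: "\<And>q. Pol (d - 3 * int N) q \<Longrightarrow> integral triangle (\<lambda>t. P t * q t) = 0"
  shows "P t = 0"
proof -
  let ?C = "\<lambda>z::real\<times>real. 1 - fst z - snd z"
  have A: "affine_fun (fst :: real\<times>real \<Rightarrow> real)" and B: "affine_fun (snd :: real\<times>real \<Rightarrow> real)"
    and C: "affine_fun ?C" by (intro affine_intros)+
  obtain q1 where q1: "Pol (d - int N) q1" "\<And>z. P z = fst z ^ N * q1 z"
    by (rule Pol_divide_power[OF P A, of "(1, 0)" N]) (use z in auto)
  obtain q2 where q2: "Pol (d - int N) q2" "\<And>z. P z = snd z ^ N * q2 z"
    by (rule Pol_divide_power[OF P B, of "(0, 1)" N]) (use z in auto)
  obtain q3 where q3: "Pol (d - int N) q3" "\<And>z. P z = ?C z ^ N * q3 z"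
  proof (rule Pol_divide_power[OF P C, of "(-1, 0)" N])
    show "(dird (- 1, 0) ^^ j) P y = 0" if "1 - fst y - snd y = 0" "j < N" for y j using z that by blast
  qed auto
  obtain g1 where g1: "Pol (d - int N - int N) g1" "\<And>z. P z = fst z ^ N * snd z ^ N * g1 z"
    by (rule Pol_divide_common[OF P A B _ _ _ q1 q2, of "(0, 1)" "(1, 0)"]) auto
  obtain g2 where g2: "Pol (d - int N - int N) g2" "\<And>z. P z = fst z ^ N * ?C z ^ N * g2 z"
    by (rule Pol_divide_common[OF P A C _ _ _ q1 q3, of "(0, 0)" "(1, 0)"]) auto
  define Q where "Q = (\<lambda>z. snd z ^ N * g1 z)"
  have PQ: "Pol (d - int N) Q" unfolding Q_def using Pol_mult[OF Pol_affine_power[OF B] g1(1), of N] by simp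
  have PD: "Pol (d - int N) (\<lambda>z. Q z - ?C z ^ N * g2 z)"
    using Pol_diff[OF PQ] Pol_mult[OF Pol_affine_power[OF C] g2(1), of N] by simp
  have "fst z ^ N * (Q z - ?C z ^ N * g2 z) = 0" for z
    using g1(2)[of z] g2(2)[of z] by (auto simp: Q_def right_diff_distrib mult.assoc)
  from Pol_cancel[OF Pol_affine_power[OF A] PD affine_UNIV UNIV_I _ UNIV_I this, of "(1, 0)"]
  have Qg2: "Q z = ?C z ^ N * g2 z" for z by simp
  obtain g where g: "Pol (d - int N - int N - int N) g" "\<And>z. Q z = snd z ^ N * ?C z ^ N * g z"
    by (rule Pol_divide_common[OF PQ B C, of "(0, 0)" "(0, 1)" N g1 N g2])
      (use g1(1) g2(1) Q_def Qg2 in auto)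
  have Pg: "P z = fst z ^ N * (snd z ^ N * ?C z ^ N) * g z" for z
    using g1(2)[of z] g(2)[of z] by (simp add: Q_def mult.assoc)
  have w: "Pol (int N + (int N + int N)) (\<lambda>z::real\<times>real. fst z ^ N * (snd z ^ N * ?C z ^ N))"
    by (intro Pol_mult Pol_affine_power A B C)
  have "d - int N - int N - int N = d - 3 * int N" by simp
  with g(1) have "Pol (d - 3 * int N) g" by (simp only:)
  from I[OF this] have int: "integral triangle (\<lambda>z. fst z ^ N * (snd z ^ N * ?C z ^ N) * g z * g z) = 0"
    unfolding Pg .
  have "g t = 0"
    by (rule Pol_integral_square_zero[OF compact_triangle convex_triangle interior_triangle w _ _ g(1) int, of "(1/4, 1/4)"])
      (auto simp: triangle_def)
  then show ?thesis by (simp add: Pg)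
qed

lemma moments_diff_zero:
  fixes \<phi> :: "'b::euclidean_space \<Rightarrow> 'a::euclidean_space"
  assumes D: "compact D" and \<phi>: "affine_fun \<phi>" and p: "Pol d1 p1" "Pol d2 p2" "Pol k q" and c: "c \<noteq> 0"
    and g: "\<And>t. t \<in> D \<Longrightarrow> g1 (\<phi> t) = p1 (\<phi> t)" "\<And>t. t \<in> D \<Longrightarrow> g2 (\<phi> t) = p2 (\<phi> t)"
       "\<And>t. t \<in> D \<Longrightarrow> s (\<phi> t) = q (\<phi> t)"
    and eq: "c * integral D (\<lambda>t. g1 (\<phi> t) * s (\<phi> t)) = c * integral D (\<lambda>t. g2 (\<phi> t) * s (\<phi> t))"
  shows "integral D (\<lambda>t. (p1 (\<phi> t) - p2 (\<phi> t)) * q (\<phi> t)) = 0"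
proof -
  have i: "(\<lambda>t. p (\<phi> t) * q (\<phi> t)) integrable_on D" if "Pol d p" for d p
    by (rule integrable_on_compact[OF D Pol_continuous_on[OF Pol_mult[OF Pol_compose[OF that \<phi>] Pol_compose[OF p(3) \<phi>]]]])
  have "integral D (\<lambda>t. g1 (\<phi> t) * s (\<phi> t)) = integral D (\<lambda>t. p1 (\<phi> t) * q (\<phi> t))"
    "integral D (\<lambda>t. g2 (\<phi> t) * s (\<phi> t)) = integral D (\<lambda>t. p2 (\<phi> t) * q (\<phi> t))"
    using g by (auto intro!: integral_cong)
  then have "integral D (\<lambda>t. p1 (\<phi> t) * q (\<phi> t)) = integral D (\<lambda>t. p2 (\<phi> t) * q (\<phi> t))" using eq c by simp
  then show ?thesis
    by (simp add: left_diff_distrib Henstock_Kurzweil_Integration.integral_diff[OF i[OF p(1)] i[OF p(2)]])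
qed

lemma affine_fun_Pair:
  assumes "affine_fun f" "affine_fun g" shows "affine_fun (\<lambda>y. (f y, g y))"
proof -
  obtain c l d m where "bounded_linear l" "f = (\<lambda>y. c + l y)" "bounded_linear m" "g = (\<lambda>y. d + m y)"
    using assms by (auto simp: affine_fun_def)
  then show ?thesis unfolding affine_fun_def
    by (intro exI[of _ "(c, d)"] exI[of _ "\<lambda>y. (l y, m y)"]) (auto intro: bounded_linear_Pair)
qed

section \<open>Edges, faces and the number of conditions\<close>

lemma edges_eq: "edges = {(0,1),(0,2),(0,3),(1,2),(1,3),(2,3)}"
  by (auto simp: edges_def numeral_3_eq_3 numeral_2_eq_2 le_Suc_eq less_Suc_eq)

lemma faces_eq: "faces = {(0,1,2),(0,1,3),(0,2,3),(1,2,3)}"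
  by (auto simp: faces_def numeral_3_eq_3 numeral_2_eq_2 le_Suc_eq less_Suc_eq)

lemma card_multi_indices: "card {\<alpha>::nat^3. mi_order \<alpha> \<le> 2} = 10"
proof -
  let ?B = "SIGMA a:{..2}. plane_exponents (2 - int a)" and ?v = "\<lambda>(a, b, c). vector [a, b, c] :: nat^3"
  have "{\<alpha>. mi_order \<alpha> \<le> 2} = ?v ` ?B"
  proof (intro set_eqI iffI)
    fix \<alpha> :: "nat^3" assume "\<alpha> \<in> {\<alpha>. mi_order \<alpha> \<le> 2}"
    moreover have "\<alpha> = vector [\<alpha> $ 1, \<alpha> $ 2, \<alpha> $ 3]" by (simp add: vec_eq_iff forall_3)
    ultimately show "\<alpha> \<in> ?v ` ?B"
      by (intro image_eqI[of _ _ "(\<alpha> $ 1, \<alpha> $ 2, \<alpha> $ 3)"]) (auto simp: mi_order_3 plane_exponents_def)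
  qed (auto simp: mi_order_3 plane_exponents_def)
  moreover have "inj_on ?v ?B"
    by (auto simp: inj_on_def vec_eq_iff forall_3)
  moreover have "card ?B = (\<Sum>a\<le>2. card (plane_exponents (2 - int a)))" by (simp add: finite_plane_exponents)
  moreover have "(\<Sum>a\<le>2. card (plane_exponents (2 - int a))) = card (plane_exponents 2) + card (plane_exponents 1) + card (plane_exponents 0)"
    by (simp add: numeral_2_eq_2)
  moreover have "card (plane_exponents 2) = 6" "card (plane_exponents 1) = 3" "card (plane_exponents 0) = 1"
    using card_plane_exponents[of 2] card_plane_exponents[of 1] card_plane_exponents[of 0] by auto
  ultimately show ?thesis by (simp add: card_image)
qed

context tetrahedron
begin

definition edge_pt :: "nat \<Rightarrow> nat \<Rightarrow> real \<Rightarrow> real^3" where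
  "edge_pt a b t = x a + t *\<^sub>R (x b - x a)"

lemma affine_edge_pt: "affine_fun (edge_pt a b)"
  unfolding edge_pt_def by (intro affine_intros)

lemma edge_image: "edge_of_tetra x (a, b) = edge_pt a b ` {0..1}"
  unfolding edge_of_tetra_def edge_pt_def by (auto simp: convex_hull_2_alt)

lemma lam_edge_pt: "a \<le> 3 \<Longrightarrow> b \<le> 3 \<Longrightarrow> a \<noteq> b \<Longrightarrow> lam b (edge_pt a b t) = t"
  by (simp add: edge_pt_def lam_dir lam_x)

lemma edge_nonzero: "a \<le> 3 \<Longrightarrow> b \<le> 3 \<Longrightarrow> a \<noteq> b \<Longrightarrow> x b - x a \<noteq> 0"
  using lam_x[of b a] lam_x[of b b] by auto

lemma edge_subset_cell:
  assumes "a \<le> 3" "b \<le> 3" "i \<le> 3" "i \<noteq> a" "i \<noteq> b"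
  shows "edge_of_tetra x (a, b) \<subseteq> alfeld_cell x i"
  unfolding edge_of_tetra_def prod.case
  by (rule hull_minimal[where S = convex, OF _ convex_cell]) (use assms vertex_cell in auto)

lemma face_image: "face_of_tetra x (a, b, c) = face_pt a b c ` triangle"
  unfolding face_of_tetra_def face_pt_def triangle_def by (auto simp: convex_hull_3_alt image_iff) blast+

lemma face_subset_cell:
  assumes "four i a b c" shows "face_of_tetra x (a, b, c) \<subseteq> alfeld_cell x i"
proof -
  have "i \<noteq> a" "i \<noteq> b" "i \<noteq> c" using assms by (auto simp: four_def)
  then show ?thesis unfolding face_of_tetra_def prod.case
    by (intro hull_minimal[where S = convex, OF _ convex_cell]) (use four_le[OF assms] vertex_cell in auto)
qed

text \<open>If the sides at \<open>x a\<close> were parallel, the line from \<open>x a\<close> through \<open>x b\<close> would be the one through \<open>x c\<close>,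
on which \<open>lam b\<close> is zero.\<close>

lemma face_cross_nonzero:
  assumes "four i a b c" shows "cross3 (x b - x a) (x c - x a) \<noteq> 0"
proof
  have ne: "a \<noteq> b" "a \<noteq> c" "b \<noteq> c" using assms by (auto simp: four_def)
  note le = four_le[OF assms]
  let ?u = "x b - x a" and ?v = "x c - x a"
  assume "cross3 ?u ?v = 0"
  then have "cross3 ?v (cross3 ?u ?v) = 0" by simp
  then have "(?v \<bullet> ?v) *\<^sub>R ?u = (?v \<bullet> ?u) *\<^sub>R ?v" unfolding Lagrange by simp
  then have "lam b (x a + (?v \<bullet> ?v) *\<^sub>R ?u) = lam b (x a + (?v \<bullet> ?u) *\<^sub>R ?v)" by simp
  then have "?v \<bullet> ?v = 0" using le ne by (simp only: lam_dir) (simp add: lam_x)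
  then show False using edge_nonzero[of a c] le ne by simp
qed

lemma sum_dim_edges:
  assumes "-1 \<le> k" shows "(\<Sum>e\<in>edges. fun_dim (polys k (edge_of_tetra x e))) = 6 * nat (k + 1)"
proof -
  have "fun_dim (polys k (edge_of_tetra x e)) = nat (k + 1)" if e: "e \<in> edges" for e
  proof -
    obtain a b where ab: "e = (a, b)" "a \<le> 3" "b \<le> 3" "a \<noteq> b" using e by (auto simp: edges_def)
    show ?thesis unfolding ab(1) edge_image
      using fin_dim_dim[OF fin_dim_polys_segment[OF affine_edge_pt lam_affine[OF ab(3)] lam_edge_pt[OF ab(2-4)]]]
        card_degs[OF assms] by simp
  qed
  then show ?thesis by (simp add: edges_eq)
qed

lemma face_four:
  assumes "F \<in> faces" obtains i a b c where "F = (a, b, c)" "four i a b c"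
proof -
  have "F \<in> {(0,1,2),(0,1,3),(0,2,3),(1,2,3)}" using assms by (simp add: faces_eq)
  then have "\<exists>i a b c. F = (a, b, c) \<and> four i a b c"
    using four_opp[of 0] four_opp[of 1] four_opp[of 2] four_opp[of 3]
    by (auto simp: opp1_def opp2_def opp3_def)
  then show thesis using that by blast
qed

lemma sum_dim_faces:
  assumes "-2 \<le> k" shows "2 * int (\<Sum>F\<in>faces. fun_dim (polys k (face_of_tetra x F))) = 4 * ((k + 1) * (k + 2))"
proof -
  have "fun_dim (polys k (face_of_tetra x F)) = card (plane_exponents k)" if F: "F \<in> faces" for F
  proof -
    obtain i a b c where f: "F = (a, b, c)" "four i a b c" using face_four[OF F] .
    have "affine_fun (\<lambda>y. (lam b y, lam c y))" using four_le[OF f(2)] by (intro affine_fun_Pair lam_affine) auto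
    from fin_dim_dim[OF fin_dim_polys_triangle[OF affine_face_pt this]] show ?thesis
      unfolding f(1) face_image by (simp add: lam_face_pt[OF f(2)])
  qed
  then show ?thesis using card_plane_exponents[OF assms] by (simp add: faces_eq)
qed

section \<open>Unisolvence\<close>

text \<open>The multi-indices give only the derivatives with increasing indices; symmetry of the
Hessian of a polynomial supplies the others.\<close>

lemma vertex_dofs:
  assumes f: "spline_family r f" and g: "spline_family r g" and m: "m \<le> 3" and i: "i \<le> 3" "i \<noteq> m"
    and dof: "\<And>\<alpha>. mi_order \<alpha> \<le> 2 \<Longrightarrow> mi_der (tetra x) \<alpha> (glue f) (x m) = mi_der (tetra x) \<alpha> (glue g) (x m)"
  defines "h \<equiv> \<lambda>y. f i y - g i y"
  shows "h (x m) = 0" "dird v h (x m) = 0" "dird v (dird w h) (x m) = 0"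
proof -
  have C: "C1_family f" "C1_family g" using f g by (auto simp: spline_family_def)
  have P: "Pol r (f i)" "Pol r (g i)" using f g i by (auto simp: spline_family_def)
  have Ph: "Pol r h" unfolding h_def by (intro Pol_diff P)
  have mi: "x m \<in> alfeld_cell x i" using m i vertex_cell by blast
  note p1 = partial_der_glue[OF f i(1) mi] partial_der_glue[OF g i(1) mi]
  note p2 = partial_der2_glue[OF f i m] partial_der2_glue[OF g i m]
  have D: "mi_der (tetra x) (vector [a, b, c]) (glue f) (x m) = mi_der (tetra x) (vector [a, b, c]) (glue g) (x m)"
    if "a + b + c \<le> 2" for a b c using that by (intro dof) (simp add: mi_order_3)
  have 0: "f i (x m) = g i (x m)"
    using D[of 0 0 0] by (simp add: mi_der_def glue_eq[OF C(1) i(1) mi] glue_eq[OF C(2) i(1) mi])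
  have 1: "\<forall>j. dird (axis j 1) (f i) (x m) = dird (axis j 1) (g i) (x m)"
    unfolding forall_3 using D[of 1 0 0] D[of 0 1 0] D[of 0 0 1] by (simp add: mi_der_def p1)
  have 2: "\<forall>a b. dird (axis a 1) (dird (axis b 1) (f i)) (x m) = dird (axis a 1) (dird (axis b 1) (g i)) (x m)"
  proof -
    note c = dird_commute[OF P(1), of "axis 2 1" "axis 1 1"] dird_commute[OF P(1), of "axis 3 1" "axis 1 1"]
      dird_commute[OF P(1), of "axis 3 1" "axis 2 1"]
      dird_commute[OF P(2), of "axis 2 1" "axis 1 1"] dird_commute[OF P(2), of "axis 3 1" "axis 1 1"]
      dird_commute[OF P(2), of "axis 3 1" "axis 2 1"]
    show ?thesis unfolding forall_3
      using D[of 1 1 0] D[of 1 0 1] D[of 0 1 1] D[of 2 0 0] D[of 0 2 0] D[of 0 0 2]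
      by (simp add: mi_der_def p2 c numeral_2_eq_2)
  qed
  show "h (x m) = 0" using 0 by (simp add: h_def)
  have dh: "dird w h = (\<lambda>y. dird w (f i) y - dird w (g i) y)" for w
    unfolding h_def by (rule ext) (rule dird_diff[OF P])
  have ddh: "dird v (dird w h) (x m) = dird v (dird w (f i)) (x m) - dird v (dird w (g i)) (x m)" for v w
    unfolding dh by (rule dird_diff[OF Pol_dird[OF P(1)] Pol_dird[OF P(2)]])
  have "(\<chi> j. dird (axis j 1) h (x m)) = 0" using 1 by (simp add: vec_eq_iff dh)
  then show "dird v h (x m) = 0" using dird_inner[OF Ph, of "x m" v] by simp
  have "dird w (dird (axis a 1) h) (x m) = 0" for a w
  proof -
    have "(\<chi> j. dird (axis j 1) (dird (axis a 1) h) (x m)) = 0" using 2 by (simp add: vec_eq_iff ddh)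
    then show ?thesis using dird_inner[OF Pol_dird[OF Ph], of "axis a 1" "x m" w] by simp
  qed
  then have "(\<chi> j. dird (axis j 1) (dird w h) (x m)) = 0"
    by (simp add: vec_eq_iff dird_commute[OF Ph, of _ w])
  then show "dird v (dird w h) (x m) = 0" using dird_inner[OF Pol_dird[OF Ph], of w "x m" v] by simp
qed

lemma dird_line:
  assumes "Pol d p"
  shows "(dird 1 ^^ j) (\<lambda>t. p (a + t *\<^sub>R v)) = (\<lambda>t. (dird v ^^ j) p (a + t *\<^sub>R v))"
proof (induction j)
  case (Suc j)
  have "affine_fun (\<lambda>t::real. a + t *\<^sub>R v)" by (intro affine_intros)
  from dird_compose[OF Pol_dird_funpow[OF assms] this, of 1] show ?case
    by (simp add: Suc fun_eq_iff algebra_simps)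
qed simp

lemma edge_moments_vanish:
  assumes p: "Pol d p" and ab: "a \<le> 3" "b \<le> 3" "a \<noteq> b"
    and v: "\<And>m j. m = a \<or> m = b \<Longrightarrow> j < N \<Longrightarrow> (dird (x b - x a) ^^ j) p (x m) = 0"
    and I: "\<And>q. Pol (d - 2 * int N) q \<Longrightarrow> integral {0..1} (\<lambda>t. p (edge_pt a b t) * q (edge_pt a b t)) = 0"
  shows "p (edge_pt a b t) = 0"
proof (rule Pol_segment_zero[OF Pol_compose[OF p affine_edge_pt], of N])
  show "(dird 1 ^^ j) (\<lambda>t. p (edge_pt a b t)) 0 = 0" "(dird 1 ^^ j) (\<lambda>t. p (edge_pt a b t)) 1 = 0" if "j < N" for j
    unfolding edge_pt_def dird_line[OF p] using v[OF _ that] by auto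
  fix q :: "real \<Rightarrow> real" assume q: "Pol (d - 2 * int N) q"
  show "integral {0..1} (\<lambda>t. p (edge_pt a b t) * q t) = 0"
    using I[OF Pol_compose[OF q lam_affine[OF ab(2)]]] by (simp add: lam_edge_pt[OF ab])
qed

lemma face_moments_vanish:
  assumes f: "four i a b c" and p: "Pol d p" and N: "N \<le> 2"
    and v: "\<And>y. lam i y = 0 \<Longrightarrow> lam a y = 0 \<or> lam b y = 0 \<or> lam c y = 0 \<Longrightarrow> p y = 0"
      "\<And>y v. lam i y = 0 \<Longrightarrow> lam a y = 0 \<or> lam b y = 0 \<or> lam c y = 0 \<Longrightarrow> N = 2 \<Longrightarrow> dird v p y = 0"
    and I: "\<And>q. Pol (d - 3 * int N) q \<Longrightarrow> integral triangle (\<lambda>z. p (face_pt a b c z) * q (face_pt a b c z)) = 0"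
    and y: "lam i y = 0"
  shows "p y = 0"
proof -
  note fp = lam_face_pt[OF f]
  have "p (face_pt a b c (lam b y, lam c y)) = 0"
  proof (rule Pol_triangle_zero[OF Pol_compose[OF p affine_face_pt], of N])
    fix z v :: "real \<times> real" and j
    assume z: "fst z = 0 \<or> snd z = 0 \<or> 1 - fst z - snd z = 0" and j: "j < N"
    have l: "lam i (face_pt a b c z) = 0"
      "lam a (face_pt a b c z) = 0 \<or> lam b (face_pt a b c z) = 0 \<or> lam c (face_pt a b c z) = 0"
      using z unfolding fp by auto
    consider "j = 0" | "j = 1" "N = 2" using j N by linarith
    then show "(dird v ^^ j) (\<lambda>z. p (face_pt a b c z)) z = 0"
      using v(1)[OF l] v(2)[OF l] by cases (simp_all add: dird_compose[OF p affine_face_pt])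
  next
    fix q :: "real \<times> real \<Rightarrow> real" assume q: "Pol (d - 3 * int N) q"
    have "affine_fun (\<lambda>y. (lam b y, lam c y))" using four_le[OF f] by (intro affine_fun_Pair lam_affine) auto
    from I[OF Pol_compose[OF q this]] show "integral triangle (\<lambda>z. p (face_pt a b c z) * q z) = 0"
      unfolding fp by simp
  qed
  then show ?thesis unfolding face_pt_lam[OF f y] .
qed

text \<open>On an edge \<open>a, b\<close> are the two normals and \<open>n\<close> is the tangent; on a face \<open>a, b\<close> are two sides and
\<open>n\<close> is the normal.\<close>

lemma gradient_zeroI:
  assumes p: "Pol d p" and ab: "cross3 a b \<noteq> 0" "n \<noteq> 0" "n \<bullet> a = 0" "n \<bullet> b = 0"
    and z: "dird a p y = 0" "dird b p y = 0" "dird n p y = 0"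
  shows "dird v p y = 0"
proof -
  have "(\<chi> j. dird (axis j 1) p y) = (0 :: real^3)"
    by (rule orthogonal_three_zero[OF ab]) (simp_all add: dird_inner[OF p] z)
  then show ?thesis using dird_inner[OF p, of y v] by simp
qed

text \<open>The difference of the two splines is its own test function, so its gradient vanishes in the
interior.  The pieces are then constants; they agree at the barycenter, and one of them is
zero at a vertex.\<close>

lemma energy_zero:
  assumes f: "spline_family r f" and g: "spline_family r g" and m: "m \<le> 3" "f i0 (x m) = g i0 (x m)" "i0 \<le> 3" "i0 \<noteq> m"
    and cont: "continuous_on (tetra x) (grad (tetra x) (glue f))" "continuous_on (tetra x) (grad (tetra x) (glue g))"
    and eq: "integral (tetra x) (\<lambda>y. grad (tetra x) (glue f) y \<bullet> grad (tetra x) (glue (\<lambda>i y. f i y - g i y)) y)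
      = integral (tetra x) (\<lambda>y. grad (tetra x) (glue g) y \<bullet> grad (tetra x) (glue (\<lambda>i y. f i y - g i y)) y)"
  shows "glue f = glue g"
proof -
  let ?T = "tetra x" and ?h = "\<lambda>i y. f i y - g i y"
  let ?G = "grad ?T (glue ?h)" and ?A = "grad ?T (glue f)" and ?B = "grad ?T (glue g)"
  have h: "spline_family r ?h" by (rule spline_family_diff[OF f g])
  have P: "Pol r (f i)" "Pol r (g i)" "Pol r (?h i)" if "i \<le> 3" for i
    using f g h that by (auto simp: spline_family_def)
  have G: "?G y = ?A y - ?B y" if y: "y \<in> ?T" for y
  proof -
    obtain i where i: "i \<le> 3" "y \<in> alfeld_cell x i" using y unfolding tetra_cells by auto
    have "?G y \<bullet> v = (?A y - ?B y) \<bullet> v" for v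
      unfolding inner_diff_left grad_glue[OF h i] grad_glue[OF f i] grad_glue[OF g i]
      by (rule dird_diff[OF P(1,2)[OF i(1)]])
    then show ?thesis using vector_eq_rdot by blast
  qed
  have cG: "continuous_on ?T ?G"
    using continuous_on_diff[OF cont] by (rule continuous_on_eq) (simp add: G)
  have iA: "(\<lambda>y. ?A y \<bullet> ?G y) integrable_on ?T" and iB: "(\<lambda>y. ?B y \<bullet> ?G y) integrable_on ?T"
    by (intro integrable_on_compact compact_tetra continuous_on_inner cont cG)+
  have "integral ?T (\<lambda>y. ?G y \<bullet> ?G y) = integral ?T (\<lambda>y. ?A y \<bullet> ?G y - ?B y \<bullet> ?G y)"
  proof (rule integral_cong)
    fix y assume "y \<in> ?T"
    then show "?G y \<bullet> ?G y = ?A y \<bullet> ?G y - ?B y \<bullet> ?G y" by (simp only: inner_diff_left[symmetric] G)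
  qed
  also have "\<dots> = 0"
    using Henstock_Kurzweil_Integration.integral_diff[OF iA iB] eq by simp
  finally have I: "integral ?T (\<lambda>y. ?G y \<bullet> ?G y) = 0" .
  have z: "?G y = 0" if "y \<in> interior ?T" for y
    using integral_zero_interior[OF compact_tetra continuous_on_inner[OF cG cG] _ I that] by simp
  have dz: "dird v (?h i) y = 0" if i: "i \<le> 3" for i v y
  proof (rule Pol_zero_interior[OF Pol_dird[OF P(3)[OF i]], of "interior (alfeld_cell x i)"])
    fix y assume y: "y \<in> interior (alfeld_cell x i)"
    then have "y \<in> interior ?T" using interior_mono[OF cell_subset[OF i]] by blast
    then show "dird v (?h i) y = 0"
      using grad_glue[OF h i, of y v] y interior_subset z by fastforce
  qed (use interior_cell[OF i] convex_cell convex_interior in auto)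
  have const: "?h i y = ?h i z" if i: "i \<le> 3" for i y z
  proof -
    have "(?h i has_derivative (\<lambda>v. 0)) (at y)" for y
      using Pol_has_derivative[OF P(3)[OF i], of y] unfolding dz[OF i] .
    then obtain c where "\<And>y. ?h i y = c" using has_derivative_zero_constant[OF convex_UNIV, of "?h i"] by auto
    then show ?thesis by simp
  qed
  have "?h i y = 0" if i: "i \<le> 3" for i y
  proof -
    have "?h i y = ?h i (barycenter x)" by (rule const[OF i])
    also have "\<dots> = ?h i0 (barycenter x)"
      using C1_family_eq[of ?h i i0 "barycenter x"] h i m by (simp add: spline_family_def lam_barycenter)
    also have "\<dots> = ?h i0 (x m)" by (rule const[OF m(3)])
    finally show ?thesis using m by simp
  qed
  then show ?thesis by (intro glue_cong) simp
qed

lemma edge_moments_diff: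
  assumes ab: "a \<le> 3" "b \<le> 3" "a \<noteq> b" and i: "i \<le> 3" "i \<noteq> a" "i \<noteq> b"
    and p: "Pol d1 p1" "Pol d2 p2" and q: "Pol k q"
    and u: "\<And>y. y \<in> alfeld_cell x i \<Longrightarrow> u1 y = p1 y" "\<And>y. y \<in> alfeld_cell x i \<Longrightarrow> u2 y = p2 y"
    and eq: "\<And>s. s \<in> polys k (edge_of_tetra x (a, b)) \<Longrightarrow>
       edge_integral x (a, b) (\<lambda>y. u1 y * s y) = edge_integral x (a, b) (\<lambda>y. u2 y * s y)"
  shows "integral {0..1} (\<lambda>t. (p1 (edge_pt a b t) - p2 (edge_pt a b t)) * q (edge_pt a b t)) = 0"
proof (rule moments_diff_zero[OF compact_Icc affine_edge_pt p q])
  let ?E = "edge_of_tetra x (a, b)"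
  show "norm (x b - x a) \<noteq> 0" using edge_nonzero[OF ab] by simp
  show "norm (x b - x a) * integral {0..1} (\<lambda>t. u1 (edge_pt a b t) * restr ?E q (edge_pt a b t))
     = norm (x b - x a) * integral {0..1} (\<lambda>t. u2 (edge_pt a b t) * restr ?E q (edge_pt a b t))"
    using eq[OF restr_in_polys[OF q]] by (simp add: edge_integral_def edge_pt_def)
  show "u1 (edge_pt a b t) = p1 (edge_pt a b t)" "u2 (edge_pt a b t) = p2 (edge_pt a b t)"
    "restr ?E q (edge_pt a b t) = q (edge_pt a b t)" if t: "t \<in> {0..1}" for t
  proof -
    have E: "edge_pt a b t \<in> ?E" using t unfolding edge_image by (rule imageI)
    then have "edge_pt a b t \<in> alfeld_cell x i" using edge_subset_cell[OF ab(1,2) i] by blast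
    with E u show "u1 (edge_pt a b t) = p1 (edge_pt a b t)" "u2 (edge_pt a b t) = p2 (edge_pt a b t)"
      "restr ?E q (edge_pt a b t) = q (edge_pt a b t)" by (simp_all add: restr_def)
  qed
qed

lemma face_moments_diff:
  assumes f: "four i a b c" and p: "Pol d1 p1" "Pol d2 p2" and q: "Pol k q"
    and u: "\<And>y. y \<in> alfeld_cell x i \<Longrightarrow> u1 y = p1 y" "\<And>y. y \<in> alfeld_cell x i \<Longrightarrow> u2 y = p2 y"
    and eq: "\<And>s. s \<in> polys k (face_of_tetra x (a, b, c)) \<Longrightarrow>
       face_integral x (a, b, c) (\<lambda>y. u1 y * s y) = face_integral x (a, b, c) (\<lambda>y. u2 y * s y)"
  shows "integral triangle (\<lambda>z. (p1 (face_pt a b c z) - p2 (face_pt a b c z)) * q (face_pt a b c z)) = 0"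
proof (rule moments_diff_zero[OF compact_triangle affine_face_pt p q])
  let ?F = "face_of_tetra x (a, b, c)" and ?J = "norm (cross3 (x b - x a) (x c - x a))"
  show "?J \<noteq> 0" using face_cross_nonzero[OF f] by simp
  show "?J * integral triangle (\<lambda>z. u1 (face_pt a b c z) * restr ?F q (face_pt a b c z))
     = ?J * integral triangle (\<lambda>z. u2 (face_pt a b c z) * restr ?F q (face_pt a b c z))"
    using eq[OF restr_in_polys[OF q]] by (simp add: face_integral_def face_pt_def triangle_def case_prod_unfold)
  show "u1 (face_pt a b c z) = p1 (face_pt a b c z)" "u2 (face_pt a b c z) = p2 (face_pt a b c z)"
    "restr ?F q (face_pt a b c z) = q (face_pt a b c z)" if z: "z \<in> triangle" for z
  proof -
    have F: "face_pt a b c z \<in> ?F" using z unfolding face_image by (rule imageI)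
    then have "face_pt a b c z \<in> alfeld_cell x i" using face_subset_cell[OF f] by blast
    with F u show "u1 (face_pt a b c z) = p1 (face_pt a b c z)" "u2 (face_pt a b c z) = p2 (face_pt a b c z)"
      "restr ?F q (face_pt a b c z) = q (face_pt a b c z)" by (simp_all add: restr_def)
  qed
qed

text \<open>The edge lies in every cell \<open>T_i\<close> with \<open>i\<close> not on the edge, and on such a cell the spline is the
polynomial piece.  So the conditions on the edge can be read as conditions on the difference \<open>h\<close>
of the two pieces.\<close>

lemma edge_determined:
  assumes f: "spline_family (int r) f" and g: "spline_family (int r) g"
    and e: "(a, b) \<in> edges" and i: "i \<le> 3" "i \<noteq> a" "i \<noteq> b" and n: "orthonormal_normals (edge_of_tetra x (a, b)) np nm"
    and V: "\<And>m \<alpha>. m \<le> 3 \<Longrightarrow> mi_order \<alpha> \<le> 2 \<Longrightarrow> mi_der (tetra x) \<alpha> (glue f) (x m) = mi_der (tetra x) \<alpha> (glue g) (x m)"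
    and E0: "\<And>s. s \<in> polys (int r - 6) (edge_of_tetra x (a, b)) \<Longrightarrow>
       edge_integral x (a, b) (\<lambda>y. glue f y * s y) = edge_integral x (a, b) (\<lambda>y. glue g y * s y)"
    and E1: "\<And>s u. s \<in> polys (int r - 5) (edge_of_tetra x (a, b)) \<Longrightarrow> u = np \<or> u = nm \<Longrightarrow>
       edge_integral x (a, b) (\<lambda>y. (grad (tetra x) (glue f) y \<bullet> u) * s y) = edge_integral x (a, b) (\<lambda>y. (grad (tetra x) (glue g) y \<bullet> u) * s y)"
  defines "h \<equiv> \<lambda>y. f i y - g i y"
  shows "h (edge_pt a b t) = 0" "dird v h (edge_pt a b t) = 0"
proof -
  have ab: "a \<le> 3" "b \<le> 3" "a \<noteq> b" using e by (auto simp: edges_def)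
  let ?\<tau> = "x b - x a"
  have C: "C1_family f" "C1_family g" using f g by (auto simp: spline_family_def)
  have P: "Pol (int r) (f i)" "Pol (int r) (g i)" using f g i by (auto simp: spline_family_def)
  have Ph: "Pol (int r) h" unfolding h_def by (intro Pol_diff P)
  have m: "m \<le> 3" "i \<noteq> m" if "m = a \<or> m = b" for m using that ab i by auto
  have vd: "h (x m) = 0" "dird v h (x m) = 0" "dird v (dird w h) (x m) = 0" if "m = a \<or> m = b" for m v w
    unfolding h_def using vertex_dofs[OF f g m(1)[OF that] i(1) m(2)[OF that] V[OF m(1)[OF that]]] by blast+
  have dh: "dird u h = (\<lambda>y. dird u (f i) y - dird u (g i) y)" for u
    unfolding h_def by (rule ext) (rule dird_diff[OF P])
  have h0: "h (edge_pt a b t) = 0" for t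
  proof (rule edge_moments_vanish[OF Ph ab])
    show "(dird ?\<tau> ^^ j) h (x m) = 0" if mab: "m = a \<or> m = b" and "j < 3" for m j
    proof -
      consider "j = 0" | "j = 1" | "j = Suc 1" using \<open>j < 3\<close> by linarith
      then show ?thesis by cases (simp_all add: vd[OF mab])
    qed
    fix q :: "real^3 \<Rightarrow> real" assume q: "Pol (int r - 2 * int 3) q"
    show "integral {0..1} (\<lambda>t. h (edge_pt a b t) * q (edge_pt a b t)) = 0"
      unfolding h_def
      by (rule edge_moments_diff[OF ab i P q glue_eq[OF C(1) i(1)] glue_eq[OF C(2) i(1)]]) (simp_all add: E0)
  qed
  have hn: "dird u h (edge_pt a b t) = 0" if u: "u = np \<or> u = nm" for u t
  proof (rule edge_moments_vanish[OF Pol_dird[OF Ph] ab])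
    show "(dird ?\<tau> ^^ j) (dird u h) (x m) = 0" if mab: "m = a \<or> m = b" and "j < 2" for m j
    proof -
      consider "j = 0" | "j = 1" using \<open>j < 2\<close> by linarith
      then show ?thesis by cases (simp_all add: vd[OF mab])
    qed
    fix q :: "real^3 \<Rightarrow> real" assume q: "Pol (int r - 1 - 2 * int 2) q"
    show "integral {0..1} (\<lambda>t. dird u h (edge_pt a b t) * q (edge_pt a b t)) = 0"
      unfolding dh
      by (rule edge_moments_diff[OF ab i Pol_dird[OF P(1)] Pol_dird[OF P(2)] q grad_glue[OF f i(1)] grad_glue[OF g i(1)]])
        (simp_all add: E1[OF _ u])
  qed
  show "h (edge_pt a b t) = 0" by (rule h0)
  have ht: "dird ?\<tau> h (edge_pt a b t) = 0"
    using fun_cong[OF dird_line[OF Ph, of 1 "x a" ?\<tau>], of t] h0 by (simp add: edge_pt_def)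
  have "x a \<in> edge_of_tetra x (a, b)" "x b \<in> edge_of_tetra x (a, b)" by (auto simp: edge_of_tetra_def hull_inc)
  then have nn: "norm np = 1" "norm nm = 1" "np \<bullet> nm = 0" "np \<bullet> ?\<tau> = 0" "nm \<bullet> ?\<tau> = 0"
    using n by (auto simp: orthonormal_normals_def)
  have c: "cross3 np nm \<noteq> 0" using norm_cross_dot[of np nm] nn(1-3) by auto
  have \<tau>: "?\<tau> \<bullet> np = 0" "?\<tau> \<bullet> nm = 0" using nn(4,5) by (simp_all only: inner_commute)
  show "dird v h (edge_pt a b t) = 0"
    by (rule gradient_zeroI[OF Ph c edge_nonzero[OF ab] \<tau> hn hn ht]) simp_all
qed

text \<open>Once \<open>h\<close> and its gradient vanish on the sides, \<open>h\<close> has double zeros there and the normal derivative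
simple ones, which matches the test degrees \<open>r - 6\<close> and \<open>(r - 1) - 3 = r - 4\<close>.\<close>

lemma face_determined:
  assumes f: "spline_family (int r) f" and g: "spline_family (int r) g" and four: "four i a b c"
    and n: "outward_unit_normal (tetra x) (face_of_tetra x (a, b, c)) u"
    and h: "h = (\<lambda>y. f i y - g i y)"
    and z: "\<And>y. lam i y = 0 \<Longrightarrow> lam a y = 0 \<or> lam b y = 0 \<or> lam c y = 0 \<Longrightarrow> h y = 0"
      "\<And>y v. lam i y = 0 \<Longrightarrow> lam a y = 0 \<or> lam b y = 0 \<or> lam c y = 0 \<Longrightarrow> dird v h y = 0"
    and F0: "\<And>s. s \<in> polys (int r - 6) (face_of_tetra x (a, b, c)) \<Longrightarrow>
       face_integral x (a, b, c) (\<lambda>y. glue f y * s y) = face_integral x (a, b, c) (\<lambda>y. glue g y * s y)"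
    and F1: "\<And>s. s \<in> polys (int r - 4) (face_of_tetra x (a, b, c)) \<Longrightarrow>
       face_integral x (a, b, c) (\<lambda>y. (grad (tetra x) (glue f) y \<bullet> u) * s y) = face_integral x (a, b, c) (\<lambda>y. (grad (tetra x) (glue g) y \<bullet> u) * s y)"
    and y: "lam i y = 0"
  shows "h y = 0" "dird v h y = 0"
proof -
  have i: "i \<le> 3" using four_le[OF four] by simp
  have C: "C1_family f" "C1_family g" using f g by (auto simp: spline_family_def)
  have P: "Pol (int r) (f i)" "Pol (int r) (g i)" using f g i by (auto simp: spline_family_def)
  have Ph: "Pol (int r) h" unfolding h by (intro Pol_diff P)
  have dh: "dird u h = (\<lambda>y. dird u (f i) y - dird u (g i) y)" for u
    unfolding h by (rule ext) (rule dird_diff[OF P])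
  have h0: "h y = 0" if "lam i y = 0" for y
  proof (rule face_moments_vanish[OF four Ph order_refl z _ that])
    fix q :: "real^3 \<Rightarrow> real" assume q: "Pol (int r - 3 * int 2) q"
    show "integral triangle (\<lambda>z. h (face_pt a b c z) * q (face_pt a b c z)) = 0"
      unfolding h by (rule face_moments_diff[OF four P q glue_eq[OF C(1) i] glue_eq[OF C(2) i]]) (simp_all add: F0)
  qed
  have hn: "dird u h y = 0" if "lam i y = 0" for y
  proof (rule face_moments_vanish[OF four Pol_dird[OF Ph], of 1])
    fix q :: "real^3 \<Rightarrow> real" assume q: "Pol (int r - 1 - 3 * int 1) q"
    show "integral triangle (\<lambda>z. dird u h (face_pt a b c z) * q (face_pt a b c z)) = 0"
      unfolding dh
      by (rule face_moments_diff[OF four Pol_dird[OF P(1)] Pol_dird[OF P(2)] q grad_glue[OF f i] grad_glue[OF g i]])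
        (simp_all add: F1)
  qed (use z(2) that in auto)
  show "h y = 0" by (rule h0[OF y])
  have tang: "dird w h y = 0" if w: "\<And>t. lam i (y + t *\<^sub>R w) = 0" for w
    using fun_cong[OF dird_line[OF Ph, of 1 y w], of 0] h0[OF w] by simp
  have le: "a \<le> 3" "b \<le> 3" "c \<le> 3" using four_le[OF four] by auto
  have ne: "i \<noteq> a" "i \<noteq> b" "i \<noteq> c" using four by (auto simp: four_def)
  have ht: "dird (x b - x a) h y = 0" "dird (x c - x a) h y = 0"
    by (rule tang, use le ne i y in \<open>simp add: lam_dir lam_x\<close>)+
  have ends: "x a \<in> face_of_tetra x (a, b, c)" "x b \<in> face_of_tetra x (a, b, c)" "x c \<in> face_of_tetra x (a, b, c)"
    by (auto simp: face_of_tetra_def hull_inc)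
  have nn: "u \<noteq> 0" "u \<bullet> (x b - x a) = 0" "u \<bullet> (x c - x a) = 0"
    using n ends by (auto simp: outward_unit_normal_def)
  show "dird v h y = 0"
    by (rule gradient_zeroI[OF Ph face_cross_nonzero[OF four] nn ht hn[OF y]])
qed

lemma edge_pt_lam:
  assumes f: "four i n a b" and y: "lam i y = 0" "lam n y = 0"
  shows "edge_pt a b (lam b y) = y"
  using face_pt_lam[OF four_swap(2)[OF f] y(1)] y(2) by (simp add: face_pt_def edge_pt_def)

theorem unisolvence:
  assumes w: "\<omega>\<^sub>1 \<in> M_space r x" "\<omega>\<^sub>2 \<in> M_space r x"
    and nF: "\<forall>F\<in>faces. outward_unit_normal (tetra x) (face_of_tetra x F) (n_face F)"
    and nE: "\<forall>e\<in>edges. orthonormal_normals (edge_of_tetra x e) (n_plus e) (n_minus e)"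
    and V: "\<forall>i\<le>3. \<forall>\<alpha>. mi_order \<alpha> \<le> 2 \<longrightarrow> mi_der (tetra x) \<alpha> \<omega>\<^sub>1 (x i) = mi_der (tetra x) \<alpha> \<omega>\<^sub>2 (x i)"
    and E0: "\<forall>e\<in>edges. \<forall>\<sigma>\<in>polys (int r - 6) (edge_of_tetra x e).
           edge_integral x e (\<lambda>y. \<omega>\<^sub>1 y * \<sigma> y) = edge_integral x e (\<lambda>y. \<omega>\<^sub>2 y * \<sigma> y)"
    and E1: "\<forall>e\<in>edges. \<forall>n\<in>{n_plus e, n_minus e}. \<forall>\<sigma>\<in>polys (int r - 5) (edge_of_tetra x e).
           edge_integral x e (\<lambda>y. (grad (tetra x) \<omega>\<^sub>1 y \<bullet> n) * \<sigma> y) =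
           edge_integral x e (\<lambda>y. (grad (tetra x) \<omega>\<^sub>2 y \<bullet> n) * \<sigma> y)"
    and F0: "\<forall>F\<in>faces. \<forall>\<sigma>\<in>polys (int r - 6) (face_of_tetra x F).
           face_integral x F (\<lambda>y. \<omega>\<^sub>1 y * \<sigma> y) = face_integral x F (\<lambda>y. \<omega>\<^sub>2 y * \<sigma> y)"
    and F1: "\<forall>F\<in>faces. \<forall>\<sigma>\<in>polys (int r - 4) (face_of_tetra x F).
           face_integral x F (\<lambda>y. (grad (tetra x) \<omega>\<^sub>1 y \<bullet> n_face F) * \<sigma> y) =
           face_integral x F (\<lambda>y. (grad (tetra x) \<omega>\<^sub>2 y \<bullet> n_face F) * \<sigma> y)"
    and G: "\<forall>\<sigma>\<in>M_ring_space r x.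
           integral (tetra x) (\<lambda>y. grad (tetra x) \<omega>\<^sub>1 y \<bullet> grad (tetra x) \<sigma> y) =
           integral (tetra x) (\<lambda>y. grad (tetra x) \<omega>\<^sub>2 y \<bullet> grad (tetra x) \<sigma> y)"
  shows "\<omega>\<^sub>1 = \<omega>\<^sub>2"
proof -
  obtain f g where f: "spline_family (int r) f" "\<omega>\<^sub>1 = glue f" and g: "spline_family (int r) g" "\<omega>\<^sub>2 = glue g"
    using w unfolding M_space_iff by blast
  let ?h = "\<lambda>i y. f i y - g i y"
  have V': "mi_der (tetra x) \<alpha> (glue f) (x m) = mi_der (tetra x) \<alpha> (glue g) (x m)" if "m \<le> 3" "mi_order \<alpha> \<le> 2" for m \<alpha>
    using V that unfolding f(2) g(2) by blast
  have edge1: "?h i y = 0 \<and> dird v (?h i) y = 0"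
    if four: "four i n a b" and ab: "a < b" and y: "lam i y = 0" "lam n y = 0" for i n a b y v
  proof -
    have ne: "i \<noteq> a" "i \<noteq> b" and i: "i \<le> 3" using four four_le[OF four] by (auto simp: four_def)
    have e: "(a, b) \<in> edges" using ab four_le[OF four] by (simp add: edges_def)
    note ed = edge_determined[OF f(1) g(1) e i ne bspec[OF nE e] V']
    have "?h i (edge_pt a b t) = 0 \<and> dird v (?h i) (edge_pt a b t) = 0" for t
      by (intro conjI ed) (use E0 E1 e in \<open>auto simp: f(2) g(2)\<close>)
    from this[of "lam b y"] show ?thesis unfolding edge_pt_lam[OF four y] .
  qed
  have edge: "?h i y = 0 \<and> dird v (?h i) y = 0"
    if four: "four i n a b" and y: "lam i y = 0" "lam n y = 0" for i n a b y v
  proof (cases "a < b")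
    case True
    show ?thesis by (rule edge1[OF four True y])
  next
    case False
    then have "b < a" using four by (auto simp: four_def)
    show ?thesis by (rule edge1[OF four_swap(3)[OF four] \<open>b < a\<close> y])
  qed
  have face: "?h i y = 0 \<and> dird v (?h i) y = 0" if i: "i \<le> 3" and y: "lam i y = 0" for i y v
  proof -
    have "\<exists>a b c. (a, b, c) \<in> faces \<and> four i a b c"
    proof -
      have "i \<in> {0, 1, 2, 3}" using i unfolding atMost_3[symmetric] by simp
      then have "(opp1 i, opp2 i, opp3 i) \<in> faces" by (auto simp: faces_eq opp1_def opp2_def opp3_def)
      with four_opp[OF i] show ?thesis by blast
    qed
    then obtain a b c where F: "(a, b, c) \<in> faces" and four: "four i a b c" by blast
    have z: "?h i y = 0 \<and> dird v (?h i) y = 0" if "lam i y = 0" "lam a y = 0 \<or> lam b y = 0 \<or> lam c y = 0" for y v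
      using that(2) edge[OF four that(1)] edge[OF four_swap(2)[OF four] that(1)]
        edge[OF four_swap(2)[OF four_swap(3)[OF four]] that(1)] by blast
    have z': "?h i y = 0" "dird v (?h i) y = 0" if "lam i y = 0" "lam a y = 0 \<or> lam b y = 0 \<or> lam c y = 0" for y v
      using z[OF that] by blast+
    note fd = face_determined[OF f(1) g(1) four bspec[OF nF F] refl z' bspec[OF bspec[OF F0 F], unfolded f(2) g(2)]
        bspec[OF bspec[OF F1 F], unfolded f(2) g(2)] y]
    show ?thesis by (rule conjI; rule fd)
  qed
  have "glue ?h \<in> M_ring_space r x"
    unfolding M_ring_iff using spline_family_diff[OF f(1) g(1)] face by blast
  from bspec[OF G this] have eq: "integral (tetra x) (\<lambda>y. grad (tetra x) (glue f) y \<bullet> grad (tetra x) (glue ?h) y)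
      = integral (tetra x) (\<lambda>y. grad (tetra x) (glue g) y \<bullet> grad (tetra x) (glue ?h) y)" unfolding f(2) g(2) .
  have c: "continuous_on (tetra x) (grad (tetra x) (glue f))" "continuous_on (tetra x) (grad (tetra x) (glue g))"
    using w unfolding f(2) g(2) by (auto simp: M_space_def)
  have "f 1 (x 0) = g 1 (x 0)"
    using face[of 1 "x 0"] by (simp add: lam_x)
  from energy_zero[OF f(1) g(1) _ this _ _ c eq] show ?thesis by (simp add: f(2) g(2))
qed

end

theorem lemma4p8:
  fixes x :: "nat \<Rightarrow> real^3" and r :: nat
    and n_face :: "nat \<times> nat \<times> nat \<Rightarrow> real^3"
    and n_plus n_minus :: "nat \<times> nat \<Rightarrow> real^3"
  defines "T \<equiv> tetra x"
  assumes "nondegenerate x" and "r \<ge> 5"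
    and "\<forall>F\<in>faces. outward_unit_normal T (face_of_tetra x F) (n_face F)"
    and "\<forall>e\<in>edges. orthonormal_normals (edge_of_tetra x e) (n_plus e) (n_minus e)"
  shows
    "(\<forall>\<omega>\<^sub>1 \<in> M_space r x. \<forall>\<omega>\<^sub>2 \<in> M_space r x.
        (\<forall>i\<le>3. \<forall>\<alpha>. mi_order \<alpha> \<le> 2 \<longrightarrow> mi_der T \<alpha> \<omega>\<^sub>1 (x i) = mi_der T \<alpha> \<omega>\<^sub>2 (x i)) \<and>
        (\<forall>e\<in>edges. \<forall>\<sigma>\<in>polys (int r - 6) (edge_of_tetra x e).
           edge_integral x e (\<lambda>y. \<omega>\<^sub>1 y * \<sigma> y) = edge_integral x e (\<lambda>y. \<omega>\<^sub>2 y * \<sigma> y)) \<and>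
        (\<forall>e\<in>edges. \<forall>n\<in>{n_plus e, n_minus e}. \<forall>\<sigma>\<in>polys (int r - 5) (edge_of_tetra x e).
           edge_integral x e (\<lambda>y. (grad T \<omega>\<^sub>1 y \<bullet> n) * \<sigma> y) =
           edge_integral x e (\<lambda>y. (grad T \<omega>\<^sub>2 y \<bullet> n) * \<sigma> y)) \<and>
        (\<forall>F\<in>faces. \<forall>\<sigma>\<in>polys (int r - 6) (face_of_tetra x F).
           face_integral x F (\<lambda>y. \<omega>\<^sub>1 y * \<sigma> y) = face_integral x F (\<lambda>y. \<omega>\<^sub>2 y * \<sigma> y)) \<and>
        (\<forall>F\<in>faces. \<forall>\<sigma>\<in>polys (int r - 4) (face_of_tetra x F).
           face_integral x F (\<lambda>y. (grad T \<omega>\<^sub>1 y \<bullet> n_face F) * \<sigma> y) =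
           face_integral x F (\<lambda>y. (grad T \<omega>\<^sub>2 y \<bullet> n_face F) * \<sigma> y)) \<and>
        (\<forall>\<sigma>\<in>M_ring_space r x.
           integral T (\<lambda>y. grad T \<omega>\<^sub>1 y \<bullet> grad T \<sigma> y) =
           integral T (\<lambda>y. grad T \<omega>\<^sub>2 y \<bullet> grad T \<sigma> y))
        \<longrightarrow> \<omega>\<^sub>1 = \<omega>\<^sub>2) \<and>
     card ({..3::nat} \<times> {\<alpha>. mi_order \<alpha> \<le> 2}) = 40 \<and>
     real (\<Sum>e\<in>edges. fun_dim (polys (int r - 6) (edge_of_tetra x e))) = 6 * (real r - 5) \<and>
     real (\<Sum>e\<in>edges. 2 * fun_dim (polys (int r - 5) (edge_of_tetra x e))) = 12 * (real r - 4) \<and>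
     real (\<Sum>F\<in>faces. fun_dim (polys (int r - 6) (face_of_tetra x F)))
       = 4 * ((real r - 5) * (real r - 4) / 2) \<and>
     real (\<Sum>F\<in>faces. fun_dim (polys (int r - 4) (face_of_tetra x F)))
       = 4 * ((real r - 3) * (real r - 2) / 2) \<and>
     real (fun_dim (M_ring_space r x)) = 2 * ((real r - 4) * (real r - 3) * (real r - 2) / 3)"
proof -
  interpret tetrahedron x by unfold_locales (rule \<open>nondegenerate x\<close>)
  have d1: "card ({..3::nat} \<times> {\<alpha>. mi_order \<alpha> \<le> 2}) = 40"
    by (simp add: card_cartesian_product card_multi_indices)
  have d2: "real (\<Sum>e\<in>edges. fun_dim (polys (int r - 6) (edge_of_tetra x e))) = 6 * (real r - 5)"
    using \<open>r \<ge> 5\<close> by (subst sum_dim_edges) auto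
  have d3: "real (\<Sum>e\<in>edges. 2 * fun_dim (polys (int r - 5) (edge_of_tetra x e))) = 12 * (real r - 4)"
    using \<open>r \<ge> 5\<close> unfolding sum_distrib_left[symmetric] by (subst sum_dim_edges) auto
  have "real_of_int (2 * int (\<Sum>F\<in>faces. fun_dim (polys (int r - 6) (face_of_tetra x F)))) = 4 * ((real r - 5) * (real r - 4))"
    using \<open>r \<ge> 5\<close> by (subst sum_dim_faces) auto
  then have d4: "real (\<Sum>F\<in>faces. fun_dim (polys (int r - 6) (face_of_tetra x F))) = 4 * ((real r - 5) * (real r - 4) / 2)"
    by simp
  have "real_of_int (2 * int (\<Sum>F\<in>faces. fun_dim (polys (int r - 4) (face_of_tetra x F)))) = 4 * ((real r - 3) * (real r - 2))"
    using \<open>r \<ge> 5\<close> by (subst sum_dim_faces) auto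
  then have d5: "real (\<Sum>F\<in>faces. fun_dim (polys (int r - 4) (face_of_tetra x F))) = 4 * ((real r - 3) * (real r - 2) / 2)"
    by simp
  have d6: "real (fun_dim (M_ring_space r x)) = 2 * ((real r - 4) * (real r - 3) * (real r - 2) / 3)"
    using \<open>r \<ge> 5\<close> by (intro dim_M_ring) simp
  show ?thesis
    unfolding T_def
    by (intro conjI ballI impI, elim conjE, (rule unisolvence[OF _ _ assms(4,5)[unfolded T_def]]; assumption),
      (rule d1 d2 d3 d4 d5 d6)+)
qed

end
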